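(* Let $M=\mathbb{R}/\mathbb{Z}$, let $f_0:M\to M$ be a $C^2$ local diffeomorphism with a unique saddle-node fixed point $0$ ($f_0(0)=0$, $f_0'(0)=1$, $f_0''(0)>0$), such that $|f_0'(x)|>1$ for all $x\in M\setminus W_0$, where $W_0$ is the connected component containing $0$ of $\{x: f_0^k(x)\to0\}$, and let $(f_t)_t$ be a generic unfolding of $f_0$. Let $t_0>0$ be such that for each $t\in(0,t_0)$ the map $f_t$ is uniformly expanding and has a unique ergodic absolutely continuous invariant probability $\mu_t$. Then for every weak$^*$ accumulation point $\mu_0$ of $\mu_t$ as $t\to0^+$, $$\limsup_{t\to0^+}h_{\mu_t}(f_t)\le h_{\mu_0}(f_0).$$
   Context: A generic unfolding of $f_0$ is a one-parameter family of $C^2$ local diffeomorphisms $f_t:M\to M$ with $f(x,t)=f_t(x)$, $f(\cdot,0)=f_0$, $f(0,0)=0$, $\partial_xf(0,0)=1$, $\partial_x^2f(0,0)>0$, $\partial_tf(0,0)>0$. $h_\mu(f)$ denotes metric entropy. *)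

theory Defs
  imports "HOL-Analysis.Analysis" "HOL-Probability.Probability"
begin

definition C1_on :: "(real \<times> real) set \<Rightarrow> (real \<times> real \<Rightarrow> real) \<Rightarrow> bool" where
  "C1_on U g \<longleftrightarrow> (\<exists>g'. (\<forall>p\<in>U. (g has_derivative g' p) (at p)) \<and>
                        (\<forall>v. continuous_on U (\<lambda>p. g' p v)))"

definition C2_on :: "(real \<times> real) set \<Rightarrow> (real \<times> real \<Rightarrow> real) \<Rightarrow> bool" where
  "C2_on U g \<longleftrightarrow> (\<exists>g'. (\<forall>p\<in>U. (g has_derivative g' p) (at p)) \<and>
                        (\<forall>v. C1_on U (\<lambda>p. g' p v)))"

text \<open>A circle map is given by a lift F : R \<rightarrow> R; the induced map on [0,1) is frac o F.\<close>

definition circle_map :: "(real \<Rightarrow> real) \<Rightarrow> real \<Rightarrow> real" where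
  "circle_map F x = frac (F x)"

definition cdist0 :: "real \<Rightarrow> real" where
  "cdist0 y = \<bar>y - of_int (round y)\<bar>"

text \<open>Lift to R of the basin {x. f^k(x) \<rightarrow> 0} (a 1-periodic set).\<close>
definition basin0 :: "(real \<Rightarrow> real) \<Rightarrow> real set" where
  "basin0 F = {x. (\<lambda>k. cdist0 ((F ^^ k) x)) \<longlonglongrightarrow> 0}"

text \<open>Lift to R of W_0, the connected component of the basin containing 0
  (the union of all integer translates of the component of 0 in R).\<close>
definition W0_lift :: "(real \<Rightarrow> real) \<Rightarrow> real set" where
  "W0_lift F = {x. \<exists>n::int. x - of_int n \<in> connected_component_set (basin0 F) 0}"

definition uniformly_expanding :: "(real \<Rightarrow> real) \<Rightarrow> bool" where
  "uniformly_expanding F \<longleftrightarrow>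
     (\<exists>C>0. \<exists>lam>1. \<forall>n x. \<bar>deriv (F ^^ n) x\<bar> \<ge> C * lam ^ n)"

definition circle_meas :: "real measure" where
  "circle_meas = restrict_space lborel {0..<1}"

definition prob_on_M :: "real measure \<Rightarrow> bool" where
  "prob_on_M \<mu> \<longleftrightarrow> prob_space \<mu> \<and> sets \<mu> = sets circle_meas"

definition invariant_meas :: "real measure \<Rightarrow> (real \<Rightarrow> real) \<Rightarrow> bool" where
  "invariant_meas \<mu> g \<longleftrightarrow> g \<in> measurable \<mu> \<mu> \<and> distr \<mu> \<mu> g = \<mu>"

definition ergodic_meas :: "real measure \<Rightarrow> (real \<Rightarrow> real) \<Rightarrow> bool" where
  "ergodic_meas \<mu> g \<longleftrightarrow> invariant_meas \<mu> g \<and>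
     (\<forall>A\<in>sets \<mu>. g -` A \<inter> space \<mu> = A \<longrightarrow> measure \<mu> A = 0 \<or> measure \<mu> A = 1)"

definition acip :: "real measure \<Rightarrow> bool" where
  "acip \<mu> \<longleftrightarrow> prob_on_M \<mu> \<and> absolutely_continuous circle_meas \<mu>"

definition eta :: "real \<Rightarrow> real" where
  "eta m = (if m = 0 then 0 else - m * ln m)"

definition meas_partition :: "'a measure \<Rightarrow> 'a set set \<Rightarrow> bool" where
  "meas_partition \<mu> P \<longleftrightarrow> finite P \<and> P \<subseteq> sets \<mu> \<and> \<Union>P = space \<mu> \<and> disjoint P"

definition part_entropy :: "'a measure \<Rightarrow> 'a set set \<Rightarrow> real" where
  "part_entropy \<mu> P = (\<Sum>A\<in>P. eta (measure \<mu> A))"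

definition refine :: "'a measure \<Rightarrow> ('a \<Rightarrow> 'a) \<Rightarrow> 'a set set \<Rightarrow> nat \<Rightarrow> 'a set set" where
  "refine \<mu> g P n = {space \<mu> \<inter> (\<Inter>i\<in>{..<n}. (g ^^ i) -` A i) | A. \<forall>i<n. A i \<in> P}"

definition entropy_part :: "'a measure \<Rightarrow> ('a \<Rightarrow> 'a) \<Rightarrow> 'a set set \<Rightarrow> real" where
  "entropy_part \<mu> g P = lim (\<lambda>n. part_entropy \<mu> (refine \<mu> g P n) / real n)"

definition ks_entropy :: "'a measure \<Rightarrow> ('a \<Rightarrow> 'a) \<Rightarrow> ereal" where
  "ks_entropy \<mu> g = (SUP P\<in>{P. meas_partition \<mu> P}. ereal (entropy_part \<mu> g P))"

end

(*
  Since entropy is nonnegative, it suffices that h(f_t) tends to 0.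

  The measures mu_t concentrate at the neutral point 0. Let L be the transfer operator of f_0
  and w_n = L^n 1. Outside W_0 the map f_0 is expanding with a neutral endpoint, and f''(0) > 0
  gives a cone of functions with controlled distortion which L preserves; since mass is lost through
  the preimages of W_0, the sum of all w_n is bounded off every neighbourhood of 0, while sup w_n
  grows subexponentially. Hence w = sum_{k<n} (1+eps)^(-k) w_k satisfies L w <= (1+eps)(w - 1/2)
  with w bounded off a neighbourhood U of 0 independently of eps. This persists, with slightly worse
  constants, for f_t with t small. As mu_t is invariant and absolutely continuous, the integral of
  ln(L_t w / w) with respect to mu_t is nonnegative, which forces mu_t(U^c) to be small.

  For small t a fixed partition into short arcs, with 0 interior to one of them, generates for the
  expanding map f_t, so h(f_t) is at most the entropy of that partition, which tends to 0.
*)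
theory Submission
  imports Defs
begin

section \<open>Entropy of simple functions\<close>

text \<open>No density bound for \<open>\<mu> t\<close> uniform in t is at hand, since the expansion
  of \<open>F t\<close> degenerates at 0 as t tends to 0. Hence the estimates are made once, for
  \<open>F 0\<close>, and carried over by one function: w is fixed before t, so an inequality for L
  w with slack survives a C^1 perturbation and can be tested against any absolutely continuous
  invariant measure. Absolute continuity is essential: the repelling fixed point p at the other end
  of the basin carries an invariant Dirac mass away from 0.

  The circle is cut at p into [p, p + 1]. On (0, p + 1] the map expands, and distortion is
  controlled by a weight singular at 0. On [p, 0], the closure of the immediate basin, the iterates
  of 1 are instead followed along the single inverse branch that stays in [p, 0]; all other branches
  land in the expanding part.

  The 1/2 is the balance of a telescoping sum that loses 1 and regains at most 1/2. The number N of
  arcs depends only on a bound for the derivatives near t = 0, so it is fixed before the mass off 0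
  is made small.\<close>

definition ent :: "'a measure \<Rightarrow> ('a \<Rightarrow> 'b) \<Rightarrow> real" where
  "ent M X = (\<Sum>x\<in>X ` space M. eta (measure M (X -` {x} \<inter> space M)))"

lemma eta_eq: "eta m = - m * ln m"
  by (simp add: eta_def)

lemma eta_nonneg: "0 \<le> m \<Longrightarrow> m \<le> 1 \<Longrightarrow> 0 \<le> eta m"
  by (cases "m = 0") (auto simp: eta_def mult_nonneg_nonpos)

text \<open>The inequality ln (1/s) <= 1/s - 1 at s = sqrt m. It serves as a modulus of continuity
  of \<open>eta\<close> at 0, for cells of small mass.\<close>

lemma eta_le_sqrt:
  assumes "0 \<le> m" shows "eta m \<le> 2 * sqrt m"
proof (cases "m = 0")
  case False
  with assms have m: "m > 0" by simp
  define s where "s = sqrt m"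
  have s: "s > 0" "m = s * s" using m by (auto simp: s_def)
  have "ln (1 / s) \<le> 1 / s - 1" using s by (intro ln_le_minus_one) auto
  moreover have "ln (1 / s) = - ln s" using s by (simp add: ln_div)
  ultimately have l: "- ln s \<le> 1 / s" by linarith
  have "s * s * (- 2 * ln s) \<le> s * s * (2 * (1/s))" using s l by (intro mult_left_mono) auto
  moreover have "eta m = s * s * (- 2 * ln s)" unfolding s(2) eta_eq using s(1) by (simp add: ln_mult)
  moreover have "s * s * (2 * (1/s)) = 2 * s" using s(1) by simp
  ultimately show ?thesis unfolding s_def by linarith
qed (simp add: eta_def)

text \<open>Strong subadditivity. For each z the joint weights are compared with
  \<open>pxz x z * pyz y z / pz z\<close>, the weights that make x and y conditionally independent
  given z; both families have total mass \<open>pz z\<close>, so ln t <= t - 1 yields the Gibbs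
  inequality.\<close>

lemma sum_submod:
  fixes p :: "'a \<Rightarrow> 'b \<Rightarrow> 'c \<Rightarrow> real"
  assumes fin: "finite A" "finite B" "finite C"
  and p0: "\<And>x y z. p x y z \<ge> 0"
  shows "(\<Sum>x\<in>A. \<Sum>y\<in>B. \<Sum>z\<in>C. eta (p x y z)) + (\<Sum>z\<in>C. eta (\<Sum>x\<in>A. \<Sum>y\<in>B. p x y z))
    \<le> (\<Sum>x\<in>A. \<Sum>z\<in>C. eta (\<Sum>y\<in>B. p x y z)) + (\<Sum>y\<in>B. \<Sum>z\<in>C. eta (\<Sum>x\<in>A. p x y z))"
proof -
  define pz where "pz z = (\<Sum>x\<in>A. \<Sum>y\<in>B. p x y z)" for z
  define pxz where "pxz x z = (\<Sum>y\<in>B. p x y z)" for x z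
  define pyz where "pyz y z = (\<Sum>x\<in>A. p x y z)" for y z
  have pz_x: "(\<Sum>x\<in>A. pxz x z) = pz z" for z by (simp add: pz_def pxz_def)
  have pz_y: "(\<Sum>y\<in>B. pyz y z) = pz z" for z unfolding pz_def pyz_def by (rule sum.swap)
  have nn: "pz z \<ge> 0" "pxz x z \<ge> 0" "pyz y z \<ge> 0" for x y z
    by (auto simp: pz_def pxz_def pyz_def intro!: sum_nonneg p0)
  have key: "(\<Sum>x\<in>A. \<Sum>y\<in>B. eta (p x y z)) + eta (pz z) \<le> (\<Sum>x\<in>A. eta (pxz x z)) + (\<Sum>y\<in>B. eta (pyz y z))" for z
  proof -
    have tm: "p x y z * (ln (pxz x z) + ln (pyz y z) - ln (p x y z) - ln (pz z)) \<le> pxz x z * pyz y z / pz z - p x y z"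
      if x: "x \<in> A" and y: "y \<in> B" for x y
    proof (cases "p x y z = 0")
      case True thus ?thesis using nn by simp
    next
      case False
      hence p: "p x y z > 0" using p0[of x y z] by simp
      have 1: "pxz x z > 0" unfolding pxz_def using fin y p p0 by (intro sum_pos2[of _ y]) auto
      have 2: "pyz y z > 0" unfolding pyz_def using fin x p p0 by (intro sum_pos2[of _ x]) auto
      have 3: "pz z > 0" unfolding pz_x[symmetric] using fin x 1 nn by (intro sum_pos2[of _ x]) auto
      have "ln (pxz x z) + ln (pyz y z) - ln (p x y z) - ln (pz z) = ln (pxz x z * pyz y z / (p x y z * pz z))"
        using p 1 2 3 by (simp add: ln_mult ln_div)
      also have "\<dots> \<le> pxz x z * pyz y z / (p x y z * pz z) - 1"
        using p 1 2 3 by (intro ln_le_minus_one) auto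
      finally have "p x y z * (ln (pxz x z) + ln (pyz y z) - ln (p x y z) - ln (pz z)) \<le> p x y z * (pxz x z * pyz y z / (p x y z * pz z) - 1)"
        using p by (intro mult_left_mono) auto
      also have "\<dots> = pxz x z * pyz y z / pz z - p x y z" using p 3 by (simp add: field_simps)
      finally show ?thesis .
    qed
    have "(\<Sum>x\<in>A. \<Sum>y\<in>B. p x y z * (ln (pxz x z) + ln (pyz y z) - ln (p x y z) - ln (pz z)))
      \<le> (\<Sum>x\<in>A. \<Sum>y\<in>B. pxz x z * pyz y z / pz z - p x y z)"
      by (intro sum_mono tm)
    also have "\<dots> = (\<Sum>x\<in>A. \<Sum>y\<in>B. pxz x z * pyz y z / pz z) - pz z"
      by (simp add: sum_subtractf pz_def)
    also have "(\<Sum>x\<in>A. \<Sum>y\<in>B. pxz x z * pyz y z / pz z) = pz z"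
    proof -
      have "(\<Sum>x\<in>A. \<Sum>y\<in>B. pxz x z * pyz y z / pz z) = (\<Sum>x\<in>A. pxz x z) * (\<Sum>y\<in>B. pyz y z) / pz z"
        unfolding sum_product by (simp add: sum_divide_distrib)
      thus ?thesis by (simp add: pz_x pz_y)
    qed
    finally have le: "(\<Sum>x\<in>A. \<Sum>y\<in>B. p x y z * (ln (pxz x z) + ln (pyz y z) - ln (p x y z) - ln (pz z))) \<le> 0" by simp
    have e1: "(\<Sum>x\<in>A. \<Sum>y\<in>B. p x y z * ln (pxz x z)) = - (\<Sum>x\<in>A. eta (pxz x z))"
      by (simp add: eta_eq sum_distrib_right[symmetric] pxz_def[symmetric] sum_negf)
    have e2: "(\<Sum>x\<in>A. \<Sum>y\<in>B. p x y z * ln (pyz y z)) = - (\<Sum>y\<in>B. eta (pyz y z))"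
      by (subst sum.swap) (simp add: eta_eq sum_distrib_right[symmetric] pyz_def[symmetric] sum_negf)
    have e3: "(\<Sum>x\<in>A. \<Sum>y\<in>B. p x y z * ln (pz z)) = - eta (pz z)"
      by (simp add: eta_eq sum_distrib_right[symmetric] pz_def[symmetric])
    have e4: "(\<Sum>x\<in>A. \<Sum>y\<in>B. p x y z * ln (p x y z)) = - (\<Sum>x\<in>A. \<Sum>y\<in>B. eta (p x y z))"
      by (simp add: eta_eq sum_negf)
    show ?thesis using le by (simp add: ring_distribs sum.distrib sum_subtractf e1 e2 e3 e4)
  qed
  have "(\<Sum>z\<in>C. (\<Sum>x\<in>A. \<Sum>y\<in>B. eta (p x y z)) + eta (pz z)) \<le> (\<Sum>z\<in>C. (\<Sum>x\<in>A. eta (pxz x z)) + (\<Sum>y\<in>B. eta (pyz y z)))"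
    by (intro sum_mono key)
  moreover have "(\<Sum>z\<in>C. \<Sum>x\<in>A. \<Sum>y\<in>B. eta (p x y z)) = (\<Sum>x\<in>A. \<Sum>y\<in>B. \<Sum>z\<in>C. eta (p x y z))"
    by (subst sum.swap, intro sum.cong refl, subst sum.swap) simp
  moreover have "(\<Sum>z\<in>C. \<Sum>x\<in>A. eta (pxz x z)) = (\<Sum>x\<in>A. \<Sum>z\<in>C. eta (pxz x z))" by (rule sum.swap)
  moreover have "(\<Sum>z\<in>C. \<Sum>y\<in>B. eta (pyz y z)) = (\<Sum>y\<in>B. \<Sum>z\<in>C. eta (pyz y z))" by (rule sum.swap)
  ultimately show ?thesis by (simp add: sum.distrib pz_def pxz_def pyz_def)
qed

lemma ent_superset:
  assumes "finite S" "X ` space M \<subseteq> S"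
  shows "ent M X = (\<Sum>x\<in>S. eta (measure M (X -` {x} \<inter> space M)))"
  unfolding ent_def
proof (rule sum.mono_neutral_left[OF assms], rule ballI)
  fix x assume "x \<in> S - X ` space M"
  hence "X -` {x} \<inter> space M = {}" by auto
  thus "eta (measure M (X -` {x} \<inter> space M)) = 0" by (simp add: eta_def)
qed

lemma ent_cong:
  assumes "\<And>w. w \<in> space M \<Longrightarrow> X w = Y w"
  shows "ent M X = ent M Y"
proof -
  have "X ` space M = Y ` space M" using assms by auto
  moreover have "X -` {x} \<inter> space M = Y -` {x} \<inter> space M" for x using assms by auto
  ultimately show ?thesis by (simp add: ent_def)
qed

lemma ent_inj:
  assumes "inj_on f (X ` space M)"
  shows "ent M (\<lambda>w. f (X w)) = ent M X"
proof -
  have "(\<lambda>w. f (X w)) -` {f x} \<inter> space M = X -` {x} \<inter> space M" if "x \<in> X ` space M" for x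
    using assms that by (auto simp: inj_on_def)
  moreover have "(\<lambda>w. f (X w)) ` space M = f ` X ` space M" by auto
  ultimately show ?thesis unfolding ent_def by (simp add: sum.reindex[OF assms])
qed

lemma ent_inj':
  assumes "inj f"
  shows "ent M (\<lambda>w. f (X w)) = ent M X"
  by (rule ent_inj) (use assms in \<open>auto simp: inj_on_def\<close>)

lemma measure_simple_split:
  assumes "finite_measure M" "simple_function M Y" "E \<in> sets M" "Y ` space M \<subseteq> S" "finite S"
  shows "measure M E = (\<Sum>y\<in>S. measure M (E \<inter> (Y -` {y} \<inter> space M)))"
proof -
  interpret finite_measure M by fact
  have m: "Y -` {y} \<inter> space M \<in> sets M" for y by (rule simple_functionD(2)[OF assms(2)])
  have "E = (\<Union>y\<in>S. E \<inter> (Y -` {y} \<inter> space M))"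
    using assms(4) sets.sets_into_space[OF assms(3)] by auto
  hence "measure M E = measure M (\<Union>y\<in>S. E \<inter> (Y -` {y} \<inter> space M))" by simp
  also have "\<dots> = (\<Sum>y\<in>S. measure M (E \<inter> (Y -` {y} \<inter> space M)))"
    using assms m by (intro finite_measure_finite_Union) (auto simp: disjoint_family_on_def)
  finally show ?thesis .
qed

context prob_space begin

lemma ent_nonneg: "0 \<le> ent M X"
  unfolding ent_def by (intro sum_nonneg eta_nonneg) auto

text \<open>Simple functions stand for partitions, so that a join is a pair and the conditional
  entropy H(X | Z) is the difference of \<open>ent\<close> at (X, Z) and at Z. In this notation the
  inequality is H(X | Y, Z) <= H(X | Z).\<close>

lemma ent_submod:
  assumes X: "simple_function M X" and Y: "simple_function M Y" and Z: "simple_function M Z"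
  shows "ent M (\<lambda>w. (X w, Y w, Z w)) + ent M Z \<le> ent M (\<lambda>w. (X w, Z w)) + ent M (\<lambda>w. (Y w, Z w))"
proof -
  let ?A = "X ` space M" and ?B = "Y ` space M" and ?C = "Z ` space M"
  have fin: "finite ?A" "finite ?B" "finite ?C" using assms by (auto dest: simple_functionD(1))
  have mX: "X -` {x} \<inter> space M \<in> sets M" for x by (rule simple_functionD(2)[OF X])
  have mY: "Y -` {x} \<inter> space M \<in> sets M" for x by (rule simple_functionD(2)[OF Y])
  have mZ: "Z -` {x} \<inter> space M \<in> sets M" for x by (rule simple_functionD(2)[OF Z])
  define p where "p x y z = measure M ((\<lambda>w. (X w, Y w, Z w)) -` {(x,y,z)} \<inter> space M)" for x y z
  have p_eq: "p x y z = measure M ((X -` {x} \<inter> space M) \<inter> ((Y -` {y} \<inter> space M) \<inter> (Z -` {z} \<inter> space M)))" for x y z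
    unfolding p_def by (intro arg_cong[where f="measure M"]) auto
  have pxz: "measure M ((\<lambda>w. (X w, Z w)) -` {(x,z)} \<inter> space M) = (\<Sum>y\<in>?B. p x y z)" for x z
  proof -
    have "measure M ((\<lambda>w. (X w, Z w)) -` {(x,z)} \<inter> space M) = measure M ((X -` {x} \<inter> space M) \<inter> (Z -` {z} \<inter> space M))"
      by (intro arg_cong[where f="measure M"]) auto
    also have "\<dots> = (\<Sum>y\<in>?B. measure M (((X -` {x} \<inter> space M) \<inter> (Z -` {z} \<inter> space M)) \<inter> (Y -` {y} \<inter> space M)))"
      using fin Y mX mZ by (intro measure_simple_split finite_measure_axioms) auto
    also have "\<dots> = (\<Sum>y\<in>?B. p x y z)"
      unfolding p_eq by (intro sum.cong refl arg_cong[where f="measure M"]) auto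
    finally show ?thesis .
  qed
  have pyz: "measure M ((\<lambda>w. (Y w, Z w)) -` {(y,z)} \<inter> space M) = (\<Sum>x\<in>?A. p x y z)" for y z
  proof -
    have "measure M ((\<lambda>w. (Y w, Z w)) -` {(y,z)} \<inter> space M) = measure M ((Y -` {y} \<inter> space M) \<inter> (Z -` {z} \<inter> space M))"
      by (intro arg_cong[where f="measure M"]) auto
    also have "\<dots> = (\<Sum>x\<in>?A. measure M (((Y -` {y} \<inter> space M) \<inter> (Z -` {z} \<inter> space M)) \<inter> (X -` {x} \<inter> space M)))"
      using fin X mY mZ by (intro measure_simple_split finite_measure_axioms) auto
    also have "\<dots> = (\<Sum>x\<in>?A. p x y z)"
      unfolding p_eq by (intro sum.cong refl arg_cong[where f="measure M"]) auto
    finally show ?thesis .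
  qed
  have pz: "measure M (Z -` {z} \<inter> space M) = (\<Sum>x\<in>?A. \<Sum>y\<in>?B. p x y z)" for z
  proof -
    have "measure M (Z -` {z} \<inter> space M) = (\<Sum>x\<in>?A. measure M ((Z -` {z} \<inter> space M) \<inter> (X -` {x} \<inter> space M)))"
      using fin X mZ by (intro measure_simple_split finite_measure_axioms) auto
    also have "\<dots> = (\<Sum>x\<in>?A. measure M ((\<lambda>w. (X w, Z w)) -` {(x,z)} \<inter> space M))"
      by (intro sum.cong refl arg_cong[where f="measure M"]) auto
    finally show ?thesis by (simp add: pxz)
  qed
  have "ent M (\<lambda>w. (X w, Y w, Z w)) = (\<Sum>v\<in>?A\<times>?B\<times>?C. eta (measure M ((\<lambda>w. (X w, Y w, Z w)) -` {v} \<inter> space M)))"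
    using fin by (intro ent_superset) auto
  also have "\<dots> = (\<Sum>x\<in>?A. \<Sum>y\<in>?B. \<Sum>z\<in>?C. eta (p x y z))"
    by (simp add: p_def sum.cartesian_product[symmetric] case_prod_unfold sum.Sigma[symmetric] fin)
       (simp add: sum.cartesian_product)
  finally have 1: "ent M (\<lambda>w. (X w, Y w, Z w)) = \<dots>" .
  have "ent M (\<lambda>w. (X w, Z w)) = (\<Sum>v\<in>?A\<times>?C. eta (measure M ((\<lambda>w. (X w, Z w)) -` {v} \<inter> space M)))"
    using fin by (intro ent_superset) auto
  also have "\<dots> = (\<Sum>x\<in>?A. \<Sum>z\<in>?C. eta (\<Sum>y\<in>?B. p x y z))"
    by (simp add: pxz[symmetric] sum.cartesian_product)
  finally have 2: "ent M (\<lambda>w. (X w, Z w)) = \<dots>" .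
  have "ent M (\<lambda>w. (Y w, Z w)) = (\<Sum>v\<in>?B\<times>?C. eta (measure M ((\<lambda>w. (Y w, Z w)) -` {v} \<inter> space M)))"
    using fin by (intro ent_superset) auto
  also have "\<dots> = (\<Sum>y\<in>?B. \<Sum>z\<in>?C. eta (\<Sum>x\<in>?A. p x y z))"
    by (simp add: pyz[symmetric] sum.cartesian_product)
  finally have 3: "ent M (\<lambda>w. (Y w, Z w)) = \<dots>" .
  have 4: "ent M Z = (\<Sum>z\<in>?C. eta (\<Sum>x\<in>?A. \<Sum>y\<in>?B. p x y z))"
    by (simp add: ent_def pz)
  show ?thesis unfolding 1 2 3 4
    by (rule sum_submod) (use fin in \<open>auto simp: p_def\<close>)
qed

lemma ent_const: "ent M (\<lambda>w. c) = 0"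
  using subprob_not_empty by (simp add: ent_def image_constant_conv not_empty prob_space eta_def)

lemma ent_Pair_le:
  assumes X: "simple_function M X" and Y: "simple_function M Y"
  shows "ent M (\<lambda>w. (X w, Y w)) \<le> ent M X + ent M Y"
proof -
  have "ent M (\<lambda>w. (X w, Y w, ())) + ent M (\<lambda>w. ()) \<le> ent M (\<lambda>w. (X w, ())) + ent M (\<lambda>w. (Y w, ()))"
    by (rule ent_submod[OF X Y]) simp
  moreover have "ent M (\<lambda>w. (X w, Y w, ())) = ent M (\<lambda>w. (X w, Y w))"
    using ent_inj'[of "\<lambda>(x,y). (x,y,())" M "\<lambda>w. (X w, Y w)"] by (auto simp: inj_def)
  moreover have "ent M (\<lambda>w. (X w, ())) = ent M X" by (rule ent_inj') (auto simp: inj_def)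
  moreover have "ent M (\<lambda>w. (Y w, ())) = ent M Y" by (rule ent_inj') (auto simp: inj_def)
  ultimately show ?thesis by (simp add: ent_const)
qed

lemma ent_fst_le:
  assumes X: "simple_function M X" and Y: "simple_function M Y"
  shows "ent M X \<le> ent M (\<lambda>w. (X w, Y w))"
proof -
  let ?A = "X ` space M" and ?B = "Y ` space M"
  have fin: "finite ?A" "finite ?B" using assms by (auto dest: simple_functionD(1))
  have mX: "X -` {x} \<inter> space M \<in> sets M" for x by (rule simple_functionD(2)[OF X])
  define p where "p x y = measure M ((\<lambda>w. (X w, Y w)) -` {(x,y)} \<inter> space M)" for x y
  have px: "measure M (X -` {x} \<inter> space M) = (\<Sum>y\<in>?B. p x y)" for x
  proof -
    have "measure M (X -` {x} \<inter> space M) = (\<Sum>y\<in>?B. measure M ((X -` {x} \<inter> space M) \<inter> (Y -` {y} \<inter> space M)))"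
      using fin Y mX by (intro measure_simple_split finite_measure_axioms) auto
    also have "\<dots> = (\<Sum>y\<in>?B. p x y)" unfolding p_def
      by (intro sum.cong refl arg_cong[where f="measure M"]) auto
    finally show ?thesis .
  qed
  have p0: "p x y \<ge> 0" for x y by (simp add: p_def)
  have "ent M X = (\<Sum>x\<in>?A. eta (\<Sum>y\<in>?B. p x y))" by (simp add: ent_def px)
  also have "\<dots> = (\<Sum>x\<in>?A. \<Sum>y\<in>?B. - p x y * ln (\<Sum>y\<in>?B. p x y))"
    by (simp add: eta_eq sum_distrib_right sum_negf)
  also have "\<dots> \<le> (\<Sum>x\<in>?A. \<Sum>y\<in>?B. eta (p x y))"
  proof (intro sum_mono)
    fix x y assume "x \<in> ?A" "y \<in> ?B"
    show "- p x y * ln (\<Sum>y\<in>?B. p x y) \<le> eta (p x y)"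
    proof (cases "p x y = 0")
      case False
      hence "p x y > 0" using p0[of x y] by simp
      moreover have "p x y \<le> (\<Sum>y\<in>?B. p x y)" using fin \<open>y \<in> ?B\<close> p0 by (intro member_le_sum) auto
      ultimately show ?thesis by (simp add: eta_eq)
    qed (simp add: eta_def)
  qed
  also have "\<dots> = ent M (\<lambda>w. (X w, Y w))"
    using fin by (subst ent_superset[where S="?A\<times>?B"]) (auto simp: p_def sum.cartesian_product)
  finally show ?thesis .
qed

text \<open>This is \<open>ent_submod\<close> with f(Y) as the third function: Y determines f(Y), so
  adjoining f(Y) to Y leaves the entropy unchanged.\<close>

lemma ent_cond_antimono:
  assumes X: "simple_function M X" and Y: "simple_function M Y"
  and f: "\<And>w. w \<in> space M \<Longrightarrow> Z w = f (Y w)"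
  shows "ent M (\<lambda>w. (X w, Y w)) - ent M Y \<le> ent M (\<lambda>w. (X w, Z w)) - ent M Z"
proof -
  have fY: "simple_function M (\<lambda>w. f (Y w))" by (rule simple_function_compose1[OF Y])
  have "ent M (\<lambda>w. (X w, Y w, f (Y w))) + ent M (\<lambda>w. f (Y w)) \<le> ent M (\<lambda>w. (X w, f (Y w))) + ent M (\<lambda>w. (Y w, f (Y w)))"
    by (rule ent_submod[OF X Y fY])
  moreover have "ent M (\<lambda>w. (X w, Y w, f (Y w))) = ent M (\<lambda>w. (X w, Y w))"
    using ent_inj'[of "\<lambda>(x,y). (x,y,f y)" M "\<lambda>w. (X w, Y w)"] by (auto simp: inj_def)
  moreover have "ent M (\<lambda>w. (Y w, f (Y w))) = ent M Y"
    by (rule ent_inj'[of "\<lambda>y. (y, f y)"]) (auto simp: inj_def)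
  moreover have "ent M Z = ent M (\<lambda>w. f (Y w))" by (rule ent_cong) (use f in auto)
  moreover have "ent M (\<lambda>w. (X w, Z w)) = ent M (\<lambda>w. (X w, f (Y w)))" by (rule ent_cong) (use f in auto)
  ultimately show ?thesis by linarith
qed

text \<open>A crude Fano inequality. Each diagonal cell exceeds the corresponding term of
  \<open>ent M Y\<close> by at most e, because eta p - eta q <= q - p for p <= q <= 1; each
  off-diagonal cell has mass at most e.\<close>

lemma ent_cond_fano:
  assumes X: "simple_function M X" and Y: "simple_function M Y"
  and S: "finite S" "X ` space M \<subseteq> S" "Y ` space M \<subseteq> S"
  and e: "measure M {w\<in>space M. X w \<noteq> Y w} \<le> e"
  shows "ent M (\<lambda>w. (X w, Y w)) - ent M Y \<le> real (card S) * e + real (card S)^2 * (2 * sqrt e)"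
proof -
  have mX: "X -` {x} \<inter> space M \<in> sets M" for x by (rule simple_functionD(2)[OF X])
  have mY: "Y -` {x} \<inter> space M \<in> sets M" for x by (rule simple_functionD(2)[OF Y])
  have mN: "{w\<in>space M. X w \<noteq> Y w} \<in> sets M"
  proof -
    have "simple_function M (\<lambda>w. (X w, Y w))" using X Y by simp
    hence "(\<lambda>w. (X w, Y w)) -` {(x,y). x \<noteq> y} \<inter> space M \<in> sets M" by (rule simple_functionD(2))
    moreover have "(\<lambda>w. (X w, Y w)) -` {(x,y). x \<noteq> y} \<inter> space M = {w\<in>space M. X w \<noteq> Y w}" by auto
    ultimately show ?thesis by simp
  qed
  have e0: "e \<ge> 0" using e measure_nonneg[of M "{w\<in>space M. X w \<noteq> Y w}"] by linarith
  define p where "p x y = measure M ((\<lambda>w. (X w, Y w)) -` {(x,y)} \<inter> space M)" for x y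
  define py where "py y = measure M (Y -` {y} \<inter> space M)" for y
  have p_int: "p x y = measure M ((X -` {x} \<inter> space M) \<inter> (Y -` {y} \<inter> space M))" for x y
    unfolding p_def by (intro arg_cong[where f="measure M"]) auto
  have off: "p x y \<le> e" if "x \<noteq> y" for x y
  proof -
    have "p x y \<le> measure M {w\<in>space M. X w \<noteq> Y w}"
      unfolding p_def by (rule finite_measure_mono) (use that mN in auto)
    thus ?thesis using e by linarith
  qed
  have diag1: "p y y \<le> py y" for y
    unfolding p_int py_def by (rule finite_measure_mono) (use mY in auto)
  have diag2: "py y - p y y \<le> e" for y
  proof -
    have "py y \<le> measure M ((X -` {y} \<inter> space M) \<inter> (Y -` {y} \<inter> space M) \<union> {w\<in>space M. X w \<noteq> Y w})"
      unfolding py_def by (rule finite_measure_mono) (use mX mY mN in auto)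
    also have "\<dots> \<le> p y y + measure M {w\<in>space M. X w \<noteq> Y w}"
      unfolding p_int by (rule measure_Un_le) (use mX mY mN in auto)
    finally show ?thesis using e by linarith
  qed
  have diag: "eta (p y y) - eta (py y) \<le> e" for y
  proof (cases "p y y = 0")
    case True
    have "0 \<le> eta (py y)" unfolding py_def by (intro eta_nonneg) auto
    thus ?thesis using True e0 by (simp add: eta_def)
  next
    case False
    hence p: "p y y > 0" by (simp add: p_def zero_less_measure_iff)
    hence q: "py y > 0" using diag1[of y] by linarith
    have "py y \<le> 1" by (simp add: py_def)
    hence "ln (py y) \<le> 0" using q by simp
    hence "py y * ln (py y) \<le> p y y * ln (py y)" using diag1[of y] by (intro mult_right_mono_neg) auto
    hence "eta (p y y) - eta (py y) \<le> p y y * (ln (py y) - ln (p y y))" by (simp add: eta_eq algebra_simps)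
    also have "\<dots> = p y y * ln (py y / p y y)" using p q by (simp add: ln_div)
    also have "\<dots> \<le> p y y * (py y / p y y - 1)" using p q by (intro mult_left_mono ln_le_minus_one) auto
    also have "\<dots> = py y - p y y" using p by (simp add: field_simps)
    finally show ?thesis using diag2[of y] by linarith
  qed
  have "ent M (\<lambda>w. (X w, Y w)) = (\<Sum>v\<in>S\<times>S. eta (measure M ((\<lambda>w. (X w, Y w)) -` {v} \<inter> space M)))"
    using S by (intro ent_superset) auto
  also have "\<dots> = (\<Sum>x\<in>S. \<Sum>y\<in>S. eta (p x y))"
    by (simp add: p_def sum.cartesian_product)
  also have "\<dots> \<le> (\<Sum>x\<in>S. \<Sum>y\<in>S. (if y = x then eta (py x) + e else 0) + 2 * sqrt e)"
  proof (intro sum_mono)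
    fix x y
    have sq: "eta (p x y) \<le> 2 * sqrt e" if "x \<noteq> y"
      using eta_le_sqrt[of "p x y"] off[OF that] by (smt (verit) p_def measure_nonneg real_sqrt_le_mono)
    have "0 \<le> 2 * sqrt e" using e0 by simp
    thus "eta (p x y) \<le> (if y = x then eta (py x) + e else 0) + 2 * sqrt e"
    proof (cases "y = x")
      case True
      have "eta (p x x) \<le> eta (py x) + e + 2 * sqrt e" using diag[of x] \<open>0 \<le> 2 * sqrt e\<close> by linarith
      thus ?thesis using True by simp
    next
      case False
      have "eta (p x y) \<le> 2 * sqrt e" by (rule sq) (use False in auto)
      thus ?thesis using False by simp
    qed
  qed
  also have "\<dots> = (\<Sum>x\<in>S. eta (py x)) + real (card S) * e + real (card S)^2 * (2 * sqrt e)"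
    using S(1) by (simp add: sum.distrib power2_eq_square)
  also have "(\<Sum>x\<in>S. eta (py x)) = ent M Y"
    unfolding py_def by (rule ent_superset[symmetric]) (use S in auto)
  finally show ?thesis by linarith
qed

end

text \<open>\<open>entropy_part\<close> is defined by \<open>lim\<close>, which carries information
  only when the limit exists; subadditivity provides it. The limit is the infimum of the quotients,
  and \<open>B\<close> bounds the remainder \<open>a (n mod m)\<close>.\<close>

lemma fekete:
  fixes a :: "nat \<Rightarrow> real"
  assumes nn: "\<And>n. 0 \<le> a n" and sub: "\<And>m n. a (m + n) \<le> a m + a n"
  shows "convergent (\<lambda>n. a n / real n)"
proof -
  define l where "l = (INF n\<in>{1..}. a n / real n)"
  have bdd: "bdd_below ((\<lambda>n. a n / real n) ` {1..})"
    by (rule bdd_belowI[of _ 0]) (use nn in auto)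
  have mult: "a (q * m) \<le> real q * a m" if "q \<ge> 1" for q m
    using that
  proof (induction q rule: dec_induct)
    case (step q)
    have "a (Suc q * m) \<le> a m + a (q * m)" using sub[of m "q * m"] by simp
    thus ?case using step by (simp add: algebra_simps)
  qed simp
  have "(\<lambda>n. a n / real n) \<longlonglongrightarrow> l"
  proof (rule LIMSEQ_I)
    fix r :: real assume r: "r > 0"
    have "\<exists>x\<in>(\<lambda>n. a n / real n) ` {1..}. x < l + r / 2"
      using cInf_lessD[of "(\<lambda>n. a n / real n) ` {1..}" "l + r/2"] r unfolding l_def by auto
    then obtain m where m: "m \<ge> 1" "a m / real m < l + r / 2" by auto
    define B where "B = (\<Sum>k<m. a k)"
    have B: "a k \<le> B" if "k < m" for k
      unfolding B_def using that nn by (intro member_le_sum) auto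
    have B0: "B \<ge> 0" unfolding B_def using nn by (intro sum_nonneg)
    obtain N where N: "real N > 2 * B / r" using reals_Archimedean2 by blast
    show "\<exists>no. \<forall>n\<ge>no. norm (a n / real n - l) < r"
    proof (intro exI allI impI)
      fix n assume n: "n \<ge> max (Suc N) m"
      define q where "q = n div m"
      have q: "q \<ge> 1" using n m(1) by (auto simp: q_def Suc_le_eq div_greater_zero_iff)
      have neq: "n = q * m + n mod m" by (simp add: q_def)
      have n0: "real n > 0" using n by simp
      have "a n \<le> a (q * m) + a (n mod m)" using sub[of "q * m" "n mod m"] neq by simp
      also have "\<dots> \<le> real q * a m + B" using mult[OF q, of m] B[of "n mod m"] m(1) by simp
      also have "real q * a m \<le> real n * (a m / real m)"
      proof -
        have "real (q * m) \<le> real n" using neq by linarith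
        hence "real q * real m * a m \<le> real n * a m" using nn by (intro mult_right_mono) auto
        thus ?thesis using m(1) by (simp add: field_simps)
      qed
      finally have "a n / real n \<le> a m / real m + B / real n" using n0 by (simp add: field_simps)
      moreover have "B / real n < r / 2"
      proof -
        have "2 * B / r < real n" using N n by linarith
        hence "2 * B < r * real n" using r by (simp add: field_simps)
        thus ?thesis using r n0 by (simp add: field_simps)
      qed
      moreover have "l \<le> a n / real n" unfolding l_def using n by (intro cINF_lower[OF bdd]) auto
      ultimately show "norm (a n / real n - l) < r" using m(2) unfolding real_norm_def by linarith
    qed
  qed
  thus ?thesis by (rule convergentI)
qed

section \<open>Generators\<close>

definition itin :: "('a \<Rightarrow> 'a) \<Rightarrow> ('a \<Rightarrow> 'b) \<Rightarrow> nat \<Rightarrow> 'a \<Rightarrow> 'b list" where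
  "itin g X n w = map (\<lambda>i. X ((g ^^ i) w)) [0..<n]"

lemma itin_add: "itin g X (m + n) w = itin g X m w @ itin g X n ((g ^^ m) w)"
proof -
  have "map (\<lambda>i. X ((g ^^ i) w)) [m..<m + n] = map (\<lambda>i. X ((g ^^ i) ((g ^^ m) w))) [0..<n]"
    by (rule nth_equalityI) (auto simp: funpow_add add.commute)
  thus ?thesis by (simp add: itin_def upt_add_eq_append[of 0])
qed

lemma itin_Suc: "itin g X (Suc n) w = itin g X n w @ [X ((g ^^ n) w)]"
  by (simp add: itin_def)

locale measure_preserving = prob_space M for M :: "'a measure" +
  fixes g :: "'a \<Rightarrow> 'a"
  assumes g_meas: "g \<in> measurable M M" and g_distr: "distr M M g = M"
begin

lemma gn_meas: "(g ^^ n) \<in> measurable M M"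
  by (induction n) (auto intro: measurable_compose[OF _ g_meas] simp: o_def)

lemma gn_distr: "distr M M (g ^^ n) = M"
proof (induction n)
  case 0 show ?case by (simp add: distr_id2)
next
  case (Suc n)
  have "distr M M (g \<circ> (g ^^ n)) = distr (distr M M (g ^^ n)) M g"
    by (rule distr_distr[symmetric]) (auto intro: g_meas gn_meas)
  thus ?case using Suc g_distr by (simp add: o_def)
qed

lemma gn_space: "w \<in> space M \<Longrightarrow> (g ^^ n) w \<in> space M"
  using gn_meas measurable_space by metis

lemma simple_shift:
  assumes "simple_function M X" shows "simple_function M (\<lambda>w. X ((g ^^ n) w))"
  unfolding simple_function_def
proof
  have "(\<lambda>w. X ((g ^^ n) w)) ` space M \<subseteq> X ` space M" using gn_space by auto
  thus "finite ((\<lambda>w. X ((g ^^ n) w)) ` space M)"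
    using simple_functionD(1)[OF assms] finite_subset by blast
  have "(g ^^ n) -` (X -` {x} \<inter> space M) \<inter> space M \<in> sets M" for x
    by (rule measurable_sets[OF gn_meas simple_functionD(2)[OF assms]])
  moreover have "(g ^^ n) -` (X -` {x} \<inter> space M) \<inter> space M = (\<lambda>w. X ((g ^^ n) w)) -` {x} \<inter> space M" for x
    using gn_space by auto
  ultimately show "\<forall>x\<in>(\<lambda>w. X ((g ^^ n) w)) ` space M. (\<lambda>w. X ((g ^^ n) w)) -` {x} \<inter> space M \<in> sets M"
    by simp
qed

lemma ent_shift:
  assumes "simple_function M X" shows "ent M (\<lambda>w. X ((g ^^ n) w)) = ent M X"
proof -
  have "measure M ((\<lambda>w. X ((g ^^ n) w)) -` {x} \<inter> space M) = measure M (X -` {x} \<inter> space M)" for x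
  proof -
    have "measure M (X -` {x} \<inter> space M) = measure (distr M M (g ^^ n)) (X -` {x} \<inter> space M)"
      by (simp add: gn_distr)
    also have "\<dots> = measure M ((g ^^ n) -` (X -` {x} \<inter> space M) \<inter> space M)"
      by (rule measure_distr[OF gn_meas simple_functionD(2)[OF assms]])
    also have "(g ^^ n) -` (X -` {x} \<inter> space M) \<inter> space M = (\<lambda>w. X ((g ^^ n) w)) -` {x} \<inter> space M"
      using gn_space by auto
    finally show ?thesis by simp
  qed
  moreover have "(\<lambda>w. X ((g ^^ n) w)) ` space M \<subseteq> X ` space M" using gn_space by auto
  ultimately show ?thesis
    using ent_superset[OF simple_functionD(1)[OF assms], where X="\<lambda>w. X ((g ^^ n) w)" and M=M]
    by (simp add: ent_def)
qed

lemma simple_itin: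
  assumes "simple_function M X" shows "simple_function M (itin g X n)"
proof (induction n)
  case 0 show ?case by (simp add: itin_def[abs_def])
next
  case (Suc n)
  have "simple_function M (\<lambda>w. itin g X n w @ [X ((g ^^ n) w)])"
    by (rule simple_function_compose2[OF Suc simple_shift[OF assms, of n], where h="\<lambda>xs x. xs @ [x]"])
  thus ?case by (simp add: itin_Suc[abs_def])
qed

text \<open>Words of fixed lengths m and n are recovered from their concatenation, so the long
  itinerary carries the entropy of a pair; invariance removes the shift in the second word.\<close>

lemma ent_itin_add:
  assumes "simple_function M X"
  shows "ent M (itin g X (m + n)) \<le> ent M (itin g X m) + ent M (itin g X n)"
proof -
  have "ent M (itin g X (m + n)) = ent M (\<lambda>w. (\<lambda>(a,b). a @ b) (itin g X m w, itin g X n ((g ^^ m) w)))"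
    by (rule ent_cong) (simp add: itin_add)
  also have "\<dots> = ent M (\<lambda>w. (itin g X m w, itin g X n ((g ^^ m) w)))"
    by (rule ent_inj) (auto simp: inj_on_def itin_def)
  also have "\<dots> \<le> ent M (itin g X m) + ent M (\<lambda>w. itin g X n ((g ^^ m) w))"
    by (intro ent_Pair_le simple_itin simple_shift[OF simple_itin] assms)
  finally show ?thesis using ent_shift[OF simple_itin[OF assms]] by simp
qed

lemma ent_itin_le:
  assumes "simple_function M X"
  shows "ent M (itin g X n) \<le> real n * ent M X"
proof (induction n)
  case 0 show ?case by (simp add: itin_def[abs_def] ent_const)
next
  case (Suc n)
  have "ent M (itin g X 1) = ent M (\<lambda>w. [X w])" by (rule ent_cong) (simp add: itin_def)
  also have "\<dots> = ent M X" by (rule ent_inj') (auto simp: inj_def)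
  finally show ?case using ent_itin_add[OF assms, of n 1] Suc by (simp add: algebra_simps)
qed

text \<open>Of the condition \<open>itin g Y k\<close>, the symbol of X at time i keeps only the m
  symbols of Y at times i, ..., i + m - 1. By invariance each of the n symbols then costs at most
  H(X | Y^m). The inequality n + m <= k makes all these windows fit.\<close>

lemma ent_itin_cond_le:
  assumes X: "simple_function M X" and Y: "simple_function M Y" and "n + m \<le> k"
  shows "ent M (\<lambda>w. (itin g X n w, itin g Y k w)) - ent M (itin g Y k)
    \<le> real n * (ent M (\<lambda>w. (X w, itin g Y m w)) - ent M (itin g Y m))"
  using assms(3)
proof (induction n)
  case 0
  have "ent M (\<lambda>w. (\<lambda>y. ([]::'b list, y)) (itin g Y k w)) = ent M (itin g Y k)"
    by (rule ent_inj') (auto simp: inj_def)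
  thus ?case by (simp add: itin_def[of _ X])
next
  case (Suc n)
  let ?Q = "itin g X n" and ?P = "itin g Y k" and ?R = "\<lambda>w. X ((g ^^ n) w)"
  have sQ: "simple_function M ?Q" and sP: "simple_function M ?P" and sR: "simple_function M ?R"
    by (intro simple_itin simple_shift X Y)+
  have "ent M (\<lambda>w. (itin g X (Suc n) w, ?P w)) = ent M (\<lambda>w. (\<lambda>(q,r,p). (q @ [r], p)) (?Q w, ?R w, ?P w))"
    by (rule ent_cong) (simp add: itin_Suc)
  also have "\<dots> = ent M (\<lambda>w. (?Q w, ?R w, ?P w))" by (rule ent_inj) (auto simp: inj_on_def)
  also have "\<dots> \<le> ent M (\<lambda>w. (?Q w, ?P w)) + (ent M (\<lambda>w. (?R w, ?P w)) - ent M ?P)"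
    using ent_submod[OF sQ sR sP] by simp
  also have "ent M (\<lambda>w. (?R w, ?P w)) - ent M ?P
    \<le> ent M (\<lambda>w. (?R w, itin g Y m ((g ^^ n) w))) - ent M (\<lambda>w. itin g Y m ((g ^^ n) w))"
  proof (rule ent_cond_antimono[OF sR sP, where f="\<lambda>l. take m (drop n l)"])
    fix w
    have k: "k = n + (m + (k - n - m))" using Suc by simp
    show "itin g Y m ((g ^^ n) w) = take m (drop n (itin g Y k w))"
      by (subst k, subst itin_add, subst itin_add) (simp add: itin_def)
  qed
  also have "ent M (\<lambda>w. (?R w, itin g Y m ((g ^^ n) w))) = ent M (\<lambda>w. (X w, itin g Y m w))"
    by (rule ent_shift) (intro simple_function_Pair X simple_itin Y)
  also have "ent M (\<lambda>w. itin g Y m ((g ^^ n) w)) = ent M (itin g Y m)"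
    by (rule ent_shift[OF simple_itin[OF Y]])
  finally show ?case using Suc by (simp add: algebra_simps)
qed

lemma part_entropy_refine:
  assumes P: "meas_partition M P"
  defines "c \<equiv> \<lambda>w. THE A. A \<in> P \<and> w \<in> A"
  shows "simple_function M c" and "part_entropy M (refine M g P n) = ent M (itin g c n)"
proof -
  have fP: "finite P" and Ps: "P \<subseteq> sets M" and PU: "\<Union>P = space M" and dP: "disjoint P"
    using P by (auto simp: meas_partition_def)
  have c_eq: "c w = A" if "A \<in> P" "w \<in> A" for w A
    unfolding c_def using that dP by (intro the_equality) (auto simp: disjoint_def)
  have c_in: "c w \<in> P \<and> w \<in> c w" if w: "w \<in> space M" for w
  proof -
    obtain A where "A \<in> P" "w \<in> A" using PU w by auto
    thus ?thesis using c_eq by simp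
  qed
  have c_iff: "c w = A \<longleftrightarrow> w \<in> A" if "A \<in> P" "w \<in> space M" for w A
    using c_eq c_in that by metis
  show sc: "simple_function M c"
    unfolding simple_function_def
  proof
    show "finite (c ` space M)" using c_in fP by (auto intro: finite_subset[of _ P])
    show "\<forall>x\<in>c ` space M. c -` {x} \<inter> space M \<in> sets M"
    proof
      fix A assume "A \<in> c ` space M"
      hence A: "A \<in> P" using c_in by auto
      have eq: "c -` {A} \<inter> space M = A" using c_iff[OF A] PU A by auto
      show "c -` {A} \<inter> space M \<in> sets M" unfolding eq by (rule subsetD[OF Ps A])
    qed
  qed
  define S where "S = {xs. set xs \<subseteq> P \<and> length xs = n}"
  define cell where "cell xs = itin g c n -` {xs} \<inter> space M" for xs
  have fS: "finite S" unfolding S_def by (rule finite_lists_length_eq[OF fP])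
  have sub: "itin g c n ` space M \<subseteq> S"
    using c_in gn_space by (auto simp: S_def itin_def)
  have cell_eq: "cell xs = space M \<inter> (\<Inter>i\<in>{..<n}. (g ^^ i) -` (xs ! i))" if "xs \<in> S" for xs
  proof -
    have len: "length xs = n" and xi: "\<And>i. i < n \<Longrightarrow> xs ! i \<in> P" using that by (auto simp: S_def)
    have "itin g c n w = xs \<longleftrightarrow> (\<forall>i<n. (g ^^ i) w \<in> xs ! i)" if w: "w \<in> space M" for w
    proof -
      have "itin g c n w = xs \<longleftrightarrow> (\<forall>i<n. c ((g ^^ i) w) = xs ! i)"
        by (auto simp: list_eq_iff_nth_eq itin_def len)
      thus ?thesis using c_iff[OF xi gn_space[OF w]] by auto
    qed
    thus ?thesis by (auto simp: cell_def)
  qed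
  have "refine M g P n = cell ` S"
  proof (intro equalityI subsetI)
    fix E assume "E \<in> refine M g P n"
    then obtain A where A: "\<forall>i<n. A i \<in> P" and E: "E = space M \<inter> (\<Inter>i\<in>{..<n}. (g ^^ i) -` A i)"
      by (auto simp: refine_def)
    have "map A [0..<n] \<in> S" using A by (auto simp: S_def)
    moreover have "E = cell (map A [0..<n])" using cell_eq[OF calculation] E by simp
    ultimately show "E \<in> cell ` S" by auto
  next
    fix E assume "E \<in> cell ` S"
    then obtain xs where xs: "xs \<in> S" "E = cell xs" by auto
    thus "E \<in> refine M g P n"
      unfolding refine_def using cell_eq[OF xs(1)] by (auto intro!: exI[of _ "\<lambda>i. xs ! i"] simp: S_def)
  qed
  hence "part_entropy M (refine M g P n) = (\<Sum>E\<in>cell ` S. eta (measure M E))"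
    by (simp add: part_entropy_def)
  \<comment> \<open>Different words name the same cell only when that cell is empty, and
    \<open>eta\<close> vanishes there.\<close>
  also have "\<dots> = (\<Sum>xs\<in>S. eta (measure M (cell xs)))"
  proof (subst sum.reindex_nontrivial[OF fS])
    fix x y assume "x \<in> S" "y \<in> S" "x \<noteq> y" "cell x = cell y"
    hence "cell x = {}" unfolding cell_def by auto
    thus "eta (measure M (cell x)) = 0" by (simp add: eta_def)
  qed simp
  also have "\<dots> = ent M (itin g c n)" unfolding cell_def by (rule ent_superset[OF fS sub, symmetric])
  finally show "part_entropy M (refine M g P n) = ent M (itin g c n)" .
qed

text \<open>Writing \<open>X\<^sup>n\<close> for the itinerary of length \<open>n\<close>, the point is
  \<open>H(X\<^sup>n) \<le> H(Y\<^bsup>n+m\<^esup>) + n H(X | Y\<^sup>m)\<close>.\<close>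

lemma ks_entropy_le_generator:
  assumes Y: "simple_function M Y"
  and gen: "\<And>(X :: 'a \<Rightarrow> 'a set) e. simple_function M X \<Longrightarrow> e > 0 \<Longrightarrow>
     \<exists>m. ent M (\<lambda>w. (X w, itin g Y m w)) - ent M (itin g Y m) \<le> e"
  shows "ks_entropy M g \<le> ereal (ent M Y)"
  unfolding ks_entropy_def
proof (rule SUP_least)
  fix P assume "P \<in> {P. meas_partition M P}"
  hence P: "meas_partition M P" by simp
  define c where "c = (\<lambda>w. THE A. A \<in> P \<and> w \<in> A)"
  have c: "simple_function M c" unfolding c_def by (rule part_entropy_refine(1)[OF P])
  define a where "a n = ent M (itin g c n)" for n
  have "entropy_part M g P = lim (\<lambda>n. a n / real n)"
    unfolding entropy_part_def a_def c_def part_entropy_refine(2)[OF P] ..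
  moreover have conv: "convergent (\<lambda>n. a n / real n)"
    unfolding a_def by (intro fekete ent_nonneg ent_itin_add c)
  ultimately have lim: "(\<lambda>n. a n / real n) \<longlonglongrightarrow> entropy_part M g P"
    by (simp add: convergent_LIMSEQ_iff)
  have "entropy_part M g P \<le> ent M Y + e" if e: "e > 0" for e
  proof -
    obtain m where m: "ent M (\<lambda>w. (c w, itin g Y m w)) - ent M (itin g Y m) \<le> e"
      using gen[OF c e] by blast
    have bound: "a n / real n \<le> ent M Y + e + real m * ent M Y * inverse (real n)" if n: "n > 0" for n
    proof -
      have "a n \<le> ent M (\<lambda>w. (itin g c n w, itin g Y (n + m) w))"
        unfolding a_def by (intro ent_fst_le simple_itin c Y)
      also have "\<dots> \<le> ent M (itin g Y (n + m)) + real n * e"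
        using ent_itin_cond_le[OF c Y order_refl, of n m] mult_left_mono[OF m, of "real n"] by simp
      also have "\<dots> \<le> real (n + m) * ent M Y + real n * e" using ent_itin_le[OF Y, of "n + m"] by simp
      finally show ?thesis using n by (simp add: field_simps)
    qed
    have "(\<lambda>n. ent M Y + e + real m * ent M Y * inverse (real n)) \<longlonglongrightarrow> ent M Y + e + real m * ent M Y * 0"
      by (intro tendsto_intros lim_inverse_n)
    moreover have "\<forall>\<^sub>F n in sequentially. a n / real n \<le> ent M Y + e + real m * ent M Y * inverse (real n)"
      by (rule eventually_sequentiallyI[of 1]) (use bound in auto)
    ultimately show ?thesis using tendsto_le[OF sequentially_bot _ lim] by fastforce
  qed
  hence "entropy_part M g P \<le> ent M Y" by (rule field_le_epsilon)
  thus "ereal (entropy_part M g P) \<le> ereal (ent M Y)" by simp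
qed

end

lemma ks_entropy_nonneg:
  assumes "prob_space M" "\<And>x. x \<in> space M \<Longrightarrow> g x \<in> space M"
  shows "0 \<le> ks_entropy M g"
proof -
  interpret prob_space M by fact
  have P: "meas_partition M {space M}" by (auto simp: meas_partition_def disjoint_def)
  have gi: "(g ^^ i) x \<in> space M" if "x \<in> space M" for i x
    using that assms(2) by (induction i) auto
  have "refine M g {space M} n = {space M}" for n
  proof -
    have "space M \<inter> (\<Inter>i\<in>{..<n}. (g ^^ i) -` A i) = space M" if "\<forall>i<n. A i \<in> {space M}" for A
      using that gi by auto
    hence "refine M g {space M} n \<subseteq> {space M}" unfolding refine_def by blast
    moreover have "space M \<in> refine M g {space M} n"
      unfolding refine_def
      by (rule CollectI, rule exI[of _ "\<lambda>_. space M"]) (use gi in auto)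
    ultimately show ?thesis by blast
  qed
  hence "entropy_part M g {space M} = lim (\<lambda>n. 0 / real n)"
    by (simp only: entropy_part_def part_entropy_def) (simp add: eta_def prob_space)
  hence "ereal (entropy_part M g {space M}) = 0" by (simp add: zero_ereal_def)
  moreover have "ereal (entropy_part M g {space M}) \<le> ks_entropy M g"
    unfolding ks_entropy_def by (rule SUP_upper) (use P in simp)
  ultimately show ?thesis by metis
qed

section \<open>Regularity of measures on the circle and partitions with small cells\<close>

lemma prob_on_M_space:
  assumes "prob_on_M M"
  shows "space M = {0..<1}" "A \<in> sets M \<longleftrightarrow> A \<in> sets borel \<and> A \<subseteq> {0..<1}"
proof -
  have s: "sets M = sets circle_meas" using assms by (simp add: prob_on_M_def)
  show "space M = {0..<1}" using sets_eq_imp_space_eq[OF s] by (simp add: circle_meas_def space_restrict_space)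
  show "A \<in> sets M \<longleftrightarrow> A \<in> sets borel \<and> A \<subseteq> {0..<1}"
    unfolding s circle_meas_def by (subst sets_restrict_space_iff) auto
qed

lemma prob_on_M_measurable:
  assumes "prob_on_M M" "f \<in> borel_measurable borel"
  shows "f \<in> borel_measurable M"
proof -
  have "f \<in> borel_measurable (restrict_space lborel {0..<1})"
    using assms(2) by (intro measurable_restrict_space1) simp
  moreover have "borel_measurable M = borel_measurable (restrict_space lborel {0..<1})"
    using assms(1) by (intro measurable_cong_sets) (auto simp: prob_on_M_def circle_meas_def)
  ultimately show ?thesis by metis
qed

text \<open>Inner regularity is available for Borel measures on the line, so M is pushed there as
  \<open>N\<close>; the two agree on Borel subsets of [0, 1).\<close>

lemma prob_on_M_inner:
  assumes M: "prob_on_M M" and A: "A \<in> sets M" and e: "e > 0"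
  shows "\<exists>K. compact K \<and> K \<subseteq> A \<and> measure M (A - K) \<le> e"
proof -
  interpret prob_space M using M by (simp add: prob_on_M_def)
  define N where "N = distr M borel (\<lambda>x. x)"
  have mid: "(\<lambda>x. x) \<in> borel_measurable M" by (rule prob_on_M_measurable[OF M]) simp
  interpret N: prob_space N unfolding N_def by (rule prob_space_distr[OF mid])
  have Ab: "A \<in> sets borel" "A \<subseteq> {0..<1}" using A prob_on_M_space[OF M] by auto
  have NM: "measure N B = measure M B" if "B \<in> sets borel" "B \<subseteq> {0..<1}" for B
  proof -
    have "measure N B = measure M ((\<lambda>x. x) -` B \<inter> space M)"
      unfolding N_def by (rule measure_distr[OF mid]) (use that in simp)
    also have "(\<lambda>x. x) -` B \<inter> space M = B" using that prob_on_M_space[OF M] by auto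
    finally show ?thesis .
  qed
  have sup: "emeasure N A = (SUP K\<in>{K. K \<subseteq> A \<and> compact K}. emeasure N K)"
  proof (rule inner_regular)
    show "sets N = sets borel" by (simp add: N_def)
    show "emeasure N (space N) \<noteq> \<infinity>" by simp
  qed (rule Ab)
  have "\<exists>K. K \<subseteq> A \<and> compact K \<and> measure N A - e < measure N K"
  proof (rule ccontr)
    assume neg: "\<not> (\<exists>K. K \<subseteq> A \<and> compact K \<and> measure N A - e < measure N K)"
    have le: "measure N K \<le> measure N A - e" if "K \<subseteq> A" "compact K" for K
    proof (rule ccontr)
      assume "\<not> measure N K \<le> measure N A - e"
      hence "measure N A - e < measure N K" by (rule not_le_imp_less)
      with neg that show False by blast
    qed
    have "emeasure N A \<le> ennreal (measure N A - e)"
      unfolding sup using le by (intro SUP_least) (auto simp: N.emeasure_eq_measure intro!: ennreal_leI)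
    moreover have "0 \<le> measure N A - e" using le[of "{}"] by simp
    ultimately have "measure N A \<le> measure N A - e" by (simp add: N.emeasure_eq_measure)
    thus False using e by simp
  qed
  then obtain K where K: "K \<subseteq> A" "compact K" "measure N A - e < measure N K" by auto
  have Kb: "K \<in> sets borel" using K(2) by (intro borel_closed compact_imp_closed)
  have "K \<in> sets M" using Kb K(1) Ab prob_on_M_space[OF M] by auto
  hence "measure M (A - K) = measure M A - measure M K"
    using A K(1) by (intro finite_measure_Diff)
  also have "\<dots> \<le> e" using K NM[OF Ab] NM[OF Kb] Ab by auto
  finally show ?thesis using K by auto
qed

text \<open>Distance is meant on the circle, so points near 0 and near 1 have to be kept apart as
  well. Every integer translate of L is closed and misses K; those with |k| > 2 are at distance at
  least 1, which leaves finitely many.\<close>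

lemma compact_translates_separated:
  fixes K L :: "real set"
  assumes "compact K" "compact L" "K \<subseteq> {0..<1}" "L \<subseteq> {0..<1}" "K \<inter> L = {}"
  shows "\<exists>d>0. \<forall>x\<in>K. \<forall>y\<in>L. \<forall>k::int. \<bar>x - y - of_int k\<bar> \<ge> d"
proof (cases "K = {} \<or> L = {}")
  case True thus ?thesis by (auto intro: exI[of _ 1])
next
  case False
  define S where "S k = (\<lambda>x. x + of_int k) ` L" for k :: int
  have S: "closed (S k)" "S k \<noteq> {}" "K \<inter> S k = {}" for k
  proof -
    have "compact (S k)" unfolding S_def
      by (intro compact_continuous_image continuous_intros assms)
    thus "closed (S k)" by (rule compact_imp_closed)
    show "S k \<noteq> {}" using False by (simp add: S_def)
    have False if "x \<in> K" "y \<in> L" "x = y + of_int k" for x y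
    proof -
      have "\<bar>real_of_int k\<bar> < 1" using that assms by fastforce
      hence "k = 0" by linarith
      thus False using that assms by auto
    qed
    thus "K \<inter> S k = {}" by (auto simp: S_def)
  qed
  have pos: "setdist K (S k) > 0" for k
    using setdist_eq_0_compact_closed[OF assms(1) S(1)[of k]] S False setdist_pos_le[of K "S k"]
    by (metis order_le_less)
  define d where "d = Min ((\<lambda>k. setdist K (S k)) ` {-2..2::int})"
  have fin: "finite ((\<lambda>k. setdist K (S k)) ` {-2..2::int})" by simp
  have "d > 0" unfolding d_def using pos by (subst Min_gr_iff[OF fin]) auto
  moreover have "\<bar>x - y - of_int k\<bar> \<ge> min d 1" if "x \<in> K" "y \<in> L" for x y k
  proof (cases "k \<in> {-2..2}")
    case True
    have "d \<le> setdist K (S k)" unfolding d_def using True by (intro Min_le[OF fin]) auto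
    also have "\<dots> \<le> dist x (y + of_int k)" using that by (intro setdist_le_dist) (auto simp: S_def)
    finally show ?thesis by (simp add: dist_real_def algebra_simps)
  next
    case False
    hence "\<bar>real_of_int k\<bar> \<ge> 3" by auto
    moreover have "\<bar>x - y\<bar> < 1" using that assms by fastforce
    ultimately show ?thesis by linarith
  qed
  ultimately show ?thesis by (intro exI[of _ "min d 1"]) auto
qed

text \<open>Each level set of X is replaced by a compact subset \<open>K x\<close> that misses
  little of its mass. Once the cells of \<open>Y m\<close> are smaller than the distances between
  these compact sets, a cell meets at most one of them, so X is a function of \<open>Y m\<close> up
  to small measure and the Fano bound applies.\<close>

lemma small_cells_generate:
  fixes Y :: "nat \<Rightarrow> real \<Rightarrow> 'c" and X :: "real \<Rightarrow> 'b"
  assumes M: "prob_on_M M" and Y: "\<And>m. simple_function M (Y m)"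
  and sep: "\<And>d::real. d > 0 \<Longrightarrow> \<exists>m. \<forall>x\<in>{0..<1}. \<forall>y\<in>{0..<1}. Y m x = Y m y \<longrightarrow> (\<exists>k::int. \<bar>x - y - of_int k\<bar> < d)"
  and X: "simple_function M X" and e: "e > 0"
  shows "\<exists>m. ent M (\<lambda>w. (X w, Y m w)) - ent M (Y m) \<le> e"
proof -
  interpret prob_space M using M by (simp add: prob_on_M_def)
  have sp: "space M = {0..<1}" using prob_on_M_space[OF M] by simp
  define S where "S = X ` space M"
  have fS: "finite S" unfolding S_def by (rule simple_functionD(1)[OF X])
  have neS: "S \<noteq> {}" by (simp add: S_def sp)
  define c where "c = real (card S)"
  have c: "c > 0" unfolding c_def using fS neS by (simp add: card_gt_0_iff)
  have "((\<lambda>r. c * (c * r) + c^2 * (2 * sqrt (c * r))) \<longlongrightarrow> c * (c * 0) + c^2 * (2 * sqrt (c * 0))) (at_right 0)"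
    by (intro tendsto_intros)
  hence "\<forall>\<^sub>F r in at_right 0. c * (c * r) + c^2 * (2 * sqrt (c * r)) < e"
    using e by (intro order_tendstoD(2)) auto
  then obtain b where "b > 0" "\<forall>r>0. r < b \<longrightarrow> c * (c * r) + c^2 * (2 * sqrt (c * r)) < e"
    unfolding eventually_at_right_field by auto
  then obtain r where r: "r > 0" "c * (c * r) + c^2 * (2 * sqrt (c * r)) < e"
    by (meson dense)
  have mX: "X -` {x} \<inter> space M \<in> sets M" for x by (rule simple_functionD(2)[OF X])
  obtain K where K: "\<And>x. compact (K x)" "\<And>x. K x \<subseteq> X -` {x} \<inter> space M"
    "\<And>x. measure M ((X -` {x} \<inter> space M) - K x) \<le> r"
    using prob_on_M_inner[OF M mX r(1)] by metis
  have ex: "\<exists>d>0. \<forall>u\<in>K x. \<forall>v\<in>K y. \<forall>k::int. \<bar>u - v - of_int k\<bar> \<ge> d" if "x \<noteq> y" for x y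
  proof (rule compact_translates_separated[OF K(1) K(1)])
    show "K x \<subseteq> {0..<1}" "K y \<subseteq> {0..<1}" using K(2) unfolding sp by (meson Int_subset_iff)+
    show "K x \<inter> K y = {}" using K(2)[of x] K(2)[of y] that by auto
  qed
  define D where "D x y = (SOME d. d > 0 \<and> (\<forall>u\<in>K x. \<forall>v\<in>K y. \<forall>k::int. \<bar>u - v - of_int k\<bar> \<ge> d))" for x y
  have D: "D x y > 0" "u \<in> K x \<Longrightarrow> v \<in> K y \<Longrightarrow> \<bar>u - v - of_int k\<bar> \<ge> D x y" if "x \<noteq> y" for x y u v and k :: int
  proof -
    have *: "D x y > 0 \<and> (\<forall>u\<in>K x. \<forall>v\<in>K y. \<forall>k::int. \<bar>u - v - of_int k\<bar> \<ge> D x y)"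
      unfolding D_def by (rule someI_ex[OF ex[OF that]])
    show "D x y > 0" using * by (rule conjunct1)
    show "\<bar>u - v - of_int k\<bar> \<ge> D x y" if "u \<in> K x" "v \<in> K y"
      using conjunct2[OF *] that by simp
  qed
  define d where "d = Min (insert 1 ((\<lambda>(x,y). D x y) ` {(x,y)\<in>S\<times>S. x \<noteq> y}))"
  have fin: "finite (insert 1 ((\<lambda>(x,y). D x y) ` {(x,y)\<in>S\<times>S. x \<noteq> y}))"
    using fS by (auto intro: finite_subset[of _ "S \<times> S"])
  have "d > 0" unfolding d_def using D(1) by (subst Min_gr_iff[OF fin]) auto
  then obtain m where m: "\<forall>x\<in>{0..<1}. \<forall>y\<in>{0..<1}. Y m x = Y m y \<longrightarrow> (\<exists>k::int. \<bar>x - y - of_int k\<bar> < d)"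
    using sep by blast
  \<comment> \<open>\<open>h\<close> decodes a symbol of \<open>Y m\<close>. A symbol whose cell
    meets no \<open>K x\<close> gets an arbitrary value in S, which affects only points outside all
    \<open>K x\<close>.\<close>
  define h where "h v = (if \<exists>x\<in>S. \<exists>w\<in>K x. Y m w = v then SOME x. x \<in> S \<and> (\<exists>w\<in>K x. Y m w = v) else SOME x. x \<in> S)" for v
  have hS: "h v \<in> S" for v
  proof (cases "\<exists>x\<in>S. \<exists>w\<in>K x. Y m w = v")
    case True
    hence "\<exists>x. x \<in> S \<and> (\<exists>w\<in>K x. Y m w = v)" by blast
    from someI_ex[OF this] show ?thesis using True by (simp add: h_def)
  next
    case False
    thus ?thesis using neS by (simp add: h_def some_in_eq)
  qed
  have h: "h (Y m w) = x" if w: "w \<in> K x" and x: "x \<in> S" for w x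
  proof -
    have ex: "\<exists>x\<in>S. \<exists>u\<in>K x. Y m u = Y m w" using w x by blast
    hence "\<exists>z. z \<in> S \<and> (\<exists>u\<in>K z. Y m u = Y m w)" by blast
    from someI_ex[OF this] ex have "h (Y m w) \<in> S" "\<exists>u\<in>K (h (Y m w)). Y m u = Y m w"
      by (simp_all add: h_def)
    then obtain u where u: "u \<in> K (h (Y m w))" "Y m u = Y m w" by blast
    show ?thesis
    proof (rule ccontr)
      assume ne: "h (Y m w) \<noteq> x"
      have "u \<in> {0..<1}" "w \<in> {0..<1}" using u(1) w K(2) sp by blast+
      then obtain k :: int where k: "\<bar>u - w - of_int k\<bar> < d" using m u(2) by blast
      have "d \<le> D (h (Y m w)) x" unfolding d_def
        by (rule Min_le[OF fin]) (use ne x hS in auto)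
      also have "\<dots> \<le> \<bar>u - w - of_int k\<bar>" by (rule D(2)[OF ne u(1) w])
      finally show False using k by simp
    qed
  qed
  have hY: "simple_function M (\<lambda>w. h (Y m w))" by (rule simple_function_compose1[OF Y])
  have KM: "K x \<in> sets M" for x
    using prob_on_M_space[OF M] K(1,2)[of x] by (auto intro: borel_closed compact_imp_closed)
  have "{w\<in>space M. X w \<noteq> h (Y m w)} \<subseteq> (\<Union>x\<in>S. (X -` {x} \<inter> space M) - K x)"
    using h by (auto simp: S_def)
  hence "measure M {w\<in>space M. X w \<noteq> h (Y m w)} \<le> measure M (\<Union>x\<in>S. (X -` {x} \<inter> space M) - K x)"
    by (rule finite_measure_mono) (use fS mX KM in auto)
  also have "\<dots> \<le> (\<Sum>x\<in>S. measure M ((X -` {x} \<inter> space M) - K x))"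
    by (rule measure_UNION_le[OF fS]) (use mX KM in auto)
  also have "\<dots> \<le> (\<Sum>x\<in>S. r)" by (intro sum_mono K(3))
  also have "\<dots> = c * r" by (simp add: c_def)
  finally have le: "measure M {w\<in>space M. X w \<noteq> h (Y m w)} \<le> c * r" .
  have "ent M (\<lambda>w. (X w, Y m w)) - ent M (Y m) \<le> ent M (\<lambda>w. (X w, h (Y m w))) - ent M (\<lambda>w. h (Y m w))"
    by (rule ent_cond_antimono[OF X Y]) simp
  also have "\<dots> \<le> c * (c * r) + c^2 * (2 * sqrt (c * r))"
    unfolding c_def by (rule ent_cond_fano[OF X hY fS]) (use hS le in \<open>auto simp: S_def c_def\<close>)
  finally show ?thesis using r(2) by (intro exI[of _ m]) linarith
qed

section \<open>Transfer operators of circle maps\<close>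

lemma periodic_int:
  fixes v :: "real \<Rightarrow> 'a"
  assumes "\<And>x. v (x + 1) = v x"
  shows "v (x + of_int k) = v x"
proof (induction k rule: int_induct[where k=0])
  case (step1 i)
  thus ?case using assms[of "x + of_int i"] by (simp add: add.assoc)
next
  case (step2 i)
  thus ?case using assms[of "x + of_int (i - 1)"] by (simp add: algebra_simps)
qed simp

lemma periodic_frac:
  fixes v :: "real \<Rightarrow> 'a"
  assumes "\<And>x. v (x + 1) = v x"
  shows "v (frac x) = v x"
proof -
  have "frac x + of_int \<lfloor>x\<rfloor> = x" by (simp add: frac_def)
  with periodic_int[where v=v and x="frac x" and k="\<lfloor>x\<rfloor>", OF assms] show ?thesis by simp
qed

lemma periodic_bounded:
  fixes f :: "real \<Rightarrow> real"
  assumes f: "continuous_on UNIV f" and per: "\<And>x. f (x + 1) = f x"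
  shows "\<exists>B>0. \<forall>x. \<bar>f x\<bar> \<le> B"
proof -
  have "compact (f ` {0..1})" by (rule compact_continuous_image) (use continuous_on_subset[OF f] in auto)
  hence "bounded (f ` {0..1})" by (rule compact_imp_bounded)
  then obtain B where B: "B > 0" "\<And>y. y \<in> f ` {0..1} \<Longrightarrow> norm y \<le> B" unfolding bounded_pos by blast
  have "\<bar>f x\<bar> \<le> B" for x
  proof -
    have "frac x \<in> {0..1}" using frac_lt_1[of x] frac_ge_0[of x] by simp
    hence "norm (f (frac x)) \<le> B" by (intro B(2) imageI)
    thus ?thesis using periodic_frac[where v=f and x=x, OF per] by simp
  qed
  thus ?thesis using B(1) by blast
qed

lemma nn_integral_shift_interval:
  fixes f :: "real \<Rightarrow> ennreal"
  assumes [measurable]: "f \<in> borel_measurable borel"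
  shows "(\<integral>\<^sup>+x. f x * indicator {a + c..<b + c} x \<partial>lborel) = (\<integral>\<^sup>+x. f (x + c) * indicator {a..<b} x \<partial>lborel)"
proof -
  have "(\<integral>\<^sup>+x. f x * indicator {a + c..<b + c} x \<partial>lborel)
    = (\<integral>\<^sup>+x. f x * indicator {a + c..<b + c} x \<partial>distr lborel borel ((+) c))"
    by (simp add: lborel_distr_plus)
  also have "\<dots> = (\<integral>\<^sup>+x. f (c + x) * indicator {a + c..<b + c} (c + x) \<partial>lborel)"
    by (rule nn_integral_distr) auto
  also have "\<dots> = (\<integral>\<^sup>+x. f (x + c) * indicator {a..<b} x \<partial>lborel)"
    by (intro nn_integral_cong) (auto simp: indicator_def add.commute)
  finally show ?thesis .
qed

lemma nn_integral_split_interval: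
  fixes f :: "real \<Rightarrow> ennreal"
  assumes [measurable]: "f \<in> borel_measurable borel" and "a \<le> b" "b \<le> c"
  shows "(\<integral>\<^sup>+x. f x * indicator {a..<c} x \<partial>lborel)
    = (\<integral>\<^sup>+x. f x * indicator {a..<b} x \<partial>lborel) + (\<integral>\<^sup>+x. f x * indicator {b..<c} x \<partial>lborel)"
proof -
  have "(\<integral>\<^sup>+x. f x * indicator {a..<c} x \<partial>lborel)
    = (\<integral>\<^sup>+x. f x * indicator {a..<b} x + f x * indicator {b..<c} x \<partial>lborel)"
    using assms(2,3) by (intro nn_integral_cong) (auto simp: indicator_def)
  also have "\<dots> = (\<integral>\<^sup>+x. f x * indicator {a..<b} x \<partial>lborel) + (\<integral>\<^sup>+x. f x * indicator {b..<c} x \<partial>lborel)"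
    by (rule nn_integral_add) auto
  finally show ?thesis .
qed

lemma nn_integral_Icc_Ico:
  fixes f :: "real \<Rightarrow> ennreal"
  shows "(\<integral>\<^sup>+x. f x * indicator {a..b} x \<partial>lborel) = (\<integral>\<^sup>+x. f x * indicator {a..<b} x \<partial>lborel)"
proof (rule nn_integral_cong_AE)
  have "AE x in lborel. x \<noteq> b" by (rule AE_lborel_singleton)
  thus "AE x in lborel. f x * indicator {a..b} x = f x * indicator {a..<b} x"
    by eventually_elim (auto simp: indicator_def)
qed

lemma nn_integral_periodic:
  fixes f :: "real \<Rightarrow> ennreal"
  assumes m: "f \<in> borel_measurable borel" and per: "\<And>x. f (x + 1) = f x"
  shows "(\<integral>\<^sup>+x. f x * indicator {a..<a + 1} x \<partial>lborel) = (\<integral>\<^sup>+x. f x * indicator {0..<1} x \<partial>lborel)"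
proof -
  let ?I = "\<lambda>a b. (\<integral>\<^sup>+x. f x * indicator {a..<b} x \<partial>lborel)"
  define k where "k = \<lfloor>a\<rfloor>"
  define r where "r = frac a"
  have a: "a = r + of_int k" and r: "0 \<le> r" "r \<le> 1"
    using frac_ge_0[of a] frac_lt_1[of a] by (auto simp: r_def k_def frac_def)
  have "?I (r + of_int k) (r + 1 + of_int k) = (\<integral>\<^sup>+x. f (x + of_int k) * indicator {r..<r + 1} x \<partial>lborel)"
    by (rule nn_integral_shift_interval[OF m])
  also have "\<dots> = ?I r (r + 1)" by (simp only: periodic_int[where v=f, OF per])
  finally have "?I a (a + 1) = ?I r (r + 1)" by (simp add: a algebra_simps)
  also have "\<dots> = ?I r 1 + ?I 1 (r + 1)" by (rule nn_integral_split_interval[OF m]) (use r in auto)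
  also have "?I (0 + 1) (r + 1) = (\<integral>\<^sup>+x. f (x + 1) * indicator {0..<r} x \<partial>lborel)"
    by (rule nn_integral_shift_interval[OF m])
  hence "?I 1 (r + 1) = ?I 0 r" by (simp add: per)
  also have "?I r 1 + ?I 0 r = ?I 0 1"
    by (subst nn_integral_split_interval[OF m, of 0 r 1]) (use r in \<open>auto simp: add.commute\<close>)
  finally show ?thesis .
qed

text \<open>\<open>G\<close> is the lift of an orientation preserving covering of the circle of
  class C^1 and degree \<open>d\<close>. The degree is a parameter, so that a map and its
  perturbations share the index range of the inverse branches.\<close>

locale circle_lift =
  fixes G G' :: "real \<Rightarrow> real" and d :: nat
  assumes G_deriv: "\<And>x. (G has_real_derivative G' x) (at x)"
    and G'_cont: "continuous_on UNIV G'"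
    and G'_pos: "\<And>x. G' x > 0"
    and G_step: "\<And>x. G (x + 1) = G x + real d"
begin

definition "Gi = inv G"

lemma G_cont: "continuous_on A G"
  using G_deriv by (meson DERIV_isCont continuous_at_imp_continuous_on)

lemma G_mono: "strict_mono G"
  by (rule strict_monoI, rule DERIV_pos_imp_increasing) (use G_deriv G'_pos in blast)+

lemma G_less_iff: "G x < G y \<longleftrightarrow> x < y" and G_le_iff: "G x \<le> G y \<longleftrightarrow> x \<le> y"
  using G_mono by (simp_all add: strict_mono_less strict_mono_less_eq)

lemma d_pos: "d \<ge> 1"
  using G_less_iff[of 0 1] G_step[of 0] by simp

lemma G'_step: "G' (x + 1) = G' x"
proof -
  have "((\<lambda>x. G (x + 1)) has_real_derivative G' (x + 1) * 1) (at x)"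
    by (rule DERIV_chain2[OF G_deriv]) (auto intro!: derivative_eq_intros)
  moreover have "((\<lambda>x. G (x + 1)) has_real_derivative G' x) (at x)"
    unfolding G_step by (auto intro!: derivative_eq_intros G_deriv)
  ultimately show ?thesis using DERIV_unique by force
qed

lemma G_int: "G (x + of_int k) = G x + real d * of_int k"
proof (induction k rule: int_induct[where k=0])
  case (step1 i)
  thus ?case using G_step[of "x + of_int i"] by (simp add: algebra_simps)
next
  case (step2 i)
  thus ?case using G_step[of "x + of_int (i - 1)"] by (simp add: algebra_simps)
qed simp

lemma G_surj: "surj G"
proof -
  have "\<exists>x. G x = y" for y
  proof -
    obtain k :: nat where k: "\<bar>y - G 0\<bar> < real k" using reals_Archimedean2 by blast
    have "real k \<le> real d * real k" using d_pos by (simp add: mult_le_cancel_right1)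
    hence "G (0 + of_int (- int k)) \<le> y" "y \<le> G (0 + of_int (int k))"
      unfolding G_int using k by auto
    moreover have "0 + of_int (- int k) \<le> 0 + of_int (int k) + (0::real)" by simp
    ultimately show ?thesis
      using IVT'[of G "0 + of_int (- int k)" y "0 + of_int (int k)"] G_cont by auto
  qed
  thus ?thesis by (metis surjI)
qed

lemma G_Gi [simp]: "G (Gi x) = x" by (simp add: Gi_def G_surj surj_f_inv_f)

lemma Gi_G [simp]: "Gi (G x) = x"
  using strict_mono_imp_inj_on[OF G_mono] by (simp add: Gi_def)

lemma Gi_less_iff: "Gi x < Gi y \<longleftrightarrow> x < y" and Gi_le_iff: "Gi x \<le> Gi y \<longleftrightarrow> x \<le> y"
  using G_less_iff[of "Gi x" "Gi y"] G_le_iff[of "Gi x" "Gi y"] by auto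

lemma Gi_step: "Gi (x + real d) = Gi x + 1"
  using G_step[of "Gi x"] by (metis G_Gi Gi_G)

lemma Gi_deriv: "(Gi has_real_derivative 1 / G' (Gi x)) (at x)"
proof -
  have c: "isCont Gi (G z)" for z
    by (rule isCont_inverse_function[where d=1]) (use DERIV_isCont[OF G_deriv] in auto)
  have "(Gi has_real_derivative inverse (G' (Gi x))) (at x)"
    by (rule DERIV_inverse_function[where f=G and a="x - 1" and b="x + 1"])
       (use G_deriv[of "Gi x"] G'_pos[of "Gi x"] c[of "Gi x"] in auto)
  thus ?thesis by (simp add: inverse_eq_divide)
qed

lemma Gi_cont: "continuous_on A Gi"
  using Gi_deriv by (meson DERIV_isCont continuous_at_imp_continuous_on)

lemma G'_bounds: "\<exists>g>0. \<exists>B>0. \<forall>x. g \<le> G' x \<and> G' x \<le> B"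
proof -
  obtain B where B: "B > 0" "\<And>x. \<bar>G' x\<bar> \<le> B" using periodic_bounded[OF G'_cont G'_step] by blast
  have "continuous_on UNIV (\<lambda>x. 1 / G' x)"
    by (intro continuous_on_divide continuous_on_const G'_cont) (use G'_pos in \<open>simp add: less_imp_neq[THEN not_sym]\<close>)
  then obtain c where c: "c > 0" "\<And>x. \<bar>1 / G' x\<bar> \<le> c"
    using periodic_bounded[of "\<lambda>x. 1 / G' x"] G'_step by auto
  have "1 / c \<le> G' x" for x using c(2)[of x] c(1) G'_pos[of x] by (simp add: field_simps)
  thus ?thesis using B c(1) by (intro exI[of _ "1 / c"] conjI exI[of _ B]) (auto simp: abs_le_iff)
qed

text \<open>The points \<open>Gi (x + i)\<close> with i < d represent the preimages of x on the
  circle. For periodic v any complete set of residues mod d gives the same sum, since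
  \<open>Gi (x + d) = Gi x + 1\<close>.\<close>

definition L :: "(real \<Rightarrow> real) \<Rightarrow> real \<Rightarrow> real" where
  "L v x = (\<Sum>i<d. v (Gi (x + real i)) / G' (Gi (x + real i)))"

lemma L_cont:
  assumes v: "continuous_on UNIV v" shows "continuous_on UNIV (L v)"
proof -
  have c: "continuous_on UNIV (\<lambda>x. Gi (x + real i))" for i
    by (rule continuous_on_compose2[OF Gi_cont[of UNIV]]) (auto intro!: continuous_intros)
  have "continuous_on UNIV (\<lambda>x. v (Gi (x + real i)))" "continuous_on UNIV (\<lambda>x. G' (Gi (x + real i)))" for i
    using continuous_on_compose2[OF v c] continuous_on_compose2[OF G'_cont c] by auto
  moreover have "G' y \<noteq> 0" for y using G'_pos[of y] by simp
  ultimately show ?thesis unfolding L_def[abs_def] by (intro continuous_on_sum continuous_on_divide) auto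
qed

lemma L_periodic:
  assumes "\<And>x. v (x + 1) = v x" shows "L v (x + 1) = L v x"
proof -
  define t where "t i = v (Gi (x + real i)) / G' (Gi (x + real i))" for i
  have td: "t d = t 0" unfolding t_def Gi_step by (simp add: assms G'_step)
  have "x + 1 + real i = x + real (Suc i)" for i by simp
  hence "L v (x + 1) = (\<Sum>i<d. t (Suc i))" unfolding L_def t_def by (simp only:)
  also have "\<dots> = (\<Sum>i<d. t i)" using sum.lessThan_Suc_shift[of t d] td by simp
  finally show ?thesis by (simp add: L_def t_def)
qed

lemma L_pos: "(\<And>x. v x > 0) \<Longrightarrow> L v x > 0"
  unfolding L_def using G'_pos d_pos by (intro sum_pos) (auto simp: lessThan_empty_iff)

lemma L_cmult: "L (\<lambda>x. c * v x) x = c * L v x"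
  by (simp add: L_def sum_distrib_left)

lemma L_sum: "L (\<lambda>x. \<Sum>j\<in>A. v j x) x = (\<Sum>j\<in>A. L (v j) x)"
  unfolding L_def by (subst sum.swap) (simp add: sum_divide_distrib)

text \<open>The period is moved to [a, a + 1) with \<open>G a = 0\<close>. The substitution y = G x
  turns it into [0, d), which splits into d unit intervals, one for each inverse branch.\<close>

lemma transfer_duality:
  fixes v :: "real \<Rightarrow> real" and h :: "real \<Rightarrow> ennreal"
  assumes h: "h \<in> borel_measurable borel" and v: "continuous_on UNIV v" and v0: "\<And>x. v x \<ge> 0"
    and hp: "\<And>x. h (x + 1) = h x" and vp: "\<And>x. v (x + 1) = v x"
  shows "(\<integral>\<^sup>+x. ennreal (v x) * h (G x) * indicator {0..<1} x \<partial>lborel)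
     = (\<integral>\<^sup>+x. h x * ennreal (L v x) * indicator {0..<1} x \<partial>lborel)"
proof -
  have [measurable]: "v \<in> borel_measurable borel" "G \<in> borel_measurable borel" "Gi \<in> borel_measurable borel"
    "G' \<in> borel_measurable borel"
    using v G_cont Gi_cont G'_cont by (auto intro: borel_measurable_continuous_onI)
  note h[measurable]
  define u where "u y = v (Gi y) / G' (Gi y)" for y
  have u0: "u y \<ge> 0" for y using v0 G'_pos by (simp add: u_def less_imp_le)
  have [measurable]: "u \<in> borel_measurable borel" unfolding u_def[abs_def] by measurable
  define k where "k y = h y * ennreal (u y)" for y
  have [measurable]: "k \<in> borel_measurable borel" unfolding k_def[abs_def] by measurable
  have kG: "k (G x) * ennreal (G' x) = ennreal (v x) * h (G x)" for x
  proof -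
    have "ennreal (u (G x)) * ennreal (G' x) = ennreal (u (G x) * G' x)"
      using u0 G'_pos by (simp add: ennreal_mult less_imp_le)
    also have "u (G x) * G' x = v x" using G'_pos[of x] by (simp add: u_def)
    finally show ?thesis by (simp add: k_def mult.assoc) (simp add: mult.commute)
  qed
  define a where "a = Gi 0"
  have Ga: "G a = 0" "G (a + 1) = real d" using G_step[of a] by (auto simp: a_def)
  have "(\<integral>\<^sup>+x. ennreal (v x) * h (G x) * indicator {0..<1} x \<partial>lborel)
     = (\<integral>\<^sup>+x. ennreal (v x) * h (G x) * indicator {a..<a + 1} x \<partial>lborel)"
  proof (rule nn_integral_periodic[symmetric])
    fix x show "ennreal (v (x + 1)) * h (G (x + 1)) = ennreal (v x) * h (G x)"
      using periodic_int[where v=h and x="G x" and k="int d", OF hp] by (simp add: vp G_step)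
  qed measurable
  also have "\<dots> = (\<integral>\<^sup>+x. k (G x) * ennreal (G' x) * indicator {a..a + 1} x \<partial>lborel)"
    unfolding kG by (rule nn_integral_Icc_Ico[symmetric])
  also have "\<dots> = (\<integral>\<^sup>+y. k y * indicator {G a..G (a + 1)} y \<partial>lborel)"
    by (rule nn_integral_substitution_aux[symmetric])
       (use G_deriv G'_cont G'_pos in \<open>auto intro: continuous_on_subset less_imp_le\<close>)
  also have "\<dots> = (\<integral>\<^sup>+y. k y * indicator {0..<real d} y \<partial>lborel)"
    unfolding Ga by (rule nn_integral_Icc_Ico)
  also have "\<dots> = (\<Sum>i<d. \<integral>\<^sup>+y. k (y + real i) * indicator {0..<1} y \<partial>lborel)"
  proof (induction d)
    case (Suc n)
    have "(\<integral>\<^sup>+y. k y * indicator {0..<real (Suc n)} y \<partial>lborel) =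
       (\<integral>\<^sup>+y. k y * indicator {0..<real n} y \<partial>lborel) + (\<integral>\<^sup>+y. k y * indicator {real n..<real (Suc n)} y \<partial>lborel)"
      by (rule nn_integral_split_interval) auto
    also have "(\<integral>\<^sup>+y. k y * indicator {0 + real n..<1 + real n} y \<partial>lborel) = (\<integral>\<^sup>+y. k (y + real n) * indicator {0..<1} y \<partial>lborel)"
      by (rule nn_integral_shift_interval) measurable
    hence "(\<integral>\<^sup>+y. k y * indicator {real n..<real (Suc n)} y \<partial>lborel) = (\<integral>\<^sup>+y. k (y + real n) * indicator {0..<1} y \<partial>lborel)"
      by (simp add: add.commute)
    finally show ?case using Suc by simp
  qed simp
  also have "\<dots> = (\<integral>\<^sup>+y. (\<Sum>i<d. k (y + real i) * indicator {0..<1} y) \<partial>lborel)"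
    by (rule nn_integral_sum[symmetric]) measurable
  also have "\<dots> = (\<integral>\<^sup>+x. h x * ennreal (L v x) * indicator {0..<1} x \<partial>lborel)"
  proof (rule nn_integral_cong)
    fix x
    have "(\<Sum>i<d. k (x + real i)) = (\<Sum>i<d. h x * ennreal (u (x + real i)))"
    proof (intro sum.cong refl)
      fix i show "k (x + real i) = h x * ennreal (u (x + real i))"
        using periodic_int[where v=h and x=x and k="int i", OF hp] by (simp add: k_def)
    qed
    also have "\<dots> = h x * ennreal (L v x)"
      using u0 by (simp add: sum_distrib_left[symmetric] L_def u_def[symmetric] sum_ennreal)
    finally show "(\<Sum>i<d. k (x + real i) * indicator {0..<1} x) = h x * ennreal (L v x) * indicator {0..<1} x"
      by (simp add: sum_distrib_right[symmetric])
  qed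
  finally show ?thesis .
qed

end

section \<open>Growth of multiplicative cocycles along typical orbits\<close>

lemma tendsto_ln_quadratic_over_n:
  "(\<lambda>n. (ln c + 2 * ln (real n + 1)) / real n) \<longlonglongrightarrow> 0"
proof -
  have 1: "(\<lambda>n. ln c * inverse (real n)) \<longlonglongrightarrow> ln c * 0" by (intro tendsto_intros lim_inverse_n)
  have "(\<lambda>n. ln (real (Suc n)) / real (Suc n)) \<longlonglongrightarrow> 0"
    using LIMSEQ_Suc[OF lim_ln_over_n] .
  moreover have "(\<lambda>n. real (Suc n) / real n) \<longlonglongrightarrow> 1"
    using LIMSEQ_Suc_n_over_n by simp
  ultimately have "(\<lambda>n. 2 * ((ln (real (Suc n)) / real (Suc n)) * (real (Suc n) / real n))) \<longlonglongrightarrow> 2 * (0 * 1)"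
    by (intro tendsto_intros)
  from tendsto_add[OF 1 this] have "(\<lambda>n. ln c * inverse (real n) + 2 * ((ln (real (Suc n)) / real (Suc n)) * (real (Suc n) / real n))) \<longlonglongrightarrow> 0"
    by simp
  moreover have "ln c * inverse (real n) + 2 * ((ln (real (Suc n)) / real (Suc n)) * (real (Suc n) / real n)) = (ln c + 2 * ln (real n + 1)) / real n" for n
    by (simp add: field_simps add_divide_distrib del: of_nat_Suc)
  ultimately show ?thesis by simp
qed

context circle_lift begin

text \<open>By duality the products \<open>E n x = 1 / (q (G x) \<cdots> q (G\<^sup>n x))\<close> satisfy
  \<open>\<integral> w E n \<le> \<integral> w\<close>, so they grow at most quadratically for Lebesgue-almost every \<open>x\<close>,
  hence for \<open>M\<close>-almost every \<open>x\<close>.\<close>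

lemma cocycle_integral_nonneg:
  fixes w q :: "real \<Rightarrow> real"
  assumes w: "continuous_on UNIV w" and w1: "\<And>x. w x \<ge> 1" and wp: "\<And>x. w (x + 1) = w x"
  and q: "q \<in> borel_measurable borel" and q0: "\<And>x. ql \<le> q x" "\<And>x. q x \<le> qu" "0 < ql"
  and qp: "\<And>x. q (x + 1) = q x"
  and Lw: "\<And>x. L w x \<le> q x * w x"
  and M: "prob_on_M M" and ac: "absolutely_continuous circle_meas M"
  and inv: "invariant_meas M (circle_map G)"
  shows "integral\<^sup>L M (\<lambda>x. ln (q x)) \<ge> 0"
proof -
  interpret prob_space M using M by (simp add: prob_on_M_def)
  define f where "f = circle_map G"
  have f_meas: "f \<in> measurable M M" and f_distr: "distr M M f = M"
    using inv by (auto simp: invariant_meas_def f_def)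
  have sM: "sets M = sets circle_meas" using M by (simp add: prob_on_M_def)
  have qpos: "q x > 0" for x using q0(1)[of x] q0(3) by linarith
  have [measurable]: "w \<in> borel_measurable borel" "G \<in> borel_measurable borel"
    using w G_cont by (auto intro: borel_measurable_continuous_onI)
  note q[measurable]
  define E where "E = rec_nat (\<lambda>x. 1::real) (\<lambda>n e x. e (G x) / q (G x))"
  have E0: "E 0 x = 1" and ES: "E (Suc n) x = E n (G x) / q (G x)" for n x by (auto simp: E_def)
  have Em[measurable]: "E n \<in> borel_measurable borel" for n
  proof (induction n)
    case 0 thus ?case by (simp add: E0[abs_def])
  next
    case (Suc n)
    note Suc[measurable]
    show ?case unfolding ES[abs_def] by measurable
  qed
  have Ep: "E n (x + 1) = E n x" for n x
  proof (induction n arbitrary: x)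
    case (Suc n)
    have "E n (G x + of_int (int d)) = E n (G x)" by (rule periodic_int) (rule Suc)
    moreover have "q (G x + of_int (int d)) = q (G x)" by (rule periodic_int) (rule qp)
    ultimately show ?case by (simp add: ES G_step)
  qed (simp add: E0)
  have Epos: "E n x > 0" for n x by (induction n arbitrary: x) (auto simp: E0 ES qpos)
  define J where "J n = (\<integral>\<^sup>+x. ennreal (w x) * ennreal (E n x) * indicator {0..<1} x \<partial>lborel)" for n
  have "J (Suc n) \<le> J n" for n
  proof -
    define h where "h x = ennreal (E n x / q x)" for x
    have hm: "h \<in> borel_measurable borel" unfolding h_def[abs_def] by measurable
    have "J (Suc n) = (\<integral>\<^sup>+x. ennreal (w x) * h (G x) * indicator {0..<1} x \<partial>lborel)"
      by (simp add: J_def ES h_def)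
    also have "\<dots> = (\<integral>\<^sup>+x. h x * ennreal (L w x) * indicator {0..<1} x \<partial>lborel)"
      by (rule transfer_duality[OF hm w])
         (use w1 wp Ep qp in \<open>auto simp: h_def intro: order_trans[of 0 1]\<close>)
    also have "\<dots> \<le> J n"
      unfolding J_def
    proof (intro nn_integral_mono mult_right_mono)
      fix x
      have "h x * ennreal (L w x) \<le> h x * ennreal (q x * w x)"
        by (intro mult_left_mono ennreal_leI Lw) simp
      also have "\<dots> = ennreal (E n x / q x * (q x * w x))"
        unfolding h_def using qpos[of x] Epos[of n x] w1[of x] by (intro ennreal_mult[symmetric]) auto
      also have "E n x / q x * (q x * w x) = w x * E n x" using qpos[of x] by simp
      also have "ennreal (w x * E n x) = ennreal (w x) * ennreal (E n x)"
        using Epos[of n x] w1[of x] by (intro ennreal_mult) auto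
      finally show "h x * ennreal (L w x) \<le> ennreal (w x) * ennreal (E n x)" .
    qed simp
    finally show ?thesis .
  qed
  hence Jle: "J n \<le> J 0" for n by (induction n) (auto intro: order_trans)
  have "\<exists>x\<in>{0..1}. \<forall>y\<in>{0..1}. w y \<le> w x"
    by (rule continuous_attains_sup) (use continuous_on_subset[OF w] in auto)
  then obtain x0 where x0: "\<forall>y\<in>{0..1}. w y \<le> w x0" by blast
  define B where "B = w x0"
  have B: "w x \<le> B" if "x \<in> {0..1}" for x using x0 that by (simp add: B_def)
  have "J 0 \<le> (\<integral>\<^sup>+x. ennreal B * indicator {0..<1::real} x \<partial>lborel)"
    unfolding J_def E0 using B by (intro nn_integral_mono) (auto simp: indicator_def intro!: ennreal_leI)
  also have "\<dots> = ennreal B" by (simp add: nn_integral_cmult_indicator)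
  finally have J0: "J 0 \<le> ennreal B" .
  have B0: "B \<ge> 0" using B[of 0] w1[of 0] by simp
  \<comment> \<open>The weights are summable and the integrals \<open>J n\<close> are bounded by
    \<open>J 0\<close>, so F is integrable over a period and finite almost everywhere; finiteness at
    x yields \<open>E n x <= c * (n + 1)^2\<close>.\<close>
  define F where "F x = (\<Sum>n. ennreal (E n x * (1 / (real n + 1)^2)))" for x
  have Fm[measurable]: "F \<in> borel_measurable borel" unfolding F_def[abs_def] by measurable
  have "(\<integral>\<^sup>+x. F x * indicator {0..<1} x \<partial>lborel)
      = (\<integral>\<^sup>+x. (\<Sum>n. ennreal (E n x * (1 / (real n + 1)^2)) * indicator {0..<1} x) \<partial>lborel)"
    unfolding F_def by simp
  also have "\<dots> = (\<Sum>n. \<integral>\<^sup>+x. ennreal (E n x * (1 / (real n + 1)^2)) * indicator {0..<1} x \<partial>lborel)"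
    by (rule nn_integral_suminf) measurable
  also have "\<dots> \<le> (\<Sum>n. ennreal (B * (1 / (real n + 1)^2)))"
  proof (intro suminf_le allI)
    fix n
    define r where "r = 1 / (real n + 1)^2"
    have r: "r \<ge> 0" by (simp add: r_def)
    have "(\<integral>\<^sup>+x. ennreal (E n x * r) * indicator {0..<1} x \<partial>lborel)
       \<le> (\<integral>\<^sup>+x. ennreal r * (ennreal (w x) * ennreal (E n x) * indicator {0..<1} x) \<partial>lborel)"
    proof (intro nn_integral_mono)
      fix x
      have "E n x * r \<le> r * (w x * E n x)" using r w1[of x] Epos[of n x] by (simp add: mult.commute mult_left_mono)
      hence "ennreal (E n x * r) \<le> ennreal (r * (w x * E n x))" by (rule ennreal_leI)
      also have "\<dots> = ennreal r * (ennreal (w x) * ennreal (E n x))"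
        using r w1[of x] Epos[of n x] by (simp add: ennreal_mult less_imp_le)
      finally show "ennreal (E n x * r) * indicator {0..<1} x \<le> ennreal r * (ennreal (w x) * ennreal (E n x) * indicator {0..<1} x)"
        by (auto simp: indicator_def)
    qed
    also have "\<dots> = ennreal r * J n" unfolding J_def by (rule nn_integral_cmult) measurable
    also have "\<dots> \<le> ennreal r * ennreal B" using order_trans[OF Jle J0] by (intro mult_left_mono) auto
    also have "\<dots> = ennreal (B * r)" using r B0 by (simp add: ennreal_mult mult.commute)
    finally show "(\<integral>\<^sup>+x. ennreal (E n x * (1 / (real n + 1)^2)) * indicator {0..<1} x \<partial>lborel)
      \<le> ennreal (B * (1 / (real n + 1)^2))" by (simp add: r_def)
  qed auto
  also have "\<dots> < \<infinity>"
  proof -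
    have "(\<lambda>n. B * (1 / (real n + 1)^2)) sums (B * (pi^2/6))"
      using sums_mult[OF inverse_squares_sums, of B] by (simp add: add.commute)
    hence "(\<Sum>n. ennreal (B * (1 / (real n + 1)^2))) = ennreal (B * (pi^2/6))"
      using B0 by (intro suminf_ennreal_eq) auto
    thus ?thesis by simp
  qed
  finally have fin: "(\<integral>\<^sup>+x. F x * indicator {0..<1} x \<partial>lborel) \<noteq> \<infinity>" by simp
  have "AE x in lborel. F x * indicator {0..<1} x \<noteq> \<infinity>"
    by (rule nn_integral_noteq_infinite[OF _ fin]) measurable
  hence "AE x in lborel. x \<in> {0..<1} \<longrightarrow> F x \<noteq> \<infinity>" by eventually_elim auto
  hence "AE x in circle_meas. F x \<noteq> \<infinity>" unfolding circle_meas_def by (subst AE_restrict_space_iff) auto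
  hence AEF: "AE x in M. F x \<noteq> \<infinity>" by (rule absolutely_continuous_AE[OF sM ac])
  \<comment> \<open>Only upper bounds for \<open>E n\<close> are available, and \<open>E n x\<close>
    may well decay, so it is the positive part of ln (E n x) / n that tends to 0. By invariance the
    integral of ln (E n x) / n is minus the integral of ln q for n > 0, and it is at most the
    integral of \<open>g n\<close>.\<close>
  define g where "g n x = max 0 (ln (E n x) / real n)" for n x
  have g_lim: "(\<lambda>n. g n x) \<longlonglongrightarrow> 0" if Fx: "F x \<noteq> \<infinity>" for x
  proof -
    obtain c where c: "F x = ennreal c" "c \<ge> 0" using Fx by (cases "F x") auto
    define c' where "c' = c + 1"
    have Eb: "E n x \<le> c' * (real n + 1)^2" for n
    proof -
      have "ennreal (E n x * (1 / (real n + 1)^2)) = (\<Sum>k\<in>{n}. ennreal (E k x * (1 / (real k + 1)^2)))" by simp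
      also have "\<dots> \<le> F x" unfolding F_def by (rule sum_le_suminf) auto
      finally have "E n x * (1 / (real n + 1)^2) \<le> c" unfolding c(1) using c(2) by simp
      hence "E n x \<le> c * (real n + 1)^2" by (simp add: field_simps)
      also have "\<dots> \<le> c' * (real n + 1)^2" unfolding c'_def by (intro mult_right_mono) auto
      finally show ?thesis .
    qed
    have lnE: "ln (E n x) \<le> ln c' + 2 * ln (real n + 1)" for n
    proof -
      have "ln (E n x) \<le> ln (c' * (real n + 1)^2)" using Eb[of n] Epos[of n x] by simp
      also have "\<dots> = ln c' + 2 * ln (real n + 1)"
        using c(2) by (simp add: c'_def ln_mult ln_realpow)
      finally show ?thesis .
    qed
    have "(\<lambda>n. max 0 ((ln c' + 2 * ln (real n + 1)) / real n)) \<longlonglongrightarrow> max 0 0"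
      by (intro tendsto_max tendsto_const tendsto_ln_quadratic_over_n)
    hence up: "(\<lambda>n. max 0 ((ln c' + 2 * ln (real n + 1)) / real n)) \<longlonglongrightarrow> 0" by simp
    show ?thesis
    proof (rule tendsto_sandwich[OF _ _ tendsto_const up])
      show "\<forall>\<^sub>F n in sequentially. 0 \<le> g n x" by (rule always_eventually) (simp add: g_def)
      show "\<forall>\<^sub>F n in sequentially. g n x \<le> max 0 ((ln c' + 2 * ln (real n + 1)) / real n)"
        unfolding g_def by (intro always_eventually allI max.mono order_refl divide_right_mono lnE) auto
    qed
  qed
  define b where "b = max \<bar>ln ql\<bar> \<bar>ln qu\<bar>"
  have lnq: "\<bar>ln (q x)\<bar> \<le> b" for x
  proof -
    have "ln ql \<le> ln (q x)" using ln_mono[OF q0(1)[of x] q0(3)] .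
    moreover have "ln (q x) \<le> ln qu" using ln_mono[OF q0(2)[of x] qpos[of x]] .
    ultimately show ?thesis unfolding b_def by linarith
  qed
  have lnE_b: "\<bar>ln (E n x)\<bar> \<le> real n * b" for n x
  proof (induction n arbitrary: x)
    case (Suc n)
    have "ln (E (Suc n) x) = ln (E n (G x)) - ln (q (G x))" unfolding ES by (simp add: ln_divide_pos Epos qpos)
    thus ?case using Suc[of "G x"] lnq[of "G x"] by (simp add: algebra_simps)
  qed (simp add: E0)
  have b0: "b \<ge> 0" by (simp add: b_def)
  have Mm: "h \<in> borel_measurable M" if "h \<in> borel_measurable borel" for h :: "real \<Rightarrow> real"
    by (rule prob_on_M_measurable[OF M that])
  have iq: "integrable M (\<lambda>x. ln (q x))"
    by (rule integrable_const_bound[of _ b]) (use lnq in \<open>auto intro!: Mm\<close>)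
  have iE: "integrable M (\<lambda>x. ln (E n x))" for n
    by (rule integrable_const_bound[of _ "real n * b"]) (use lnE_b in \<open>auto intro!: Mm\<close>)
  have shift: "integral\<^sup>L M (\<lambda>x. h (G x)) = integral\<^sup>L M h"
    if hm: "h \<in> borel_measurable borel" and hp: "\<And>x. h (x + 1) = h x" for h :: "real \<Rightarrow> real"
  proof -
    have "integral\<^sup>L M h = integral\<^sup>L (distr M M f) h" by (simp add: f_distr)
    also have "\<dots> = integral\<^sup>L M (\<lambda>x. h (f x))" by (rule integral_distr[OF f_meas Mm[OF hm]])
    also have "\<dots> = integral\<^sup>L M (\<lambda>x. h (G x))"
      unfolding f_def circle_map_def using periodic_frac[where v=h, OF hp] by simp
    finally show ?thesis by simp
  qed
  define I where "I = integral\<^sup>L M (\<lambda>x. ln (q x))"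
  have intE: "integral\<^sup>L M (\<lambda>x. ln (E n x)) = - real n * I" for n
  proof (induction n)
    case (Suc n)
    have "integral\<^sup>L M (\<lambda>x. ln (E (Suc n) x)) = integral\<^sup>L M (\<lambda>x. (\<lambda>y. ln (E n y) - ln (q y)) (G x))"
      unfolding ES by (simp add: ln_divide_pos Epos qpos)
    also have "\<dots> = integral\<^sup>L M (\<lambda>y. ln (E n y) - ln (q y))"
      by (rule shift) (auto simp: Ep qp)
    also have "\<dots> = integral\<^sup>L M (\<lambda>y. ln (E n y)) - I"
      unfolding I_def by (rule Bochner_Integration.integral_diff[OF iE iq])
    finally show ?case using Suc by (simp add: algebra_simps)
  qed (simp add: E0)
  have gm: "g n \<in> borel_measurable M" for n unfolding g_def[abs_def] by (intro Mm) measurable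
  have g_b: "\<bar>g n x\<bar> \<le> b" for n x
  proof (cases "n = 0")
    case False
    have "ln (E n x) / real n \<le> b" using lnE_b[of n x] False by (simp add: field_simps abs_le_iff)
    thus ?thesis using b0 by (simp add: g_def)
  qed (use b0 in \<open>simp add: g_def\<close>)
  have ig: "integrable M (g n)" for n
    by (rule integrable_const_bound[of _ b]) (use g_b gm in auto)
  have "(\<lambda>n. integral\<^sup>L M (g n)) \<longlonglongrightarrow> integral\<^sup>L M (\<lambda>x. 0)"
    by (rule integral_dominated_convergence[where w="\<lambda>_. b"])
       (use gm g_b AEF g_lim in \<open>auto intro: eventually_mono[OF AEF]\<close>)
  hence lim: "(\<lambda>n. integral\<^sup>L M (g n)) \<longlonglongrightarrow> 0" by simp
  have "- I \<le> integral\<^sup>L M (g n)" if "n > 0" for n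
  proof -
    have "- I = integral\<^sup>L M (\<lambda>x. ln (E n x) / real n)" using that by (simp add: intE)
    also have "\<dots> \<le> integral\<^sup>L M (g n)"
      by (intro integral_mono ig integrable_divide iE) (simp add: g_def)
    finally show ?thesis .
  qed
  hence "- I \<le> 0"
    by (intro LIMSEQ_le_const[OF lim]) (auto intro: exI[of _ 1])
  thus ?thesis by (simp add: I_def)
qed

end

section \<open>Expanding maps with a saddle-node\<close>

text \<open>\<open>p\<close> is the fixed point at the left end of the immediate basin of 0, so
  [p, 0] is the closure of that basin and (0, p + 1] is the expanding part. The ends p and
  \<open>b = p + 1\<close> are the same point of the circle; with [p, b] as period, 0 is an interior
  point.\<close>

locale saddle_lift = circle_lift +
  fixes G'' :: "real \<Rightarrow> real" and p :: real
  assumes G0: "G 0 = 0" and d2: "d \<ge> 2"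
    and p: "-1 < p" "p < 0" and Gp: "G p = p"
    and G_above: "\<And>x. p < x \<Longrightarrow> x < 0 \<Longrightarrow> G x > x"
    and G'_gt: "\<And>x. 0 < x \<Longrightarrow> x \<le> p + 1 \<Longrightarrow> G' x > 1"
    and G'0: "G' 0 = 1"
    and G''_deriv: "\<And>x. (G' has_real_derivative G'' x) (at x)"
    and G''_cont: "continuous_on UNIV G''"
    and G''0: "G'' 0 > 0"
begin

abbreviation "b \<equiv> p + 1"

text \<open>The branch fixing 0 maps [0, e] onto [0, b], and the gap (e, Gi 1) goes onto (b, 1),
  which is the basin interval (p, 0) translated by 1.\<close>

definition "e = Gi b"

lemma Gi0: "Gi 0 = 0" using Gi_G[of 0] by (simp add: G0)
lemma Gip: "Gi p = p" using Gi_G[of p] by (simp add: Gp)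
lemma Gb: "G b = b + real d - 1" using G_step[of p] by (simp add: Gp)

lemma e: "0 < e" "e < b" "e < Gi 1" "Gi 1 \<le> b" "G e = b"
proof -
  show "0 < e" using Gi_less_iff[of 0 b] p by (simp add: e_def Gi0)
  show "G e = b" by (simp add: e_def)
  thus "e < b" using G_less_iff[of e b] Gb d2 by simp
  show "e < Gi 1" unfolding e_def using p by (simp add: Gi_less_iff)
  show "Gi 1 \<le> b" using G_le_iff[of "Gi 1" b] Gb d2 p by simp
qed

text \<open>Since \<open>G b = b + d - 1\<close>, all d inverse branches map [0, b] into itself. The
  distortion of \<open>L v\<close> on (0, b] is therefore governed by that of v on the same
  interval, whatever v does in the basin.\<close>

lemma branch_bounds:
  assumes "0 \<le> x" "x \<le> b" "i < d"
  shows "0 \<le> Gi (x + real i)" "Gi (x + real i) \<le> b" "0 < x \<Longrightarrow> 0 < Gi (x + real i)"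
proof -
  show "0 \<le> Gi (x + real i)" using Gi_le_iff[of 0 "x + real i"] assms by (simp add: Gi0)
  have "real i \<le> real d - 1" using assms(3) by linarith
  hence "x + real i \<le> G b" using assms Gb by linarith
  thus "Gi (x + real i) \<le> b" using G_le_iff[of "Gi (x + real i)" b] by simp
  show "0 < Gi (x + real i)" if "0 < x" using Gi_less_iff[of 0 "x + real i"] assms that by (simp add: Gi0)
qed

text \<open>Only the branch i = 0 can approach the neutral point, also when x lies in the
  basin.\<close>

lemma far_branch_bounds:
  assumes "p \<le> x" "x \<le> b" "1 \<le> i" "i < d"
  shows "e \<le> Gi (x + real i)" "Gi (x + real i) \<le> b"
proof -
  show "e \<le> Gi (x + real i)" unfolding e_def Gi_le_iff using assms by simp
  have "real i \<le> real d - 1" using assms(4) by linarith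
  hence "x + real i \<le> G b" using assms Gb by linarith
  thus "Gi (x + real i) \<le> b" using G_le_iff[of "Gi (x + real i)" b] by simp
qed

lemma G'_ge_1: "0 \<le> x \<Longrightarrow> x \<le> b \<Longrightarrow> G' x \<ge> 1"
  using G'_gt[of x] G'0 by (cases "x = 0") auto

text \<open>The weight \<open>1/z + A\<close> is chosen so that \<open>G\<close> expands the metric \<open>(1/z + A) dz\<close>
  on \<open>(0, b]\<close> strongly enough to absorb the distortion, uniformly up to the
  neutral point \<open>0\<close>; near \<open>0\<close> this uses \<open>G''(0) > 0\<close>.\<close>

definition dist_consts :: "real \<Rightarrow> real \<Rightarrow> bool" where
  "dist_consts K A \<longleftrightarrow> K > 0 \<and> A > 0 \<and> (\<forall>z i. 0 < z \<longrightarrow> z \<le> b \<longrightarrow> 0 < G z - real i \<longrightarrow> G z - real i \<le> b \<longrightarrow>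
     K * (1 / z + A) + \<bar>G'' z\<bar> / G' z \<le> K * G' z * (1 / (G z - real i) + A))"

text \<open>Two regimes, with D a bound for |G''| / G'. For z >= \<delta> the derivative is at least
  l > 1, and the constant term A pays for everything. For z < \<delta> only i = 0 occurs and the
  derivative may be close to 1; there the gain is G' z / G z - 1 / z >= a / 4, a second order effect
  of G'' >= a.\<close>

lemma dist_consts_exist: "\<exists>K A. dist_consts K A"
proof -
  have G'_ne: "G' x \<noteq> 0" for x using G'_pos[of x] by simp
  have "\<exists>x\<in>{0..b}. \<forall>y\<in>{0..b}. \<bar>G'' y\<bar> / G' y \<le> \<bar>G'' x\<bar> / G' x"
  proof (rule continuous_attains_sup)
    have "continuous_on UNIV (\<lambda>y. \<bar>G'' y\<bar> / G' y)"
      by (intro continuous_on_divide continuous_on_rabs G''_cont G'_cont) (use G'_ne in simp)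
    thus "continuous_on {0..b} (\<lambda>y. \<bar>G'' y\<bar> / G' y)" by (rule continuous_on_subset) simp
  qed (use p in auto)
  then obtain x0 where x0: "\<forall>y\<in>{0..b}. \<bar>G'' y\<bar> / G' y \<le> \<bar>G'' x0\<bar> / G' x0" by blast
  define D where "D = \<bar>G'' x0\<bar> / G' x0 + 1"
  have D: "\<bar>G'' y\<bar> / G' y \<le> D" if "0 \<le> y" "y \<le> b" for y
    using x0 that by (auto simp: D_def intro: order_trans[of _ "\<bar>G'' x0\<bar> / G' x0"])
  have D0: "D > 0" unfolding D_def using G'_pos[of x0] by (simp add: add_nonneg_pos less_imp_le)
  define a where "a = G'' 0 / 2"
  have a: "a > 0" using G''0 by (simp add: a_def)
  have "G'' \<midarrow>0\<rightarrow> G'' 0" "G' \<midarrow>0\<rightarrow> G' 0"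
    using G''_cont G'_cont by (auto simp: continuous_on_eq_continuous_at isCont_def)
  moreover have "a < G'' 0" "G' 0 < 2" using G''0 G'0 by (auto simp: a_def)
  ultimately have "\<forall>\<^sub>F z in at 0. G'' z > a" "\<forall>\<^sub>F z in at 0. G' z < 2"
    by (auto intro: order_tendstoD)
  hence "\<forall>\<^sub>F z in at 0. G'' z > a \<and> G' z < 2" by eventually_elim simp
  then obtain \<delta>1 where \<delta>1: "\<delta>1 > 0" "\<And>z. z \<noteq> 0 \<Longrightarrow> \<bar>z\<bar> < \<delta>1 \<Longrightarrow> G'' z > a \<and> G' z < 2"
    by (auto simp: eventually_at dist_real_def)
  define \<delta> where "\<delta> = min (\<delta>1 / 2) (e / 2)"
  have \<delta>: "\<delta> > 0" "\<delta> < \<delta>1" "\<delta> < e" using \<delta>1(1) e(1) by (auto simp: \<delta>_def)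
  have "\<exists>x\<in>{\<delta>..b}. \<forall>y\<in>{\<delta>..b}. G' x \<le> G' y"
    by (rule continuous_attains_inf) (use \<delta> e(2) continuous_on_subset[OF G'_cont] in auto)
  then obtain x1 where x1: "x1 \<in> {\<delta>..b}" "\<forall>y\<in>{\<delta>..b}. G' x1 \<le> G' y" by blast
  define l where "l = G' x1"
  have l: "l > 1" unfolding l_def by (rule G'_gt) (use x1 \<delta> in auto)
  \<comment> \<open>\<open>K >= D\<close> serves z >= \<delta>, and \<open>K * a / 4 >= D\<close>
    serves z < \<delta>. A is chosen so that \<open>A * (l - 1)\<close> covers both 1 / z <= 1 /
    \<delta> and the distortion term, which is at most K.\<close>
  define K where "K = D + 4 * D / a"
  have K: "K > 0" "K \<ge> D" "K * a / 4 \<ge> D" using D0 a by (auto simp: K_def field_simps add_pos_pos)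
  define A where "A = (1 / \<delta> + 1) / (l - 1)"
  have A: "A > 0" "A * (l - 1) = 1 / \<delta> + 1" using l \<delta> by (auto simp: A_def add_pos_pos)
  have main: "K * (1 / z + A) + \<bar>G'' z\<bar> / G' z \<le> K * G' z * (1 / (G z - real i) + A)"
    if z: "0 < z" "z \<le> b" and i: "0 < G z - real i" for z i
  proof (cases "z \<ge> \<delta>")
    case True
    have "1 / z \<le> 1 / \<delta>" using True \<delta> z by (simp add: frac_le)
    hence "K * (1 / z + A) + \<bar>G'' z\<bar> / G' z \<le> K * (1 / \<delta> + A) + K"
      using D[of z] z K by (intro add_mono mult_left_mono) auto
    also have "\<dots> = K * l * (0 + A)" using arg_cong[OF A(2), of "\<lambda>t. K * t"] by (simp add: algebra_simps)
    also have "\<dots> \<le> K * G' z * (1 / (G z - real i) + A)"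
    proof (rule mult_mono)
      show "K * l \<le> K * G' z" using x1(2) True z K by (simp add: l_def)
      show "0 \<le> K * G' z" using K G'_pos[of z] by simp
      show "0 + A \<le> 1 / (G z - real i) + A" using i by simp
    qed (use A(1) in simp)
    finally show ?thesis .
  next
    case False
    hence z\<delta>: "z < \<delta>" by simp
    have "G z < 1" using G_less_iff[of z e] z\<delta> \<delta> e(5) p by simp
    hence i0: "i = 0" using i by (cases i) auto
    have Gz: "G z > 0" using G_less_iff[of 0 z] z G0 by simp
    have near: "G'' s \<ge> a" "G' s \<le> 2" if "0 \<le> s" "s \<le> z" for s
      using \<delta>1(2)[of s] that z\<delta> \<delta> G''0 G'0 by (cases "s = 0", auto simp: a_def)+
    have "2 * 0 - G 0 \<le> 2 * z - G z"
    proof (rule DERIV_nonneg_imp_nondecreasing[of 0 z])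
      fix s assume s: "0 \<le> s" "s \<le> z"
      have "((\<lambda>s. 2 * s - G s) has_real_derivative 2 - G' s) (at s)"
        by (auto intro!: derivative_eq_intros G_deriv)
      thus "\<exists>y. ((\<lambda>s. 2 * s - G s) has_real_derivative y) (at s) \<and> 0 \<le> y"
        using near(2)[OF s] by auto
    qed (use z in auto)
    hence G2: "G z \<le> 2 * z" using G0 by simp
    \<comment> \<open>Integrating G'' >= a against s gives z G' z - G z >= a z^2 / 2. Divided by z G
      z <= 2 z^2 this becomes the gain a / 4.\<close>
    have "0 * G' 0 - G 0 - a * 0^2 / 2 \<le> z * G' z - G z - a * z^2 / 2"
    proof (rule DERIV_nonneg_imp_nondecreasing[of 0 z])
      fix s assume s: "0 \<le> s" "s \<le> z"
      have "((\<lambda>s. s * G' s - G s - a * s^2 / 2) has_real_derivative s * (G'' s - a)) (at s)"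
        by (auto intro!: derivative_eq_intros G_deriv G''_deriv simp: algebra_simps)
      thus "\<exists>y. ((\<lambda>s. s * G' s - G s - a * s^2 / 2) has_real_derivative y) (at s) \<and> 0 \<le> y"
        using near(1)[OF s] s by (intro exI[of _ "s * (G'' s - a)"]) simp
    qed (use z in auto)
    hence lower: "a * z^2 / 2 \<le> z * G' z - G z" using G0 by simp
    have "a / 4 * (z * G z) \<le> a / 4 * (z * (2 * z))"
      using G2 z a by (intro mult_left_mono) auto
    also have "\<dots> = a * z^2 / 2" by (simp add: power2_eq_square)
    also note lower
    finally have "a / 4 \<le> G' z / G z - 1 / z" using z Gz by (simp add: field_simps)
    hence "K * (a / 4) \<le> K * (G' z / G z - 1 / z)" using K by (intro mult_left_mono) auto
    hence "D + K * (1 / z) \<le> K * G' z * (1 / G z)" using K by (simp add: algebra_simps)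
    moreover have "K * A * 1 \<le> K * A * G' z" using K A z G'_ge_1[of z] by (intro mult_left_mono) auto
    moreover have "\<bar>G'' z\<bar> / G' z \<le> D" using D z by simp
    ultimately show ?thesis unfolding i0 by (simp add: algebra_simps)
  qed
  thus ?thesis unfolding dist_consts_def using K A by blast
qed

text \<open>ln v is Lipschitz on (0, b] for the metric K (1 / z + A) dz, whose primitive is
  \<open>K * (ln z + A * z)\<close>. The multiplicative form passes directly to sums over
  branches.\<close>

definition cone :: "real \<Rightarrow> real \<Rightarrow> (real \<Rightarrow> real) \<Rightarrow> bool" where
  "cone K A v \<longleftrightarrow> (\<forall>x y. 0 < x \<longrightarrow> x \<le> y \<longrightarrow> y \<le> b \<longrightarrow>
     v x \<le> v y * exp (K * (ln y + A * y) - K * (ln x + A * x)) \<and>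
     v y \<le> v x * exp (K * (ln y + A * y) - K * (ln x + A * x)))"

text \<open>By \<open>dist_consts\<close>, in each branch G stretches the metric by at least the
  variation of ln G'. Hence the ratio of corresponding terms of \<open>L v\<close> at x and y, the
  factor 1 / G' included, obeys the bound required by the cone, and so does the ratio of the
  sums.\<close>

lemma cone_L:
  assumes KA: "dist_consts K A" and v: "cone K A v" and v0: "\<And>x. v x \<ge> 0"
  shows "cone K A (L v)"
  unfolding cone_def
proof (intro allI impI)
  fix x y assume xy: "0 < x" "x \<le> y" "y \<le> b"
  define al where "al z = K * (ln z + A * z)" for z
  have K: "K > 0" "A > 0" using KA by (auto simp: dist_consts_def)
  have tm: "v (Gi (x + real i)) / G' (Gi (x + real i)) \<le> v (Gi (y + real i)) / G' (Gi (y + real i)) * exp (al y - al x)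
    \<and> v (Gi (y + real i)) / G' (Gi (y + real i)) \<le> v (Gi (x + real i)) / G' (Gi (x + real i)) * exp (al y - al x)"
    if i: "i < d" for i
  proof -
    define u z where "u = Gi (x + real i)" and "z = Gi (y + real i)"
    have u0: "0 < u" unfolding u_def by (rule branch_bounds) (use xy i in auto)
    have zb: "z \<le> b" unfolding z_def by (rule branch_bounds) (use xy i in auto)
    have uz: "u \<le> z" unfolding u_def z_def Gi_le_iff using xy by simp
    have Gu: "G u - real i = x" "G z - real i = y" by (auto simp: u_def z_def)
    \<comment> \<open>This is \<open>dist_consts\<close> integrated from u to z; \<sigma> = 1 and
      \<sigma> = -1 give the two directions in which 1 / G' may vary.\<close>
    have mono: "al (G u - real i) - al u + \<sigma> * ln (G' u) \<le> al (G z - real i) - al z + \<sigma> * ln (G' z)"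
      if \<sigma>: "\<bar>\<sigma>\<bar> = 1" for \<sigma> :: real
    proof (rule DERIV_nonneg_imp_nondecreasing[OF uz])
      fix s assume s: "u \<le> s" "s \<le> z"
      have s0: "0 < s" "s \<le> b" using s u0 zb by auto
      have Gs: "x \<le> G s - real i" "G s - real i \<le> y" using G_le_iff[of u s] G_le_iff[of s z] s Gu by auto
      hence Gs0: "0 < G s - real i" "G s - real i \<le> b" using xy by auto
      have g: "G' s > 0" by (rule G'_pos)
      define D where "D = K * (1 / (G s - real i) * G' s + A * G' s) - K * (1 / s + A) + \<sigma> * (G'' s / G' s)"
      have "((\<lambda>s. al (G s - real i) - al s + \<sigma> * ln (G' s)) has_real_derivative D) (at s)"
        unfolding al_def D_def using s0 Gs0 g
        by (auto intro!: derivative_eq_intros G_deriv G''_deriv simp: field_simps)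
      moreover have "D \<ge> 0"
      proof -
        have "K * (1 / s + A) + \<bar>G'' s\<bar> / G' s \<le> K * G' s * (1 / (G s - real i) + A)"
          using KA s0 Gs0 unfolding dist_consts_def by blast
        moreover have "\<bar>\<sigma> * (G'' s / G' s)\<bar> = \<bar>G'' s\<bar> / G' s" using \<sigma> g by (simp add: abs_mult)
        moreover have "K * (1 / (G s - real i) * G' s + A * G' s) = K * G' s * (1 / (G s - real i) + A)"
          by (simp add: algebra_simps)
        ultimately show ?thesis unfolding D_def by linarith
      qed
      ultimately show "\<exists>D. ((\<lambda>s. al (G s - real i) - al s + \<sigma> * ln (G' s)) has_real_derivative D) (at s) \<and> 0 \<le> D"
        by blast
    qed
    have le1: "al z - al u + (ln (G' u) - ln (G' z)) \<le> al y - al x" using mono[of 1] unfolding Gu by simp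
    have le2: "al z - al u + (ln (G' z) - ln (G' u)) \<le> al y - al x" using mono[of "-1"] unfolding Gu by simp
    have vv: "v u \<le> v z * exp (al z - al u)" "v z \<le> v u * exp (al z - al u)"
      using v u0 uz zb unfolding cone_def al_def by blast+
    have gg: "1 / G' u = 1 / G' z * exp (ln (G' z) - ln (G' u))" "1 / G' z = 1 / G' u * exp (ln (G' u) - ln (G' z))"
      using G'_pos[of u] G'_pos[of z] by (simp_all add: exp_diff)
    have "v u / G' u \<le> v z * exp (al z - al u) * (1 / G' u)"
      using mult_right_mono[OF vv(1), of "1 / G' u"] G'_pos[of u] by (simp add: less_imp_le)
    also have "\<dots> = v z / G' z * exp (al z - al u + (ln (G' z) - ln (G' u)))"
      unfolding gg(1) exp_add by simp
    also have "\<dots> \<le> v z / G' z * exp (al y - al x)"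
      using le2 v0 G'_pos[of z] by (intro mult_left_mono) (auto intro!: divide_nonneg_nonneg less_imp_le)
    finally have 1: "v u / G' u \<le> v z / G' z * exp (al y - al x)" .
    have "v z / G' z \<le> v u * exp (al z - al u) * (1 / G' z)"
      using mult_right_mono[OF vv(2), of "1 / G' z"] G'_pos[of z] by (simp add: less_imp_le)
    also have "\<dots> = v u / G' u * exp (al z - al u + (ln (G' u) - ln (G' z)))"
      unfolding gg(2) exp_add by simp
    also have "\<dots> \<le> v u / G' u * exp (al y - al x)"
      using le1 v0 G'_pos[of u] by (intro mult_left_mono) (auto intro!: divide_nonneg_nonneg less_imp_le)
    finally have 2: "v z / G' z \<le> v u / G' u * exp (al y - al x)" .
    show ?thesis using 1 2 unfolding u_def z_def by blast
  qed
  have "L v x \<le> L v y * exp (al y - al x)" unfolding L_def sum_distrib_right by (intro sum_mono) (use tm in auto)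
  moreover have "L v y \<le> L v x * exp (al y - al x)" unfolding L_def sum_distrib_right by (intro sum_mono) (use tm in auto)
  ultimately show "L v x \<le> L v y * exp (K * (ln y + A * y) - K * (ln x + A * x)) \<and>
    L v y \<le> L v x * exp (K * (ln y + A * y) - K * (ln x + A * x))" by (simp add: al_def)
qed

end

section \<open>Iterates of the constant function 1 under the transfer operator\<close>

context saddle_lift begin

definition W :: "nat \<Rightarrow> real \<Rightarrow> real" where "W n = (L ^^ n) (\<lambda>_. 1)"

lemma W_0 [simp]: "W 0 x = 1" and W_Suc: "W (Suc n) x = L (W n) x"
  by (simp_all add: W_def)

lemma W_Suc': "W (Suc n) = L (W n)"
  by (simp add: W_def)

lemma W_cont: "continuous_on UNIV (W n)"
proof (induction n)
  case 0 show ?case by (simp add: W_def)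
next
  case (Suc n) thus ?case unfolding W_Suc' by (rule L_cont)
qed

lemma W_periodic: "W n (x + 1) = W n x"
  by (induction n arbitrary: x) (auto simp: W_Suc L_periodic)

lemma W_pos: "W n x > 0"
  by (induction n arbitrary: x) (auto simp: W_Suc L_pos)

lemma W_cone: "dist_consts K A \<Longrightarrow> cone K A (W n)"
proof (induction n)
  case 0
  have "0 \<le> K * (ln y + A * y) - K * (ln x + A * x)" if "0 < x" "x \<le> y" for x y
  proof -
    have "ln x \<le> ln y" by (rule ln_mono) (use that in auto)
    moreover have "A * x \<le> A * y" using 0 that by (simp add: dist_consts_def)
    ultimately have "K * (ln x + A * x) \<le> K * (ln y + A * y)"
      using 0 by (intro mult_left_mono add_mono) (simp_all add: dist_consts_def)
    thus ?thesis by simp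
  qed
  thus ?case unfolding cone_def by auto
next
  case (Suc n)
  show ?case unfolding W_Suc'
    by (rule cone_L[OF Suc.prems Suc.IH[OF Suc.prems] less_imp_le[OF W_pos]])
qed

text \<open>A Harnack inequality drawn from the cone, with a constant independent of n. It makes
  \<open>W n b\<close> the reference value for \<open>W n\<close> on [\<delta>, b].\<close>

lemma W_le_W_b:
  assumes KA: "dist_consts K A" and x: "0 < \<delta>" "\<delta> \<le> x" "x \<le> b"
  shows "W n x \<le> exp (K * (ln b + A * b) - K * (ln \<delta> + A * \<delta>)) * W n b"
    "W n b \<le> exp (K * (ln b + A * b) - K * (ln \<delta> + A * \<delta>)) * W n x"
proof -
  define al where "al z = K * (ln z + A * z)" for z
  have "al \<delta> \<le> al x" unfolding al_def
    using KA x by (intro mult_left_mono add_mono ln_mono) (auto simp: dist_consts_def)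
  hence ex: "exp (al b - al x) \<le> exp (al b - al \<delta>)" by simp
  have c: "W n x \<le> W n b * exp (al b - al x)" "W n b \<le> W n x * exp (al b - al x)"
    using W_cone[OF KA, of n] x unfolding cone_def al_def by auto
  have "W n b * exp (al b - al x) \<le> W n b * exp (al b - al \<delta>)"
    "W n x * exp (al b - al x) \<le> W n x * exp (al b - al \<delta>)"
    using ex W_pos[of n] by (auto intro!: mult_left_mono less_imp_le)
  with c show "W n x \<le> exp (K * (ln b + A * b) - K * (ln \<delta> + A * \<delta>)) * W n b"
    "W n b \<le> exp (K * (ln b + A * b) - K * (ln \<delta> + A * \<delta>)) * W n x"
    by (auto simp: al_def mult.commute)
qed

text \<open>Mass escapes from \<open>[0, b]\<close> through the gap \<open>(e, Gi 1)\<close>, which \<open>G\<close> maps onto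
  \<open>(b, 1)\<close>; the total escaping mass is at most the initial mass.\<close>

lemma W_b_summable: "\<exists>C>0. \<forall>n. (\<Sum>k<n. W k b) \<le> C"
proof -
  obtain K A where KA: "dist_consts K A" using dist_consts_exist by blast
  define c where "c = exp (K * (ln b + A * b) - K * (ln e + A * e))"
  have c0: "c > 0" by (simp add: c_def)
  \<comment> \<open>\<open>h\<close> is the indicator of the arc [0, b], made periodic so that
    duality applies; \<open>J n\<close> is then the mass that \<open>W n\<close> gives to this
    arc.\<close>
  define h :: "real \<Rightarrow> ennreal" where "h = indicator {x. frac x \<le> b}"
  have fm: "(frac :: real \<Rightarrow> real) \<in> borel_measurable borel" unfolding frac_def[abs_def] by measurable
  have "{x::real. frac x \<le> b} \<in> sets borel" using fm by simp
  hence hm[measurable]: "h \<in> borel_measurable borel"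
    unfolding h_def by (rule borel_measurable_indicator)
  have [measurable]: "W n \<in> borel_measurable borel" for n
    by (rule borel_measurable_continuous_onI[OF W_cont])
  define J where "J n = (\<integral>\<^sup>+x. ennreal (W n x) * h x * indicator {0..<1} x \<partial>lborel)" for n
  define gap where "gap n = (\<integral>\<^sup>+x. ennreal (W n x) * indicator {e<..<Gi 1} x \<partial>lborel)" for n
  have e1: "Gi 1 \<le> b" "b < 1" using e p by auto
  have step: "J (Suc n) + gap n \<le> J n" for n
  proof -
    have "J (Suc n) = (\<integral>\<^sup>+x. h x * ennreal (L (W n) x) * indicator {0..<1} x \<partial>lborel)"
      unfolding J_def W_Suc by (simp add: mult.commute)
    also have "\<dots> = (\<integral>\<^sup>+x. ennreal (W n x) * h (G x) * indicator {0..<1} x \<partial>lborel)"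
      by (rule transfer_duality[OF hm W_cont, symmetric])
         (simp_all add: W_periodic less_imp_le[OF W_pos] h_def indicator_def frac_1_eq)
    finally have "J (Suc n) + gap n = (\<integral>\<^sup>+x. ennreal (W n x) * h (G x) * indicator {0..<1} x
       + ennreal (W n x) * indicator {e<..<Gi 1} x \<partial>lborel)"
      unfolding gap_def by (subst nn_integral_add) (auto intro!: borel_measurable_times_ennreal
        measurable_compose[OF borel_measurable_continuous_onI[OF G_cont]])
    also have "\<dots> \<le> J n"
      unfolding J_def
    proof (rule nn_integral_mono)
      fix x
      show "ennreal (W n x) * h (G x) * indicator {0..<1} x + ennreal (W n x) * indicator {e<..<Gi 1} x
        \<le> ennreal (W n x) * h x * indicator {0..<1} x"
      proof (cases "x \<in> {0..<1}")
        case False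
        hence "x \<notin> {e<..<Gi 1}" using e p by auto
        thus ?thesis using False by simp
      next
        case True
        have fx: "frac x = x" using True by (simp add: frac_eq)
        have gapx: "\<not> frac (G x) \<le> b \<and> x \<le> b" if "x \<in> {e<..<Gi 1}"
        proof -
          have "b < G x" "G x < 1" using that G_less_iff[of e x] G_less_iff[of x "Gi 1"] e(5) by auto
          moreover from this have "frac (G x) = G x" using p by (simp add: frac_eq)
          ultimately show ?thesis using that e1 by auto
        qed
        have outx: "\<not> frac (G x) \<le> b" if "b < x"
        proof -
          have "G b < G x" "G x < G (0 + 1)" using that True G_less_iff by auto
          hence *: "b + real d - 1 < G x" "G x < real d" using Gb G_step[of 0] G0 by auto
          have "frac (G x - real_of_int (int d - 1)) = G x - real_of_int (int d - 1)"
            using * p by (intro frac_eq[THEN iffD2]) auto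
          moreover have "frac (G x - real_of_int (int d - 1)) = frac (G x)"
            using floor_diff_of_int[of "G x" "int d - 1"] by (simp only: frac_def of_int_diff)
          ultimately show ?thesis using * by simp
        qed
        show ?thesis using True gapx outx fx
          by (cases "x \<in> {e<..<Gi 1}"; cases "frac (G x) \<le> b"; cases "x \<le> b") (auto simp: h_def)
      qed
    qed
    finally show ?thesis .
  qed
  have "J 0 \<le> (\<integral>\<^sup>+x. indicator {0..<1::real} x \<partial>lborel)"
    unfolding J_def by (intro nn_integral_mono) (auto simp: h_def indicator_def)
  hence J0: "J 0 \<le> 1" by simp
  have tot: "(\<Sum>k<n. gap k) + J n \<le> J 0" for n
  proof (induction n)
    case (Suc n)
    have "(\<Sum>k<Suc n. gap k) + J (Suc n) = (\<Sum>k<n. gap k) + (J (Suc n) + gap n)" by (simp add: ac_simps)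
    also have "\<dots> \<le> (\<Sum>k<n. gap k) + J n" by (intro add_left_mono step)
    finally show ?case using Suc by (rule order_trans)
  qed simp
  \<comment> \<open>The gap lies in [e, b], so by the Harnack inequality it carries at least the
    mass \<open>W n b / c\<close> times its length \<open>g\<close>. A bounded total gap mass thus
    bounds the sums of the values at b.\<close>
  define g where "g = Gi 1 - e"
  have g0: "g > 0" using e by (simp add: g_def)
  have gap_ge: "ennreal (W n b / c * g) \<le> gap n" for n
  proof -
    have "ennreal (W n b / c * g) = ennreal (W n b / c) * ennreal g"
      using W_pos[of n b] c0 g0 by (intro ennreal_mult) auto
    also have "\<dots> = (\<integral>\<^sup>+x. ennreal (W n b / c) * indicator {e<..<Gi 1} x \<partial>lborel)"
      using e by (simp add: nn_integral_cmult_indicator g_def)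
    also have "\<dots> \<le> gap n"
      unfolding gap_def
    proof (intro nn_integral_mono)
      fix x
      have "W n b / c \<le> W n x" if "x \<in> {e<..<Gi 1}"
        using W_le_W_b(2)[OF KA e(1), of x n] that e1 c0 by (simp add: c_def field_simps)
      thus "ennreal (W n b / c) * indicator {e<..<Gi 1} x \<le> ennreal (W n x) * indicator {e<..<Gi 1} x"
        by (auto simp: indicator_def intro!: ennreal_leI)
    qed
    finally show ?thesis .
  qed
  have "(\<Sum>k<n. W k b) \<le> c / g" for n
  proof -
    have "ennreal (\<Sum>k<n. W k b / c * g) = (\<Sum>k<n. ennreal (W k b / c * g))"
      using W_pos c0 g0 by (intro sum_ennreal[symmetric]) (auto intro!: mult_nonneg_nonneg divide_nonneg_nonneg less_imp_le)
    also have "\<dots> \<le> (\<Sum>k<n. gap k)" by (intro sum_mono gap_ge)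
    also have "\<dots> \<le> (\<Sum>k<n. gap k) + J n" by simp
    also have "\<dots> \<le> 1" using tot J0 by (rule order_trans)
    finally have "(\<Sum>k<n. W k b / c * g) \<le> 1" by simp
    moreover have "(\<Sum>k<n. W k b / c * g) = (\<Sum>k<n. W k b) * (g / c)"
      unfolding sum_distrib_right by (intro sum.cong) auto
    ultimately show ?thesis using c0 g0 by (simp add: pos_le_divide_eq pos_divide_le_eq)
  qed
  thus ?thesis using c0 g0 by (intro exI[of _ "c / g"]) auto
qed

lemma Gi_range: "p \<le> x \<Longrightarrow> x \<le> b \<Longrightarrow> p \<le> Gi x \<and> Gi x \<le> b"
  using Gi_le_iff[of p x] Gi_le_iff[of x b] e by (auto simp: Gip e_def)

text \<open>The far branches land in [e, b], where G' >= 1 and \<open>W n\<close> is at most a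
  constant times \<open>W n b\<close>; R collects the d - 1 of them. What remains is the branch
  through the neutral point and an error that is summable in n.\<close>

lemma W_recursion: "\<exists>R\<ge>0. \<forall>n x. p \<le> x \<longrightarrow> x \<le> b \<longrightarrow> W (Suc n) x \<le> W n (Gi x) / G' (Gi x) + R * W n b"
proof -
  obtain K A where KA: "dist_consts K A" using dist_consts_exist by blast
  define c where "c = exp (K * (ln b + A * b) - K * (ln e + A * e))"
  have "W (Suc n) x \<le> W n (Gi x) / G' (Gi x) + real (d - 1) * c * W n b" if x: "p \<le> x" "x \<le> b" for n x
  proof -
    have dd: "{..<d} = {..<Suc (d - 1)}" using d_pos by simp
    have "W n (Gi (x + real i)) / G' (Gi (x + real i)) \<le> c * W n b" if i: "1 \<le> i" "i < d" for i
    proof -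
      note fb = far_branch_bounds[OF x i]
      have "W n (Gi (x + real i)) / G' (Gi (x + real i)) \<le> W n (Gi (x + real i)) / 1"
        using G'_ge_1[of "Gi (x + real i)"] fb e(1) W_pos[of n] by (intro divide_left_mono) (auto intro: less_imp_le)
      also have "\<dots> \<le> c * W n b" using W_le_W_b(1)[OF KA e(1) fb] by (simp add: c_def)
      finally show ?thesis .
    qed
    from this[of "Suc i" for i]
    have "W n (Gi (x + real (Suc i))) / G' (Gi (x + real (Suc i))) \<le> c * W n b" if "i < d - 1" for i
      using that by (simp del: of_nat_Suc)
    hence "(\<Sum>i<d - 1. W n (Gi (x + real (Suc i))) / G' (Gi (x + real (Suc i)))) \<le> (\<Sum>i<d - 1. c * W n b)"
      by (intro sum_mono) simp
    thus ?thesis unfolding W_Suc L_def dd by (subst sum.lessThan_Suc_shift) simp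
  qed
  thus ?thesis by (intro exI[of _ "real (d - 1) * c"]) (auto simp: c_def)
qed

end

section \<open>Summability of the iterates off the neutral point and their subexponential
  growth\<close>

context saddle_lift begin

text \<open>The orbit increases and stays below 0, and its limit is a fixed point in (p, 0], where 0
  is the only one.\<close>

lemma orbit_tendsto_0:
  assumes y: "p < y" "y < 0"
  shows "(\<lambda>j. (G ^^ j) y) \<longlonglongrightarrow> 0" "\<And>j. p < (G ^^ j) y \<and> (G ^^ j) y < 0"
proof -
  show in': "p < (G ^^ j) y \<and> (G ^^ j) y < 0" for j
  proof (induction j)
    case (Suc j)
    thus ?case using G_less_iff[of p "(G ^^ j) y"] G_less_iff[of "(G ^^ j) y" 0] G0 Gp by simp
  qed (use y in simp)
  have "incseq (\<lambda>j. (G ^^ j) y)"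
    by (rule incseq_SucI) (use in' G_above in \<open>auto intro: less_imp_le\<close>)
  then obtain l where l: "(\<lambda>j. (G ^^ j) y) \<longlonglongrightarrow> l" "\<And>j. (G ^^ j) y \<le> l"
    using incseq_convergent[of "\<lambda>j. (G ^^ j) y" 0] in' by (metis less_imp_le)
  have "isCont G l" using DERIV_isCont[OF G_deriv] .
  hence "(\<lambda>j. G ((G ^^ j) y)) \<longlonglongrightarrow> G l" using l(1) by (rule isCont_tendsto_compose)
  moreover have "(\<lambda>j. G ((G ^^ j) y)) \<longlonglongrightarrow> l" using LIMSEQ_Suc[OF l(1)] by simp
  ultimately have "G l = l" by (rule LIMSEQ_unique)
  moreover have "p < l" using l(2)[of 0] y by simp
  moreover have "l \<le> 0" using in' by (intro LIMSEQ_le_const2[OF l(1)]) (auto intro: less_imp_le)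
  ultimately have "l = 0" using G_above[of l] by (cases "l = 0") auto
  thus "(\<lambda>j. (G ^^ j) y) \<longlonglongrightarrow> 0" using l(1) by simp
qed

lemma W_sum_mono: "(\<Sum>k<n. W k x) \<le> (\<Sum>k<Suc n. W k x)"
  using W_pos[of n x] by (simp add: less_imp_le)

text \<open>Backward orbits under \<open>Gi\<close> run towards p. Near p the derivative is at least
  m > 1, so the recursion contracts the partial sums and gives the bound \<open>B0\<close>. Forward
  steps carry a bound from y0 up to -\<delta>, each dividing the previous bound by at most g and
  adding a constant; finitely many steps suffice because \<delta> > 0.\<close>

lemma W_sum_bounded_left:
  assumes \<delta>: "\<delta> > 0"
  shows "\<exists>C. \<forall>x n. p \<le> x \<longrightarrow> x \<le> - \<delta> \<longrightarrow> (\<Sum>k<n. W k x) \<le> C"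
proof -
  obtain C where C: "C > 0" "\<And>n. (\<Sum>k<n. W k b) \<le> C" using W_b_summable by blast
  obtain R where R: "R \<ge> 0" "\<And>n x. p \<le> x \<Longrightarrow> x \<le> b \<Longrightarrow> W (Suc n) x \<le> W n (Gi x) / G' (Gi x) + R * W n b"
    using W_recursion by blast
  obtain g where g: "g > 0" "\<And>x. g \<le> G' x" using G'_bounds by blast
  have step: "(\<Sum>k<Suc n. W k x) \<le> 1 + B / m + R * C"
    if x: "p \<le> x" "x \<le> b" and m: "0 < m" "m \<le> G' (Gi x)" and B: "(\<Sum>k<n. W k (Gi x)) \<le> B" for n x m B
  proof -
    have "(\<Sum>k<Suc n. W k x) = 1 + (\<Sum>k<n. W (Suc k) x)" by (subst sum.lessThan_Suc_shift) simp
    also have "\<dots> \<le> 1 + (\<Sum>k<n. W k (Gi x) / G' (Gi x) + R * W k b)"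
      by (intro add_left_mono sum_mono R(2) x)
    also have "\<dots> = 1 + (\<Sum>k<n. W k (Gi x)) / G' (Gi x) + R * (\<Sum>k<n. W k b)"
      by (simp add: sum.distrib sum_divide_distrib sum_distrib_left)
    also have "\<dots> \<le> 1 + B / m + R * C"
    proof (intro add_mono order_refl mult_left_mono R(1) C(2) frac_le)
      show "0 \<le> B" using B sum_nonneg[of "{..<n}" "\<lambda>k. W k (Gi x)"] W_pos by (smt (verit))
    qed (use B m in auto)
    finally show ?thesis .
  qed
  have Gi_le: "p \<le> Gi x \<and> Gi x \<le> x" if "p \<le> x" "x \<le> 0" for x
  proof -
    have "x \<le> G x" using G_above[of x] that Gp G0 by (cases "x = p"; cases "x = 0") auto
    thus ?thesis using Gi_le_iff[of x "G x"] Gi_le_iff[of p x] that by (simp add: Gip)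
  qed
  have "G' p > 1" using G'_gt[of b] G'_step[of p] p by simp
  define m where "m = (1 + G' p) / 2"
  have m: "1 < m" "m < G' p" using \<open>G' p > 1\<close> by (auto simp: m_def)
  have "G' \<midarrow>p\<rightarrow> G' p" using G'_cont by (auto simp: continuous_on_eq_continuous_at isCont_def)
  hence "\<forall>\<^sub>F x in at p. m < G' x" using m(2) by (rule order_tendstoD)
  then obtain s0 where s0: "s0 > 0" "\<And>x. x \<noteq> p \<Longrightarrow> \<bar>x - p\<bar> < s0 \<Longrightarrow> m < G' x"
    by (auto simp: eventually_at dist_real_def)
  define y0 where "y0 = p + min (s0 / 2) (- p / 2)"
  have y0: "p < y0" "y0 < 0" "y0 - p < s0" using s0(1) p by (auto simp: y0_def min_def)
  have mG: "m \<le> G' x" if "p \<le> x" "x \<le> y0" for x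
    using s0(2)[of x] that y0 m(2) by (cases "x = p") auto
  define B0 where "B0 = (1 + R * C) / (1 - 1 / m)"
  have B0: "1 + B0 / m + R * C = B0" using m by (simp add: B0_def field_simps)
  have B0_nn: "B0 \<ge> 0" unfolding B0_def using m R(1) C(1) by (intro divide_nonneg_nonneg) auto
  have base: "(\<Sum>k<n. W k x) \<le> B0" if "p \<le> x" "x \<le> y0" for x n
    using that
  proof (induction n arbitrary: x)
    case 0 thus ?case using B0_nn by simp
  next
    case (Suc n)
    have Gx: "p \<le> Gi x \<and> Gi x \<le> x" by (rule Gi_le) (use Suc y0 in auto)
    have "(\<Sum>k<Suc n. W k x) \<le> 1 + B0 / m + R * C"
      by (rule step) (use Suc Gx y0 p m mG in auto)
    thus ?case unfolding B0 .
  qed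
  have iter: "\<exists>B. \<forall>x n. p \<le> x \<longrightarrow> x \<le> (G ^^ j) y0 \<longrightarrow> (\<Sum>k<n. W k x) \<le> B" for j
  proof (induction j)
    case 0 thus ?case using base by auto
  next
    case (Suc j)
    then obtain B where B: "\<And>x n. p \<le> x \<Longrightarrow> x \<le> (G ^^ j) y0 \<Longrightarrow> (\<Sum>k<n. W k x) \<le> B" by blast
    have "(\<Sum>k<n. W k x) \<le> 1 + B / g + R * C" if x: "p \<le> x" "x \<le> (G ^^ Suc j) y0" for x n
    proof -
      have x0: "x \<le> 0" using x orbit_tendsto_0(2)[OF y0(1,2), of "Suc j"] by linarith
      have Gx: "p \<le> Gi x" using Gi_le x x0 by simp
      have Gx2: "Gi x \<le> (G ^^ j) y0" using x(2) Gi_le_iff[of x "G ((G ^^ j) y0)"] by simp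
      have "(\<Sum>k<Suc n. W k x) \<le> 1 + B / g + R * C"
        by (rule step[OF x(1) _ g B[OF Gx Gx2]]) (use x0 p in simp)
      thus ?thesis using W_sum_mono[of x n] by linarith
    qed
    thus ?case by blast
  qed
  have "\<forall>\<^sub>F j in sequentially. - \<delta> < (G ^^ j) y0"
    by (rule order_tendstoD(1)[OF orbit_tendsto_0(1)[OF y0(1,2)]]) (use \<delta> in simp)
  then obtain j where j: "- \<delta> < (G ^^ j) y0" by (auto simp: eventually_sequentially)
  obtain B where B: "\<And>x n. p \<le> x \<Longrightarrow> x \<le> (G ^^ j) y0 \<Longrightarrow> (\<Sum>k<n. W k x) \<le> B" using iter by blast
  have "\<forall>x n. p \<le> x \<longrightarrow> x \<le> - \<delta> \<longrightarrow> (\<Sum>k<n. W k x) \<le> B" using B j by (auto intro: B)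
  thus ?thesis by blast
qed

lemma W_sum_bounded:
  assumes \<delta>: "\<delta> > 0"
  shows "\<exists>C. \<forall>x n. p \<le> x \<longrightarrow> x \<le> b \<longrightarrow> \<delta> \<le> \<bar>x\<bar> \<longrightarrow> (\<Sum>k<n. W k x) \<le> C"
proof -
  obtain C1 where C1: "\<And>x n. p \<le> x \<Longrightarrow> x \<le> - \<delta> \<Longrightarrow> (\<Sum>k<n. W k x) \<le> C1"
    using W_sum_bounded_left[OF \<delta>] by blast
  obtain C where C: "C > 0" "\<And>n. (\<Sum>k<n. W k b) \<le> C" using W_b_summable by blast
  obtain K A where KA: "dist_consts K A" using dist_consts_exist by blast
  define c where "c = exp (K * (ln b + A * b) - K * (ln \<delta> + A * \<delta>))"
  have "(\<Sum>k<n. W k x) \<le> max C1 (c * C)" if x: "p \<le> x" "x \<le> b" "\<delta> \<le> \<bar>x\<bar>" for x n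
  proof (cases "x < 0")
    case True
    hence "(\<Sum>k<n. W k x) \<le> C1" using x by (intro C1) auto
    thus ?thesis by simp
  next
    case False
    hence "(\<Sum>k<n. W k x) \<le> (\<Sum>k<n. c * W k b)"
      unfolding c_def using x by (intro sum_mono W_le_W_b(1)[OF KA \<delta>]) auto
    also have "\<dots> \<le> c * C" using C(2)[of n] by (simp add: sum_distrib_left[symmetric] c_def)
    finally show ?thesis by simp
  qed
  thus ?thesis by blast
qed

lemma W_shift_range: "W n (x - of_int \<lfloor>x - p\<rfloor>) = W n x" "p \<le> x - of_int \<lfloor>x - p\<rfloor>" "x - of_int \<lfloor>x - p\<rfloor> \<le> b"
proof -
  have "W n (x + of_int (- \<lfloor>x - p\<rfloor>)) = W n x" by (rule periodic_int) (rule W_periodic)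
  thus "W n (x - of_int \<lfloor>x - p\<rfloor>) = W n x" by simp
  show "p \<le> x - of_int \<lfloor>x - p\<rfloor>" "x - of_int \<lfloor>x - p\<rfloor> \<le> b" by linarith+
qed

text \<open>The recursion stops contracting near 0, as G' 0 = 1. For |x| < s the factor 1 / G' (Gi
  x) is at most \<rho>, slightly above 1; for |x| >= s the values are bounded by summability.
  Together this gives growth at most \<open>\<rho> ^ n * (1 + n * B)\<close>, and \<rho> < 1 +
  \<epsilon>.\<close>

lemma W_growth:
  assumes \<epsilon>: "\<epsilon> > 0"
  shows "\<exists>n. \<forall>x. W n x \<le> (1 + \<epsilon>) ^ n / 2"
proof -
  obtain C where C: "C > 0" "\<And>n. (\<Sum>k<n. W k b) \<le> C" using W_b_summable by blast
  obtain R where R: "R \<ge> 0" "\<And>n x. p \<le> x \<Longrightarrow> x \<le> b \<Longrightarrow> W (Suc n) x \<le> W n (Gi x) / G' (Gi x) + R * W n b"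
    using W_recursion by blast
  define \<rho> where "\<rho> = 1 + \<epsilon> / 2"
  have \<rho>: "\<rho> > 1" "\<rho> < 1 + \<epsilon>" using \<epsilon> by (auto simp: \<rho>_def)
  have "isCont (\<lambda>x. 1 / G' (Gi x)) 0"
    by (rule continuous_divide[OF continuous_const isCont_o2[of 0 Gi G']])
       (use Gi_cont[of UNIV] G'_cont G'_pos[of "Gi 0"] in \<open>auto simp: continuous_on_eq_continuous_at\<close>)
  hence "(\<lambda>x. 1 / G' (Gi x)) \<midarrow>0\<rightarrow> 1" by (simp add: isCont_def Gi0 G'0)
  hence "\<forall>\<^sub>F x in at 0. 1 / G' (Gi x) < \<rho>" using \<rho>(1) by (rule order_tendstoD)
  then obtain s where s: "s > 0" "\<And>x. x \<noteq> 0 \<Longrightarrow> \<bar>x\<bar> < s \<Longrightarrow> 1 / G' (Gi x) < \<rho>"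
    by (auto simp: eventually_at dist_real_def)
  obtain Cs where Cs: "\<And>x n. p \<le> x \<Longrightarrow> x \<le> b \<Longrightarrow> s \<le> \<bar>x\<bar> \<Longrightarrow> (\<Sum>k<n. W k x) \<le> Cs"
    using W_sum_bounded[OF s(1)] by blast
  define B where "B = R * C + max Cs 0"
  have "0 \<le> R * C" using R(1) C(1) by simp
  hence B: "R * C \<le> B" "Cs \<le> B" "0 \<le> B" unfolding B_def by linarith+
  have one: "W k x \<le> S" if "\<And>n. (\<Sum>k<n. W k x) \<le> S" for k x S
  proof -
    have "W k x \<le> (\<Sum>i<Suc k. W i x)"
      by (rule member_le_sum) (auto intro: less_imp_le[OF W_pos])
    thus ?thesis using that[of "Suc k"] by linarith
  qed
  have bound: "W n x \<le> \<rho> ^ n * (1 + real n * B)" if "p \<le> x" "x \<le> b" for n x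
    using that
  proof (induction n arbitrary: x)
    case (Suc n)
    have r1: "1 \<le> \<rho> ^ Suc n" using \<rho> by (intro one_le_power) simp
    have pos: "0 \<le> \<rho> ^ n * (1 + real n * B)" using \<rho> B by simp
    show ?case
    proof (cases "\<bar>x\<bar> < s")
      case False
      have "W (Suc n) x \<le> Cs" by (rule one) (use Cs Suc False in auto)
      also have "\<dots> \<le> 1 * (1 + real (Suc n) * B)"
        using B(2) mult_nonneg_nonneg[OF of_nat_0_le_iff[of n] B(3)] by (simp add: distrib_right)
      also have "\<dots> \<le> \<rho> ^ Suc n * (1 + real (Suc n) * B)" using r1 B by (intro mult_right_mono) auto
      finally show ?thesis .
    next
      case True
      have "1 / G' (Gi x) \<le> \<rho>" using s(2)[of x] True \<rho> by (cases "x = 0") (auto simp: Gi0 G'0)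
      moreover have "W n (Gi x) \<le> \<rho> ^ n * (1 + real n * B)" using Suc Gi_range by blast
      ultimately have "W n (Gi x) * (1 / G' (Gi x)) \<le> (\<rho> ^ n * (1 + real n * B)) * \<rho>"
        using pos G'_pos[of "Gi x"] by (intro mult_mono) auto
      hence "W n (Gi x) / G' (Gi x) \<le> \<rho> ^ Suc n * (1 + real n * B)" by (simp add: algebra_simps)
      moreover have "R * W n b \<le> R * C" using one[of b C n] C(2) R(1) by (intro mult_left_mono) auto
      moreover have "B \<le> \<rho> ^ Suc n * B" using mult_right_mono[OF r1 B(3)] by simp
      moreover have "\<rho> ^ Suc n * (1 + real (Suc n) * B) = \<rho> ^ Suc n * (1 + real n * B) + \<rho> ^ Suc n * B"
        by (simp add: algebra_simps)
      ultimately show ?thesis using R(2)[OF Suc.prems, of n] B(1) by linarith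
    qed
  qed simp
  define r where "r = \<rho> / (1 + \<epsilon>)"
  have r: "0 < r" "r < 1" using \<rho> \<epsilon> by (auto simp: r_def)
  have "(\<lambda>n. r ^ n + B * (real n * r ^ n)) \<longlonglongrightarrow> 0 + B * 0"
    by (intro tendsto_add tendsto_mult tendsto_const LIMSEQ_realpow_zero powser_times_n_limit_0) (use r in auto)
  hence "\<forall>\<^sub>F n in sequentially. r ^ n + B * (real n * r ^ n) < 1 / 2" by (intro order_tendstoD) auto
  then obtain n where n: "r ^ n + B * (real n * r ^ n) < 1 / 2" by (auto simp: eventually_sequentially)
  have "W n x \<le> (1 + \<epsilon>) ^ n / 2" for x
  proof -
    have "W n x \<le> \<rho> ^ n * (1 + real n * B)"
      using bound[OF W_shift_range(2,3)[of x], of n] by (simp add: W_shift_range(1))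
    also have "\<rho> ^ n = r ^ n * (1 + \<epsilon>) ^ n" using \<epsilon> by (simp add: r_def power_divide)
    also have "r ^ n * (1 + \<epsilon>) ^ n * (1 + real n * B) = (r ^ n + B * (real n * r ^ n)) * (1 + \<epsilon>) ^ n"
      by (simp add: algebra_simps)
    also have "\<dots> \<le> 1 / 2 * (1 + \<epsilon>) ^ n" using n \<epsilon> by (intro mult_right_mono) auto
    finally show ?thesis by simp
  qed
  thus ?thesis by blast
qed

text \<open>The witness is \<open>w = \<Sum>k<n. (1 + \<epsilon>)\<^bsup>-k\<^esup> W k\<close>. That \<open>C\<close> does not depend on \<open>\<epsilon>\<close>
  is what forces the invariant measures to concentrate at \<open>0\<close>.\<close>

lemma drift_function:
  assumes \<delta>: "\<delta> > 0"
  shows "\<exists>C\<ge>1. \<forall>\<epsilon>>0. \<exists>w. continuous_on UNIV w \<and> (\<forall>x. w (x + 1) = w x) \<and> (\<forall>x. 1 \<le> w x) \<and>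
     (\<forall>x. L w x \<le> (1 + \<epsilon>) * (w x - 1 / 2)) \<and> (\<forall>x. (\<forall>k::int. \<delta> \<le> \<bar>x - of_int k\<bar>) \<longrightarrow> w x \<le> C)"
proof -
  obtain C where C: "\<And>x n. p \<le> x \<Longrightarrow> x \<le> b \<Longrightarrow> \<delta> \<le> \<bar>x\<bar> \<Longrightarrow> (\<Sum>k<n. W k x) \<le> C"
    using W_sum_bounded[OF \<delta>] by blast
  have far: "(\<Sum>k<n. W k x) \<le> C" if "\<forall>k::int. \<delta> \<le> \<bar>x - of_int k\<bar>" for x n
    using C[OF W_shift_range(2,3)[of x], of n] that by (simp add: W_shift_range(1))
  have "\<exists>w. continuous_on UNIV w \<and> (\<forall>x. w (x + 1) = w x) \<and> (\<forall>x. 1 \<le> w x) \<and>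
     (\<forall>x. L w x \<le> (1 + \<epsilon>) * (w x - 1 / 2)) \<and> (\<forall>x. (\<forall>k::int. \<delta> \<le> \<bar>x - of_int k\<bar>) \<longrightarrow> w x \<le> max C 1)"
    if \<epsilon>: "\<epsilon> > 0" for \<epsilon>
  proof -
    obtain n where n: "\<And>x. W n x \<le> (1 + \<epsilon>) ^ n / 2" using W_growth[OF \<epsilon>] by blast
    have n0: "n > 0" using n[of 0] by (cases n) auto
    define r where "r = 1 / (1 + \<epsilon>)"
    have r: "0 < r" "r \<le> 1" "(1 + \<epsilon>) * r = 1" using \<epsilon> by (auto simp: r_def)
    define w where "w x = (\<Sum>k<n. r ^ k * W k x)" for x
    have "continuous_on UNIV w"
      unfolding w_def[abs_def] by (intro continuous_on_sum continuous_on_mult continuous_on_const W_cont)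
    moreover have "w (x + 1) = w x" for x by (simp add: w_def W_periodic)
    moreover have "1 \<le> w x" for x
    proof -
      have "r ^ 0 * W 0 x \<le> w x" unfolding w_def
        by (rule member_le_sum) (use n0 r W_pos in \<open>auto intro!: mult_nonneg_nonneg less_imp_le\<close>)
      thus ?thesis by simp
    qed
    \<comment> \<open>Applying L shifts the sum by one index: the term k = 0, which is 1, is lost,
      and the term k = n, at most 1 / 2 by the choice of n, is gained.\<close>
    moreover have "L w x \<le> (1 + \<epsilon>) * (w x - 1 / 2)" for x
    proof -
      have "L w x = (\<Sum>k<n. r ^ k * W (Suc k) x)"
        unfolding w_def[abs_def] L_sum L_cmult W_Suc ..
      also have "\<dots> = (1 + \<epsilon>) * (\<Sum>k<n. r ^ Suc k * W (Suc k) x)"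
        unfolding sum_distrib_left using r(3) by (intro sum.cong refl) (simp add: mult.assoc[symmetric])
      also have "(\<Sum>k<n. r ^ Suc k * W (Suc k) x) = w x - 1 + r ^ n * W n x"
        unfolding w_def using sum.lessThan_Suc_shift[of "\<lambda>k. r ^ k * W k x" n] by simp
      also have "r ^ n * W n x \<le> 1 / 2"
      proof -
        have "r ^ n * W n x \<le> r ^ n * ((1 + \<epsilon>) ^ n / 2)" using n r by (intro mult_left_mono) auto
        also have "\<dots> = ((1 + \<epsilon>) * r) ^ n / 2" by (simp add: power_mult_distrib)
        finally show ?thesis by (simp add: r(3))
      qed
      finally show ?thesis using \<epsilon> by (simp add: mult_left_mono)
    qed
    moreover have "w x \<le> max C 1" if "\<forall>k::int. \<delta> \<le> \<bar>x - of_int k\<bar>" for x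
    proof -
      have "w x \<le> (\<Sum>k<n. 1 * W k x)" unfolding w_def
        using r W_pos by (intro sum_mono mult_right_mono power_le_one) (auto intro: less_imp_le)
      thus ?thesis using far[OF that, of n] by simp
    qed
    ultimately show ?thesis by blast
  qed
  thus ?thesis by (intro exI[of _ "max C 1"]) auto
qed

end

section \<open>Perturbation of the transfer operator\<close>

lemma periodic_uniformly_continuous:
  fixes f :: "real \<Rightarrow> real"
  assumes f: "continuous_on UNIV f" and per: "\<And>x. f (x + 1) = f x"
  shows "uniformly_continuous_on UNIV f"
proof -
  have uc: "uniformly_continuous_on {-1..2} f"
    by (rule compact_uniformly_continuous) (use continuous_on_subset[OF f] in auto)
  show ?thesis
    unfolding uniformly_continuous_on_def
  proof (intro allI impI)
    fix r :: real assume "r > 0"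
    then obtain s where s: "s > 0" "\<And>x y. x \<in> {-1..2} \<Longrightarrow> y \<in> {-1..2} \<Longrightarrow> dist y x < s \<Longrightarrow> dist (f y) (f x) < r"
      using uc unfolding uniformly_continuous_on_def by meson
    have "dist (f y) (f x) < r" if xy: "dist y x < min s 1" for x y
    proof -
      define k where "k = - \<lfloor>x\<rfloor>"
      have "f (x + of_int k) = f x" "f (y + of_int k) = f y" by (rule periodic_int, rule per)+
      moreover have "x + of_int k \<in> {-1..2}" unfolding k_def by simp linarith
      moreover have "y + of_int k \<in> {-1..2}" using xy unfolding k_def dist_real_def by simp linarith
      moreover have "dist (y + of_int k) (x + of_int k) < s" using xy by (simp add: dist_real_def)
      ultimately show ?thesis using s(2) by metis
    qed
    thus "\<exists>d>0. \<forall>x\<in>UNIV. \<forall>x'\<in>UNIV. dist x' x < d \<longrightarrow> dist (f x') (f x) < r"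
      using s(1) by (intro exI[of _ "min s 1"]) auto
  qed
qed

context circle_lift begin

text \<open>w is fixed first, so uniform continuity of w / G' suffices: a C^0 change of G by \<eta>
  moves every inverse branch by at most \<eta> / g, and the change of G' alters the weights by a
  controlled amount. Each of the d branches contributes at most 2 * r = \<epsilon> / d.\<close>

lemma transfer_perturb:
  assumes w: "continuous_on UNIV w" and wp: "\<And>x. w (x + 1) = w x" and \<epsilon>: "\<epsilon> > 0"
  shows "\<exists>\<eta>>0. \<forall>H H'. circle_lift H H' d \<longrightarrow> (\<forall>x. \<bar>H x - G x\<bar> \<le> \<eta> \<and> \<bar>H' x - G' x\<bar> \<le> \<eta>) \<longrightarrow>
    (\<forall>x. circle_lift.L H H' d w x \<le> L w x + \<epsilon>)"
proof -
  obtain g where g: "g > 0" "\<And>x. g \<le> G' x" using G'_bounds by blast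
  obtain B where B: "B > 0" "\<And>x. \<bar>w x\<bar> \<le> B" using periodic_bounded[OF w wp] by blast
  define Q where "Q x = w x / G' x" for x
  have "continuous_on UNIV Q" unfolding Q_def[abs_def]
    by (intro continuous_on_divide w G'_cont) (use G'_pos in \<open>simp add: less_imp_neq[THEN not_sym]\<close>)
  hence "uniformly_continuous_on UNIV Q"
    by (rule periodic_uniformly_continuous) (simp add: Q_def wp G'_step)
  moreover define r where "r = \<epsilon> / (2 * real d)"
  have r: "r > 0" using \<epsilon> d_pos by (simp add: r_def)
  ultimately obtain s where s: "s > 0" "\<And>x y. dist y x < s \<Longrightarrow> dist (Q y) (Q x) < r"
    unfolding uniformly_continuous_on_def by (meson UNIV_I)
  \<comment> \<open>The three entries keep H' >= g / 2, move the inverse branches by at most s / 2,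
    and bound by r the error B * \<eta> / (g * g / 2) made in the weights.\<close>
  define \<eta> where "\<eta> = min (g / 2) (min (g * s / 2) (r * g\<^sup>2 / (2 * B)))"
  have \<eta>: "\<eta> > 0" "\<eta> \<le> g / 2" "\<eta> \<le> g * s / 2" "\<eta> \<le> r * g\<^sup>2 / (2 * B)"
    using g(1) s(1) r B(1) by (auto simp: \<eta>_def)
  have "circle_lift.L H H' d w x \<le> L w x + \<epsilon>"
    if H: "circle_lift H H' d" and close: "\<And>x. \<bar>H x - G x\<bar> \<le> \<eta> \<and> \<bar>H' x - G' x\<bar> \<le> \<eta>" for H H' x
  proof -
    interpret H: circle_lift H H' d by (rule H)
    have tm: "w (H.Gi y) / H' (H.Gi y) \<le> w (Gi y) / G' (Gi y) + 2 * r" for y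
    proof -
      define a z where "a = H.Gi y" and "z = Gi y"
      have "\<bar>G a - G z\<bar> \<le> \<eta>" using close[of a] by (simp add: a_def z_def abs_minus_commute)
      moreover have "g * \<bar>a - z\<bar> \<le> \<bar>G a - G z\<bar>"
      proof (cases "a = z")
        case False
        obtain \<xi> where "G a - G z = (a - z) * G' \<xi>"
        proof (cases "a < z")
          case True
          from MVT2[OF True, of G G'] G_deriv obtain \<xi> where "G z - G a = (z - a) * G' \<xi>" by blast
          thus ?thesis by (intro that[of \<xi>]) (simp add: algebra_simps)
        next
          case False
          hence "z < a" using \<open>a \<noteq> z\<close> by simp
          from MVT2[OF this, of G G'] G_deriv obtain \<xi> where "G a - G z = (a - z) * G' \<xi>" by blast
          thus ?thesis by (rule that)
        qed
        hence "\<bar>G a - G z\<bar> = \<bar>a - z\<bar> * G' \<xi>" using G'_pos[of \<xi>] by (simp add: abs_mult)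
        thus ?thesis using mult_left_mono[OF g(2)[of \<xi>], of "\<bar>a - z\<bar>"] by (simp add: mult.commute)
      qed simp
      ultimately have "g * \<bar>a - z\<bar> \<le> g * (s / 2)" using \<eta>(3) by simp
      hence "\<bar>a - z\<bar> \<le> s / 2" using g(1) by (rule mult_left_le_imp_le)
      hence "dist a z < s" using s(1) by (simp add: dist_real_def)
      hence 1: "Q a < Q z + r" using s(2)[of a z] by (simp add: dist_real_def abs_less_iff)
      have H'a: "H' a \<ge> g / 2" using close[of a] g(2)[of a] \<eta>(2) by linarith
      have "w a / H' a - Q a = w a * (G' a - H' a) / (H' a * G' a)"
        using H'a g(1) G'_pos[of a] by (simp add: Q_def field_simps)
      also have "\<dots> \<le> \<bar>w a * (G' a - H' a)\<bar> / (H' a * G' a)"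
        using H'a g(1) G'_pos[of a] by (intro divide_right_mono) auto
      also have "\<dots> \<le> (B * \<eta>) / (g / 2 * g)"
      proof (rule frac_le)
        show "\<bar>w a * (G' a - H' a)\<bar> \<le> B * \<eta>"
          unfolding abs_mult using B(2)[of a] close[of a] B(1) by (intro mult_mono) (auto simp: abs_minus_commute)
        show "g / 2 * g \<le> H' a * G' a" using H'a g by (intro mult_mono) auto
      qed (use B \<eta> g in auto)
      also have "\<dots> \<le> r"
      proof -
        have "\<eta> * (2 * B) \<le> r * g\<^sup>2" using \<eta>(4) B(1) by (simp add: pos_le_divide_eq)
        thus ?thesis using g(1) by (simp add: power2_eq_square field_simps)
      qed
      finally show ?thesis using 1 by (simp add: Q_def a_def z_def)
    qed
    have "H.L w x \<le> (\<Sum>i<d. w (Gi (x + real i)) / G' (Gi (x + real i)) + 2 * r)"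
      unfolding H.L_def by (intro sum_mono tm)
    also have "\<dots> = L w x + \<epsilon>" using d_pos by (simp add: L_def sum.distrib r_def)
    finally show ?thesis .
  qed
  thus ?thesis using \<eta>(1) by blast
qed

end

context saddle_lift begin

text \<open>C depends on \<delta> alone, which fixes a contraction factor \<theta> < 1 for w off 0
  before \<epsilon> is chosen. Nonnegativity of the integral of ln q reads c * M(far) <= ln (1 + 2 *
  \<epsilon>) with c = - ln \<theta>, and \<epsilon> = \<kappa> * c / 2 turns this into M(far) <=
  \<kappa>. If C grew as \<epsilon> shrinks, c could shrink along with it.\<close>

lemma concentration:
  assumes \<delta>: "\<delta> > 0" and \<kappa>: "\<kappa> > 0"
  shows "\<exists>\<eta>>0. \<forall>H H' M. circle_lift H H' d \<longrightarrow> (\<forall>x. \<bar>H x - G x\<bar> \<le> \<eta> \<and> \<bar>H' x - G' x\<bar> \<le> \<eta>) \<longrightarrow>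
    prob_on_M M \<longrightarrow> absolutely_continuous circle_meas M \<longrightarrow> invariant_meas M (circle_map H) \<longrightarrow>
    measure M {x \<in> {0..<1}. \<forall>k::int. \<delta> \<le> \<bar>x - of_int k\<bar>} \<le> \<kappa>"
proof -
  obtain C where C: "C \<ge> 1" and drift: "\<forall>\<epsilon>>0. \<exists>w. continuous_on UNIV w \<and> (\<forall>x. w (x + 1) = w x) \<and> (\<forall>x. 1 \<le> w x) \<and>
     (\<forall>x. L w x \<le> (1 + \<epsilon>) * (w x - 1 / 2)) \<and> (\<forall>x. (\<forall>k::int. \<delta> \<le> \<bar>x - of_int k\<bar>) \<longrightarrow> w x \<le> C)"
    using drift_function[OF \<delta>] by blast
  \<comment> \<open>Where w <= C, the loss of 1 / 2 is a fixed proportion of w, that is, w - 1 / 2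
    <= \<theta> * w.\<close>
  define \<theta> where "\<theta> = 1 - 1 / (2 * C)"
  have "1 / (2 * C) \<le> 1 / 2" using C by (simp add: field_simps)
  moreover have "1 / (2 * C) > 0" using C by simp
  ultimately have \<theta>: "0 < \<theta>" "\<theta> < 1" by (auto simp: \<theta>_def)
  define c where "c = - ln \<theta>"
  have c: "c > 0" using \<theta> by (simp add: c_def)
  define \<epsilon> where "\<epsilon> = \<kappa> * c / 2"
  have \<epsilon>: "\<epsilon> > 0" using \<kappa> c by (simp add: \<epsilon>_def)
  obtain w where w: "continuous_on UNIV w" "\<And>x. w (x + 1) = w x" "\<And>x. 1 \<le> w x"
     "\<And>x. L w x \<le> (1 + \<epsilon>) * (w x - 1 / 2)" "\<And>x. (\<forall>k::int. \<delta> \<le> \<bar>x - of_int k\<bar>) \<Longrightarrow> w x \<le> C"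
    using drift \<epsilon> by blast
  obtain \<eta> where \<eta>: "\<eta> > 0" "\<And>H H' x. circle_lift H H' d \<Longrightarrow> (\<forall>x. \<bar>H x - G x\<bar> \<le> \<eta> \<and> \<bar>H' x - G' x\<bar> \<le> \<eta>) \<Longrightarrow>
    circle_lift.L H H' d w x \<le> L w x + \<epsilon> / 2"
    using transfer_perturb[OF w(1,2), of "\<epsilon> / 2"] \<epsilon> by auto
  define far where "far = {x::real. \<forall>k::int. \<delta> \<le> \<bar>x - of_int k\<bar>}"
  have far_closed: "closed far"
  proof -
    have "far = (\<Inter>k::int. {x. \<delta> \<le> \<bar>x - of_int k\<bar>})" by (auto simp: far_def)
    moreover have "closed {x. \<delta> \<le> \<bar>x - of_int k\<bar>}" for k :: int
      by (intro closed_Collect_le continuous_intros)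
    ultimately show ?thesis by (simp add: closed_INT)
  qed
  have far_step: "x + 1 \<in> far \<longleftrightarrow> x \<in> far" for x
  proof -
    have "(\<forall>k::int. \<delta> \<le> \<bar>x + 1 - of_int k\<bar>) \<longleftrightarrow> (\<forall>k::int. \<delta> \<le> \<bar>x - of_int k\<bar>)"
    proof (intro iffI allI)
      fix k :: int assume a: "\<forall>k::int. \<delta> \<le> \<bar>x + 1 - of_int k\<bar>"
      show "\<delta> \<le> \<bar>x - of_int k\<bar>" using spec[OF a, of "k + 1"] by (simp add: algebra_simps)
    next
      fix k :: int assume a: "\<forall>k::int. \<delta> \<le> \<bar>x - of_int k\<bar>"
      show "\<delta> \<le> \<bar>x + 1 - of_int k\<bar>" using spec[OF a, of "k - 1"] by (simp add: algebra_simps)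
    qed
    thus ?thesis by (simp add: far_def)
  qed
  define q where "q x = (if x \<in> far then (1 + 2 * \<epsilon>) * \<theta> else 1 + 2 * \<epsilon>)" for x
  have "measure M {x \<in> {0..<1}. \<forall>k::int. \<delta> \<le> \<bar>x - of_int k\<bar>} \<le> \<kappa>"
    if H: "circle_lift H H' d" and close: "\<forall>x. \<bar>H x - G x\<bar> \<le> \<eta> \<and> \<bar>H' x - G' x\<bar> \<le> \<eta>"
      and M: "prob_on_M M" and ac: "absolutely_continuous circle_meas M" and inv: "invariant_meas M (circle_map H)"
    for H H' M
  proof -
    interpret H: circle_lift H H' d by (rule H)
    interpret prob_space M using M by (simp add: prob_on_M_def)
    have sp: "space M = {0..<1}" using prob_on_M_space[OF M] by simp
    have farb: "far \<in> sets borel" using far_closed by (rule borel_closed)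
    have LH: "H.L w x \<le> q x * w x" for x
    proof -
      have "H.L w x \<le> (1 + \<epsilon>) * (w x - 1 / 2) + \<epsilon> / 2" using \<eta>(2)[OF H close, of x] w(4)[of x] by linarith
      \<comment> \<open>Enlarging 1 + \<epsilon> to 1 + 2 * \<epsilon> absorbs the perturbation
        error \<epsilon> / 2, because w - 1 / 2 >= 1 / 2.\<close>
      also have "\<dots> \<le> (1 + 2 * \<epsilon>) * (w x - 1 / 2)"
      proof -
        have "(1 + 2 * \<epsilon>) * (w x - 1 / 2) - ((1 + \<epsilon>) * (w x - 1 / 2) + \<epsilon> / 2) = \<epsilon> * (w x - 1)"
          by (simp add: field_simps)
        moreover have "0 \<le> \<epsilon> * (w x - 1)" using w(3)[of x] \<epsilon> by simp
        ultimately show ?thesis by linarith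
      qed
      also have "\<dots> \<le> q x * w x"
      proof (cases "x \<in> far")
        case True
        have "w x \<le> C" using w(5)[of x] True by (simp add: far_def)
        hence "w x / (2 * C) \<le> 1 / 2" using C by (simp add: field_simps)
        hence "w x - 1 / 2 \<le> \<theta> * w x" by (simp add: \<theta>_def algebra_simps)
        hence "(1 + 2 * \<epsilon>) * (w x - 1 / 2) \<le> (1 + 2 * \<epsilon>) * (\<theta> * w x)" using \<epsilon> by (intro mult_left_mono) auto
        thus ?thesis using True by (simp add: q_def mult.assoc)
      next
        case False
        have "(1 + 2 * \<epsilon>) * (w x - 1 / 2) \<le> (1 + 2 * \<epsilon>) * w x" using \<epsilon> by (intro mult_left_mono) auto
        thus ?thesis using False by (simp add: q_def)
      qed
      finally show ?thesis .
    qed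
    have "integral\<^sup>L M (\<lambda>x. ln (q x)) \<ge> 0"
    proof (rule H.cocycle_integral_nonneg[OF w(1) w(3) w(2) _ _ _ _ _ LH M ac inv])
      show "q \<in> borel_measurable borel" unfolding q_def[abs_def] using farb by measurable
      show "0 < (1 + 2 * \<epsilon>) * \<theta>" using \<epsilon> \<theta> by simp
      have "(1 + 2 * \<epsilon>) * \<theta> \<le> (1 + 2 * \<epsilon>) * 1" using \<epsilon> \<theta> by (intro mult_left_mono) auto
      thus "(1 + 2 * \<epsilon>) * \<theta> \<le> q x" "q x \<le> 1 + 2 * \<epsilon>" for x by (auto simp: q_def)
      show "q (x + 1) = q x" for x by (simp add: q_def far_step)
    qed
    also have "(\<lambda>x. ln (q x)) = (\<lambda>x. ln (1 + 2 * \<epsilon>) - c * indicator far x)"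
      using \<epsilon> \<theta> by (auto simp: q_def c_def ln_mult fun_eq_iff)
    also have "integral\<^sup>L M \<dots> = ln (1 + 2 * \<epsilon>) - c * measure M (far \<inter> {0..<1})"
    proof -
      have "far \<inter> {0..<1} \<in> sets M" using farb prob_on_M_space[OF M] by auto
      hence "integrable M (indicator (far \<inter> {0..<1}) :: real \<Rightarrow> real)" by (simp add: less_top[symmetric])
      moreover have "integral\<^sup>L M (\<lambda>x. ln (1 + 2 * \<epsilon>) - c * indicator far x)
        = integral\<^sup>L M (\<lambda>x. ln (1 + 2 * \<epsilon>) - c * indicator (far \<inter> {0..<1}) x)"
        by (rule Bochner_Integration.integral_cong) (auto simp: sp indicator_def)
      ultimately show ?thesis
        using \<open>far \<inter> {0..<1} \<in> sets M\<close> by (simp add: prob_space)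
    qed
    finally have "c * measure M (far \<inter> {0..<1}) \<le> ln (1 + 2 * \<epsilon>)" by simp
    also have "\<dots> \<le> 2 * \<epsilon>" using \<epsilon> by (intro ln_add_one_self_le_self) simp
    also have "\<dots> = c * \<kappa>" by (simp add: \<epsilon>_def)
    finally have "measure M (far \<inter> {0..<1}) \<le> \<kappa>" using c by (rule mult_left_le_imp_le)
    moreover have "far \<inter> {0..<1} = {x \<in> {0..<1}. \<forall>k::int. \<delta> \<le> \<bar>x - of_int k\<bar>}" by (auto simp: far_def)
    ultimately show ?thesis by simp
  qed
  thus ?thesis using \<eta>(1) by blast
qed

end

section \<open>Entropy bound for expanding maps\<close>

text \<open>The arcs have length \<open>1/N\<close> and are centred at the multiples of \<open>1/N\<close>, so that the
  neutral point \<open>0\<close> is interior to the arc of index \<open>0\<close>.\<close>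

definition arc_code :: "nat \<Rightarrow> real \<Rightarrow> int" where
  "arc_code N x = \<lfloor>real N * x + 1 / 2\<rfloor> mod int N"

lemma arc_code_step: "arc_code N (x + 1) = arc_code N x"
proof -
  have "real N * (x + 1) + 1 / 2 = real N * x + 1 / 2 + of_int (int N)" by (simp add: algebra_simps)
  thus ?thesis unfolding arc_code_def by (metis floor_add_int mod_add_self2)
qed

lemma arc_code_eq_close:
  assumes N: "N > 0" and eq: "arc_code N x = arc_code N y"
  shows "\<exists>k::int. \<bar>x - y - of_int k\<bar> < 1 / real N"
proof -
  define a c where "a = \<lfloor>real N * x + 1 / 2\<rfloor>" and "c = \<lfloor>real N * y + 1 / 2\<rfloor>"
  have "int N dvd a - c" using eq unfolding arc_code_def a_def c_def by (simp add: mod_eq_dvd_iff)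
  then obtain k where k: "a - c = int N * k" by (elim dvdE)
  have "\<bar>(real N * x - real N * y) - (of_int a - of_int c)\<bar> < 1" unfolding a_def c_def by linarith
  moreover have "of_int a - of_int c = real N * of_int k" using k by (metis of_int_diff of_int_mult of_int_of_nat_eq)
  ultimately have "\<bar>real N * (x - y - of_int k)\<bar> < 1" by (simp add: algebra_simps)
  hence "real N * \<bar>x - y - of_int k\<bar> < 1" by (simp add: abs_mult)
  thus ?thesis using N by (intro exI[of _ k]) (simp add: field_simps)
qed

lemma arc_code_nonzero_far:
  assumes N: "N > 0" and nz: "arc_code N x \<noteq> 0"
  shows "1 / (2 * real N) \<le> \<bar>x - of_int k\<bar>"
proof (rule ccontr)
  assume "\<not> 1 / (2 * real N) \<le> \<bar>x - of_int k\<bar>"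
  hence "real N * \<bar>x - of_int k\<bar> < 1 / 2" using N by (simp add: field_simps)
  hence "\<bar>real N * (x - of_int k)\<bar> < 1 / 2" by (simp add: abs_mult)
  hence "\<bar>real N * x - of_int (int N * k)\<bar> < 1 / 2" by (simp add: algebra_simps)
  hence "\<lfloor>real N * x + 1 / 2\<rfloor> = int N * k" by linarith
  thus False using nz by (simp add: arc_code_def)
qed

lemma arc_code_simple:
  assumes M: "prob_on_M M" and N: "N > 0"
  shows "simple_function M (arc_code N)" "arc_code N ` space M \<subseteq> {0..<int N}"
proof -
  show sub: "arc_code N ` space M \<subseteq> {0..<int N}" using N by (auto simp: arc_code_def)
  have f: "(\<lambda>x. \<lfloor>real N * x + 1 / 2\<rfloor>) \<in> borel \<rightarrow>\<^sub>M count_space UNIV" by measurable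
  have "arc_code N \<in> borel \<rightarrow>\<^sub>M count_space UNIV"
    unfolding arc_code_def[abs_def] by (rule measurable_compose[OF f]) simp
  hence "arc_code N -` {j} \<inter> space borel \<in> sets borel" for j by (rule measurable_sets) simp
  hence "arc_code N -` {j} \<inter> space M \<in> sets M" for j
    using prob_on_M_space[OF M] by auto
  moreover have "finite (arc_code N ` space M)" using sub by (rule finite_subset) simp
  ultimately show "simple_function M (arc_code N)" by (simp add: simple_function_def)
qed

text \<open>Up to end points, the arc of index 0 is the neighbourhood of 0 of radius 1 / (2 N) on
  the circle. It has mass m >= 1 - \<kappa>, and eta m <= 1 - m handles it; every other arc has mass
  at most \<kappa>.\<close>

lemma ent_arc_code_le:
  assumes M: "prob_on_M M" and N: "N > 0"
    and \<kappa>: "measure M {x \<in> {0..<1}. \<forall>k::int. 1 / (2 * real N) \<le> \<bar>x - of_int k\<bar>} \<le> \<kappa>"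
  shows "ent M (arc_code N) \<le> \<kappa> + real N * (2 * sqrt \<kappa>)"
proof -
  interpret prob_space M using M by (simp add: prob_on_M_def)
  have sp: "space M = {0..<1}" using prob_on_M_space[OF M] by simp
  define far where "far = {x \<in> {0..<1::real}. \<forall>k::int. 1 / (2 * real N) \<le> \<bar>x - of_int k\<bar>}"
  define A where "A j = arc_code N -` {j} \<inter> space M" for j
  have \<kappa>0: "\<kappa> \<ge> 0" using \<kappa> measure_nonneg order_trans by blast
  have AM: "A j \<in> sets M" for j unfolding A_def by (rule simple_functionD(2)[OF arc_code_simple(1)[OF M N]])
  have farM: "far \<in> sets M"
  proof -
    have "far = {0..<1} \<inter> (\<Inter>k::int. {x. 1 / (2 * real N) \<le> \<bar>x - of_int k\<bar>})" by (auto simp: far_def)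
    moreover have "closed {x::real. 1 / (2 * real N) \<le> \<bar>x - of_int k\<bar>}" for k :: int
      by (intro closed_Collect_le continuous_intros)
    hence "closed (\<Inter>k::int. {x::real. 1 / (2 * real N) \<le> \<bar>x - of_int k\<bar>})" by blast
    hence "(\<Inter>k::int. {x::real. 1 / (2 * real N) \<le> \<bar>x - of_int k\<bar>}) \<in> sets borel" by (rule borel_closed)
    ultimately have "far \<in> sets borel" by simp
    thus ?thesis using prob_on_M_space(2)[OF M] by (auto simp: far_def)
  qed
  have Aj: "measure M (A j) \<le> \<kappa>" if "j \<noteq> 0" for j
  proof -
    have "A j \<subseteq> far" using arc_code_nonzero_far[OF N] that sp by (auto simp: A_def far_def)
    hence "measure M (A j) \<le> measure M far" by (rule finite_measure_mono[OF _ farM])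
    thus ?thesis using \<kappa> by (simp add: far_def)
  qed
  have "space M - A 0 \<subseteq> far" using arc_code_nonzero_far[OF N] sp by (auto simp: A_def far_def)
  hence "measure M (space M - A 0) \<le> measure M far" by (rule finite_measure_mono[OF _ farM])
  hence A0: "1 - measure M (A 0) \<le> \<kappa>" using \<kappa> prob_compl[OF AM[of 0]] by (simp add: far_def)
  have eta0: "eta (measure M (A 0)) \<le> \<kappa>"
  proof (cases "measure M (A 0) = 0")
    case True thus ?thesis using \<kappa>0 by (simp add: eta_def)
  next
    case False
    define m where "m = measure M (A 0)"
    have m: "m > 0" using False by (simp add: m_def zero_less_measure_iff)
    have "ln (1 / m) \<le> 1 / m - 1" using m by (intro ln_le_minus_one) auto
    hence "m * ln (1 / m) \<le> m * (1 / m - 1)" using m by (intro mult_left_mono) auto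
    moreover have "m * (1 / m - 1) = 1 - m" using m by (simp add: field_simps)
    moreover have "eta m = m * ln (1 / m)" using m by (simp add: eta_eq ln_divide_pos)
    ultimately show ?thesis using A0 by (simp add: m_def)
  qed
  have "ent M (arc_code N) = (\<Sum>j\<in>{0..<int N}. eta (measure M (A j)))"
    unfolding A_def by (rule ent_superset[OF _ arc_code_simple(2)[OF M N]]) simp
  also have "\<dots> \<le> (\<Sum>j\<in>{0..<int N}. (if j = 0 then \<kappa> else 0) + 2 * sqrt \<kappa>)"
  proof (intro sum_mono)
    fix j
    have sq: "0 \<le> 2 * sqrt \<kappa>" using \<kappa>0 by simp
    show "eta (measure M (A j)) \<le> (if j = 0 then \<kappa> else 0) + 2 * sqrt \<kappa>"
    proof (cases "j = 0")
      case True
      have "eta (measure M (A 0)) \<le> \<kappa> + 2 * sqrt \<kappa>" using eta0 sq by linarith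
      thus ?thesis using True by simp
    next
      case False
      have "eta (measure M (A j)) \<le> 2 * sqrt (measure M (A j))" by (rule eta_le_sqrt) simp
      also have "\<dots> \<le> 2 * sqrt \<kappa>" using Aj[OF False] by simp
      finally show ?thesis using False by simp
    qed
  qed
  also have "\<dots> = \<kappa> + real N * (2 * sqrt \<kappa>)" using N by (simp add: sum.distrib)
  finally show ?thesis .
qed

context circle_lift begin

lemma frac_G: "frac (G (frac x)) = frac (G x)"
proof -
  have "G x = G (frac x + of_int \<lfloor>x\<rfloor>)" by (simp add: frac_def)
  also have "\<dots> = G (frac x) + of_int (int d * \<lfloor>x\<rfloor>)" by (simp add: G_int)
  finally have "frac (G x) = frac (G (frac x) + of_int (int d * \<lfloor>x\<rfloor>))" by simp
  also have "\<dots> = frac (G (frac x))" unfolding frac_def by (subst floor_add_int[symmetric]) simp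
  finally show ?thesis by simp
qed

lemma circle_map_funpow: "(circle_map G ^^ j) (frac x) = frac ((G ^^ j) x)"
  by (induction j) (simp_all add: circle_map_def frac_G)

lemma funpow_differentiable: "\<exists>D. ((G ^^ n) has_real_derivative D) (at x)"
proof (induction n)
  case 0 show ?case by (auto intro: DERIV_ident)
next
  case (Suc n)
  then obtain D where D: "((G ^^ n) has_real_derivative D) (at x)" by blast
  have "((\<lambda>x. G ((G ^^ n) x)) has_real_derivative G' ((G ^^ n) x) * D) (at x)"
    by (rule DERIV_chain2[OF G_deriv D])
  thus ?case by (auto simp: o_def)
qed

lemma funpow_mvt: "\<exists>\<xi>. (G ^^ n) x - (G ^^ n) y = (x - y) * deriv (G ^^ n) \<xi>"
proof -
  have D: "((G ^^ n) has_real_derivative deriv (G ^^ n) z) (at z)" for z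
    using funpow_differentiable[of n z] DERIV_imp_deriv by blast
  consider "x = y" | "x < y" | "y < x" by linarith
  thus ?thesis
  proof cases
    case 1 thus ?thesis by simp
  next
    case 2
    from MVT2[OF 2, of "G ^^ n" "deriv (G ^^ n)"] D obtain \<xi>
      where "(G ^^ n) y - (G ^^ n) x = (y - x) * deriv (G ^^ n) \<xi>" by blast
    thus ?thesis by (intro exI[of _ \<xi>]) (simp add: algebra_simps)
  next
    case 3
    from MVT2[OF 3, of "G ^^ n" "deriv (G ^^ n)"] D show ?thesis by blast
  qed
qed

text \<open>Equal symbols locate points only up to an integer, which might change with time. It does
  not: lifts less than 1 / N apart have images at most B / N <= 1 / 2 apart, and as 1 / N <= 1 / 2
  the new integer has absolute value below 1, so it is 0. Hence N >= 2 * B and N >= 2.\<close>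

lemma itin_arc_code_close:
  assumes N: "real N \<ge> 2 * B" "N \<ge> 2" and B: "\<And>x. G' x \<le> B"
    and x: "x \<in> {0..<1}" and y: "y \<in> {0..<1}"
    and eq: "itin (circle_map G) (arc_code N) m x = itin (circle_map G) (arc_code N) m y"
    and m: "m > 0"
  shows "\<exists>k::int. \<forall>j<m. \<bar>(G ^^ j) x - (G ^^ j) (y + of_int k)\<bar> < 1 / real N"
proof -
  have N0: "N > 0" using N(2) by simp
  have fx: "frac x = x" "frac y = y" using x y by (auto simp: frac_eq)
  have ac_frac: "arc_code N (frac z) = arc_code N z" for z
    by (rule periodic_frac) (rule arc_code_step)
  have code_eq: "arc_code N ((G ^^ j) x) = arc_code N ((G ^^ j) (y + of_int k))" if j: "j < m" for j and k :: int
  proof -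
    have "arc_code N ((circle_map G ^^ j) x) = arc_code N ((circle_map G ^^ j) y)"
      using eq j by (auto simp: itin_def)
    moreover have "(circle_map G ^^ j) x = frac ((G ^^ j) x)" using circle_map_funpow[of j x] fx by simp
    moreover have "(circle_map G ^^ j) y = frac ((G ^^ j) (y + of_int k))"
    proof -
      have "frac (y + of_int k) = y" using fx(2) unfolding frac_def by (simp add: floor_add_int[symmetric])
      thus ?thesis using circle_map_funpow[of j "y + of_int k"] by simp
    qed
    ultimately show ?thesis by (simp add: ac_frac)
  qed
  obtain k :: int where k: "\<bar>x - y - of_int k\<bar> < 1 / real N"
    using arc_code_eq_close[OF N0, of x y] code_eq[OF m, of 0] by auto
  have "\<bar>(G ^^ j) x - (G ^^ j) (y + of_int k)\<bar> < 1 / real N" if "j < m" for j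
    using that
  proof (induction j)
    case 0 show ?case using k by (simp add: algebra_simps)
  next
    case (Suc j)
    define u v where "u = (G ^^ j) x" and "v = (G ^^ j) (y + of_int k)"
    have uv: "\<bar>u - v\<bar> < 1 / real N" using Suc by (simp add: u_def v_def)
    obtain \<xi> where "(G ^^ 1) u - (G ^^ 1) v = (u - v) * deriv (G ^^ 1) \<xi>" using funpow_mvt by blast
    moreover have "deriv G \<xi> = G' \<xi>" by (rule DERIV_imp_deriv[OF G_deriv])
    ultimately have "\<bar>G u - G v\<bar> = \<bar>u - v\<bar> * G' \<xi>" using G'_pos[of \<xi>] by (simp add: abs_mult)
    also have "\<dots> \<le> (1 / real N) * B" using uv B[of \<xi>] G'_pos[of \<xi>] by (intro mult_mono) auto
    also have "\<dots> \<le> 1 / 2" using N N0 by (simp add: field_simps)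
    finally have half: "\<bar>G u - G v\<bar> \<le> 1 / 2" .
    obtain k' :: int where k': "\<bar>G u - G v - of_int k'\<bar> < 1 / real N"
      using arc_code_eq_close[OF N0, of "G u" "G v"] code_eq[OF Suc.prems, of k] by (auto simp: u_def v_def)
    have "1 / real N \<le> 1 / 2" using N(2) by (simp add: field_simps)
    hence "\<bar>real_of_int k'\<bar> < 1" using half k' by linarith
    hence "k' = 0" by linarith
    thus ?case using k' by (simp add: u_def v_def)
  qed
  thus ?thesis by blast
qed

text \<open>The arcs generate: points with n + 1 equal symbols have lifts whose n-th images are less
  than 1 / N apart, so by uniform expansion the lifts themselves are less than 1 / (N C l^n)
  apart.\<close>

lemma ks_entropy_le_arc_code:
  assumes N: "real N \<ge> 2 * B" "N \<ge> 2" and B: "\<And>x. G' x \<le> B"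
    and exp: "uniformly_expanding G"
    and M: "prob_on_M M" and inv: "invariant_meas M (circle_map G)"
  shows "ks_entropy M (circle_map G) \<le> ereal (ent M (arc_code N))"
proof -
  interpret prob_space M using M by (simp add: prob_on_M_def)
  interpret measure_preserving M "circle_map G" by unfold_locales (use inv in \<open>auto simp: invariant_meas_def\<close>)
  have N0: "N > 0" using N(2) by simp
  obtain C l where C: "C > 0" "l > 1" "\<And>n x. \<bar>deriv (G ^^ n) x\<bar> \<ge> C * l ^ n"
    using exp unfolding uniformly_expanding_def by blast
  have Y: "simple_function M (itin (circle_map G) (arc_code N) m)" for m
    by (rule simple_itin[OF arc_code_simple(1)[OF M N0]])
  have sep: "\<exists>m. \<forall>x\<in>{0..<1}. \<forall>y\<in>{0..<1}. itin (circle_map G) (arc_code N) m x = itin (circle_map G) (arc_code N) m y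
      \<longrightarrow> (\<exists>k::int. \<bar>x - y - of_int k\<bar> < s)" if s: "s > 0" for s :: real
  proof -
    obtain n where n: "1 / (C * s) < l ^ n" using real_arch_pow[OF C(2)] by blast
    have "\<exists>k::int. \<bar>x - y - of_int k\<bar> < s"
      if xy: "x \<in> {0..<1}" "y \<in> {0..<1}"
        and eq: "itin (circle_map G) (arc_code N) (Suc n) x = itin (circle_map G) (arc_code N) (Suc n) y" for x y
    proof -
      obtain k :: int where k: "\<And>j. j < Suc n \<Longrightarrow> \<bar>(G ^^ j) x - (G ^^ j) (y + of_int k)\<bar> < 1 / real N"
        using itin_arc_code_close[OF N B xy eq] by auto
      obtain \<xi> where \<xi>: "(G ^^ n) x - (G ^^ n) (y + of_int k) = (x - (y + of_int k)) * deriv (G ^^ n) \<xi>"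
        using funpow_mvt by blast
      have "\<bar>x - (y + of_int k)\<bar> * (C * l ^ n) \<le> \<bar>x - (y + of_int k)\<bar> * \<bar>deriv (G ^^ n) \<xi>\<bar>"
        by (intro mult_left_mono C(3)) simp
      also have "\<dots> = \<bar>(G ^^ n) x - (G ^^ n) (y + of_int k)\<bar>" unfolding \<xi> abs_mult ..
      also have "\<dots> < 1 / real N" by (rule k) simp
      also have "\<dots> \<le> 1" using N0 by simp
      also have "1 < s * (C * l ^ n)" using n C(1) s by (simp add: field_simps)
      finally have "\<bar>x - (y + of_int k)\<bar> < s" using C(1,2) by (simp add: mult_less_cancel_right)
      thus ?thesis by (intro exI[of _ k]) (simp add: algebra_simps)
    qed
    thus ?thesis by (intro exI[of _ "Suc n"]) simp
  qed
  show ?thesis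
    by (rule ks_entropy_le_generator[OF arc_code_simple(1)[OF M N0] small_cells_generate[OF M Y sep]])
qed

end

section \<open>The immediate basin of the saddle-node\<close>

context circle_lift begin

lemma funpow_step: "(G ^^ n) (x + 1) = (G ^^ n) x + real d ^ n"
proof (induction n)
  case (Suc n)
  have "G ((G ^^ n) x + real d ^ n) = G ((G ^^ n) x) + real d * real d ^ n"
    using G_int[of "(G ^^ n) x" "int (d ^ n)"] by simp
  thus ?case using Suc by simp
qed simp

text \<open>For d = 1 every iterate advances by exactly 1 over a period, so its derivative equals 1
  somewhere, which contradicts expansion for large n.\<close>

lemma expanding_imp_degree_ge_2:
  assumes "uniformly_expanding G" shows "d \<ge> 2"
proof (rule ccontr)
  assume "\<not> d \<ge> 2"
  hence d1: "d = 1" using d_pos by simp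
  obtain C l where C: "C > 0" "l > 1" "\<And>n x. \<bar>deriv (G ^^ n) x\<bar> \<ge> C * l ^ n"
    using assms unfolding uniformly_expanding_def by blast
  obtain n where n: "1 / C < l ^ n" using real_arch_pow[OF C(2)] by blast
  obtain \<xi> where "(G ^^ n) 1 - (G ^^ n) 0 = (1 - 0) * deriv (G ^^ n) \<xi>" using funpow_mvt by blast
  hence "deriv (G ^^ n) \<xi> = 1" using funpow_step[of n 0] d1 by simp
  hence "C * l ^ n \<le> 1" using C(3)[of n \<xi>] by simp
  thus False using n C(1) by (simp add: field_simps)
qed

end

lemma cdist0_int: "cdist0 (y + of_int n) = cdist0 y"
proof -
  have "round (y + of_int n) = round y + n" unfolding round_def
    by (metis add.assoc add.commute floor_add_int)
  thus ?thesis by (simp add: cdist0_def)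
qed

text \<open>The setting of \<open>saddle_lift\<close> before p is known and before expansion off the
  basin has been turned into a condition on (0, p + 1].\<close>

locale neutral_lift = circle_lift +
  fixes G'' :: "real \<Rightarrow> real"
  assumes G0: "G 0 = 0" and d2: "d \<ge> 2"
    and G'0: "G' 0 = 1"
    and G''_deriv: "\<And>x. (G' has_real_derivative G'' x) (at x)"
    and G''_cont: "continuous_on UNIV G''"
    and G''0: "G'' 0 > 0"
begin

text \<open>G'' > 0 makes G' increase through the value 1 at 0, so G x - x has a strict local
  minimum there, with value 0: the fixed point attracts from the left and repels on the
  right.\<close>

lemma above_near_0: "\<exists>s>0. s < 1 \<and> (\<forall>x. -s \<le> x \<longrightarrow> x \<le> s \<longrightarrow> x \<noteq> 0 \<longrightarrow> G x > x)"
proof -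
  have "G'' \<midarrow>0\<rightarrow> G'' 0" using G''_cont by (auto simp: continuous_on_eq_continuous_at isCont_def)
  hence "\<forall>\<^sub>F z in at 0. G'' z > 0" using G''0 by (rule order_tendstoD)
  then obtain r where r: "r > 0" "\<And>z. z \<noteq> 0 \<Longrightarrow> \<bar>z\<bar> < r \<Longrightarrow> G'' z > 0"
    by (auto simp: eventually_at dist_real_def)
  define s where "s = min (r / 2) (1 / 2)"
  have s: "s > 0" "s < 1" "s < r" using r(1) by (auto simp: s_def)
  have pos: "G'' z > 0" if "-s \<le> z" "z \<le> s" for z
    using r(2)[of z] that s G''0 by (cases "z = 0") auto
  have inc: "G' x < G' y" if "-s \<le> x" "x < y" "y \<le> s" for x y
    by (rule DERIV_pos_imp_increasing[OF that(2)]) (use G''_deriv pos that in \<open>meson order_trans\<close>)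
  have "G x > x" if x: "-s \<le> x" "x \<le> s" "x \<noteq> 0" for x
  proof (cases "x > 0")
    case True
    from MVT2[OF this, of G G'] G_deriv obtain z where z: "0 < z" "z < x" "G x - G 0 = (x - 0) * G' z" by blast
    have "1 < G' z" using inc[of 0 z] z x s G'0 by simp
    hence "x * 1 < x * G' z" using True by (intro mult_strict_left_mono) auto
    thus ?thesis using z(3) G0 by simp
  next
    case False
    hence x0: "x < 0" using x by simp
    from MVT2[OF this, of G G'] G_deriv obtain z where z: "x < z" "z < 0" "G 0 - G x = (0 - x) * G' z" by blast
    have "G' z < 1" using inc[of z 0] z x s G'0 by simp
    hence "- x * G' z < - x * 1" using x0 by (intro mult_strict_left_mono) auto
    thus ?thesis using z(3) G0 by simp
  qed
  thus ?thesis using s by blast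
qed

text \<open>p is the largest fixed point in [-1, -s]. One exists because G (-1) = -d lies below -1
  while G (-s) > -s; a point x of (p, 0) with G x <= x would produce a larger one by the same
  argument.\<close>

lemma left_fixed_point: "\<exists>p. -1 < p \<and> p < 0 \<and> G p = p \<and> (\<forall>x. p < x \<longrightarrow> x < 0 \<longrightarrow> G x > x)"
proof -
  obtain s where s: "s > 0" "s < 1" and ab: "\<And>x. -s \<le> x \<Longrightarrow> x \<le> s \<Longrightarrow> x \<noteq> 0 \<Longrightarrow> G x > x"
    using above_near_0 by blast
  have ivt: "\<exists>y. x \<le> y \<and> y \<le> - s \<and> G y = y" if "x \<le> - s" "G x \<le> x" for x
  proof -
    have "\<exists>y. x \<le> y \<and> y \<le> - s \<and> G y - y = 0"
      by (rule IVT') (use that ab[of "-s"] s in \<open>auto intro!: continuous_intros G_cont\<close>)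
    thus ?thesis by auto
  qed
  have Gm1: "G (-1) = - real d" using G_step[of "-1"] G0 by simp
  define Z where "Z = {x \<in> {-1..-s}. G x = x}"
  have "closed {x. G x = x}" by (intro closed_Collect_eq G_cont continuous_on_id)
  hence "compact ({-1..-s} \<inter> {x. G x = x})" by (intro compact_Int_closed) auto
  hence cZ: "compact Z" by (simp add: Z_def Int_def)
  have "\<exists>y. -1 \<le> y \<and> y \<le> - s \<and> G y = y" by (rule ivt) (use s Gm1 d2 in auto)
  hence "Z \<noteq> {}" by (auto simp: Z_def)
  then obtain p where p: "p \<in> Z" "\<And>z. z \<in> Z \<Longrightarrow> z \<le> p" using compact_attains_sup[OF cZ] by blast
  have p': "-1 \<le> p" "p \<le> - s" "G p = p" using p(1) by (auto simp: Z_def)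
  have "p \<noteq> -1" using p'(3) Gm1 d2 by auto
  moreover have "G x > x" if x: "p < x" "x < 0" for x
  proof (rule ccontr)
    assume "\<not> G x > x"
    hence Gx: "G x \<le> x" by simp
    have "x < - s"
    proof (rule ccontr)
      assume "\<not> x < - s"
      hence "G x > x" using x s by (intro ab) auto
      thus False using Gx by simp
    qed
    then obtain y where "x \<le> y" "y \<le> - s" "G y = y" using ivt[of x] Gx by auto
    hence "y \<in> Z" using x p' by (auto simp: Z_def)
    thus False using p(2)[of y] x \<open>x \<le> y\<close> by simp
  qed
  moreover have "-1 < p" using p'(1) \<open>p \<noteq> -1\<close> by simp
  moreover have "p < 0" using p'(2) s(1) by linarith
  ultimately show ?thesis using p'(3) by blast
qed

text \<open>The component of 0 is an interval. If it contained a translate of x to the left of 0, it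
  would contain p, whose orbit keeps a constant positive distance from 0 on the circle. If it
  contained z > 0, the orbit of z could not reach p + 1, since otherwise some point of [0, z] would
  be mapped to p + 1. Staying in (0, p + 1), that orbit cannot converge to 0, because G pushes
  points to the right of 0 away from it.\<close>

lemma not_in_W0_lift:
  assumes F: "\<And>x. F x = G x + of_int k"
    and p: "-1 < p" "p < 0" "G p = p"
    and x: "0 < x" "x \<le> p + 1"
  shows "x \<notin> W0_lift F"
proof
  assume "x \<in> W0_lift F"
  then obtain n :: int where n: "x - of_int n \<in> connected_component_set (basin0 F) 0" by (auto simp: W0_lift_def)
  define z where "z = x - of_int n"
  define C where "C = connected_component_set (basin0 F) 0"
  have z: "z \<in> C" using n by (simp add: z_def C_def)
  have "0 \<in> basin0 F" using z unfolding C_def by (auto dest: connected_component_in)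
  hence C0: "0 \<in> C" by (simp add: C_def)
  have CB: "C \<subseteq> basin0 F" unfolding C_def by (rule connected_component_subset)
  have "is_interval C" unfolding C_def by (simp add: is_interval_connected_1)
  hence seg: "y \<in> basin0 F" if "u \<in> C" "v \<in> C" "u \<le> y" "y \<le> v" for u v y
    using that CB mem_is_interval_1_I[of C u v y] by blast
  have iter: "\<exists>m::int. (F ^^ j) y = (G ^^ j) y + of_int m" for j y
  proof (induction j)
    case (Suc j)
    then obtain m :: int where "(F ^^ j) y = (G ^^ j) y + of_int m" by blast
    hence "(F ^^ Suc j) y = (G ^^ Suc j) y + of_int (int d * m + k)" by (simp add: F G_int)
    thus ?case by blast
  qed (auto intro: exI[of _ 0])
  have cd: "cdist0 ((F ^^ j) y) = cdist0 ((G ^^ j) y)" for j y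
  proof -
    obtain m :: int where "(F ^^ j) y = (G ^^ j) y + of_int m" using iter by blast
    thus ?thesis by (simp add: cdist0_int)
  qed
  have basin: "(\<lambda>j. cdist0 ((G ^^ j) y)) \<longlonglongrightarrow> 0" if "y \<in> basin0 F" for y
    using that by (simp add: basin0_def cd)
  have p_orbit: "\<exists>i::int. (G ^^ j) (p + of_int m) = p + of_int i" for j m
  proof (induction j)
    case (Suc j)
    then obtain i :: int where "(G ^^ j) (p + of_int m) = p + of_int i" by blast
    hence "(G ^^ Suc j) (p + of_int m) = p + of_int (int d * i)" by (simp add: G_int p(3))
    thus ?case by blast
  qed auto
  have not_basin: "y \<notin> basin0 F" if y: "(G ^^ m) y = p + of_int i" for y m and i :: int
  proof
    assume "y \<in> basin0 F"
    from LIMSEQ_ignore_initial_segment[OF basin[OF this], of m]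
    have "(\<lambda>j. cdist0 ((G ^^ (j + m)) y)) \<longlonglongrightarrow> 0" .
    moreover have "cdist0 ((G ^^ (j + m)) y) = cdist0 p" for j
      using p_orbit[of j i] cdist0_int[of p] by (auto simp: funpow_add y)
    ultimately have "(\<lambda>j::nat. cdist0 p) \<longlonglongrightarrow> 0" by simp
    hence "cdist0 p = 0" using LIMSEQ_unique tendsto_const by blast
    hence "p = of_int (round p)" by (simp add: cdist0_def)
    hence "real_of_int (-1) < real_of_int (round p)" "real_of_int (round p) < real_of_int 0" using p by auto
    hence "-1 < round p" "round p < 0" unfolding of_int_less_iff by auto
    thus False by linarith
  qed
  show False
  proof (cases "n \<ge> 1")
    case True
    hence "z \<le> p" using x unfolding z_def by linarith
    hence "p \<in> basin0 F" using p by (intro seg[OF z C0]) auto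
    thus False using not_basin[of 0 p 0] by simp
  next
    case False
    hence z0: "z > 0" using x unfolding z_def by linarith
    define u where "u m = (G ^^ m) z" for m
    have zb: "z \<in> basin0 F" using z CB by blast
    have G0m: "(G ^^ m) 0 = 0" for m by (induction m) (auto simp: G0)
    have u0: "u m > 0" for m
    proof (induction m)
      case 0 show ?case using z0 by (simp add: u_def)
    next
      case (Suc m)
      have "G 0 < G (u m)" unfolding G_less_iff by (rule Suc)
      thus ?case by (simp add: u_def G0)
    qed
    have cont: "continuous_on A (G ^^ m)" for A m
      using funpow_differentiable by (meson DERIV_isCont continuous_at_imp_continuous_on)
    have ub: "u m < p + 1" for m
    proof (rule ccontr)
      assume "\<not> u m < p + 1"
      hence "\<exists>y. 0 \<le> y \<and> y \<le> z \<and> (G ^^ m) y = p + 1"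
        by (intro IVT') (use G0m z0 p cont in \<open>auto simp: u_def\<close>)
      then obtain y where y: "0 \<le> y" "y \<le> z" "(G ^^ m) y = p + of_int 1" by auto
      have "y \<in> basin0 F" by (rule seg[OF C0 z y(1,2)])
      thus False using not_basin[OF y(3)] by simp
    qed
    \<comment> \<open>On (0, p + 1) the nearest integer is 0 or 1, and 1 is farther away than -
      p.\<close>
    have cu: "min (u m) (- p) \<le> cdist0 (u m)" for m
    proof -
      define r where "r = round (u m)"
      have "\<bar>real_of_int r - u m\<bar> \<le> 1 / 2" unfolding r_def by (rule of_int_round_abs_le)
      hence "real_of_int r < 2" "real_of_int r > -1" using u0[of m] ub[of m] p by linarith+
      hence "r = 0 \<or> r = 1" by linarith
      thus ?thesis using u0[of m] ub[of m] by (auto simp: cdist0_def r_def[symmetric])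
    qed
    obtain s where s: "s > 0" and ab: "\<And>x. -s \<le> x \<Longrightarrow> x \<le> s \<Longrightarrow> x \<noteq> 0 \<Longrightarrow> G x > x"
      using above_near_0 by blast
    have lim: "(\<lambda>m. cdist0 (u m)) \<longlonglongrightarrow> 0" using basin[OF zb] by (simp add: u_def)
    have "\<forall>\<^sub>F m in sequentially. cdist0 (u m) < min s (- p)"
      by (rule order_tendstoD(2)[OF lim]) (use s p in simp)
    then obtain M0 where M0: "\<And>m. m \<ge> M0 \<Longrightarrow> cdist0 (u m) < min s (- p)"
      unfolding eventually_sequentially by blast
    have us: "u m < s" if "m \<ge> M0" for m using cu[of m] M0[OF that] by linarith
    have inc: "u M0 \<le> u m" if "m \<ge> M0" for m
      using that
    proof (induction m rule: dec_induct)
      case (step m)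
      have "u m < G (u m)" by (rule ab) (use us[of m] u0[of m] s step in auto)
      thus ?case using step by (simp add: u_def)
    qed simp
    have "\<forall>\<^sub>F m in sequentially. cdist0 (u m) < min (u M0) (- p)"
      by (rule order_tendstoD(2)[OF lim]) (use u0 p in simp)
    then obtain M1 where M1: "\<And>m. m \<ge> M1 \<Longrightarrow> cdist0 (u m) < min (u M0) (- p)"
      unfolding eventually_sequentially by blast
    show False
      using M1[OF max.cobounded2, of M0] inc[OF max.cobounded1, of M1] cu[of "max M0 M1"] by linarith
  qed
qed

end

section \<open>Smooth families\<close>

lemma partial_derivative_fst:
  assumes "(f has_derivative f') (at (x, t))"
  shows "((\<lambda>x. f (x, t)) has_real_derivative f' (1, 0)) (at x)"
proof -
  have "((\<lambda>x. (x, t)) has_derivative (\<lambda>h. (h, 0))) (at x)" by (auto intro!: derivative_eq_intros)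
  from has_derivative_compose[OF this assms]
  have "((\<lambda>x. f (x, t)) has_derivative (\<lambda>h. f' (h, 0))) (at x)" .
  moreover have "f' (h, 0) = f' (1, 0) * h" for h :: real
    using linear_scale[OF has_derivative_linear[OF assms], of h "(1, 0)"] by (simp add: mult.commute)
  hence "(\<lambda>h. f' (h, 0)) = (*) (f' (1, 0))" by (rule ext)
  ultimately show ?thesis unfolding has_field_derivative_def by metis
qed

lemma C1_on_continuous: "C1_on U f \<Longrightarrow> continuous_on U f"
proof -
  assume "C1_on U f"
  then obtain f' where "\<forall>p\<in>U. (f has_derivative f' p) (at p)" unfolding C1_on_def by blast
  thus ?thesis by (intro continuous_at_imp_continuous_on ballI) (blast intro: has_derivative_continuous)
qed

lemma C2_on_partials:
  fixes F :: "real \<Rightarrow> real \<Rightarrow> real"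
  assumes C2: "C2_on (UNIV \<times> I) (\<lambda>(x, t). F t x)"
  obtains D E where
    "\<And>t x. t \<in> I \<Longrightarrow> (F t has_real_derivative D (x, t)) (at x)"
    "continuous_on (UNIV \<times> I) D" "continuous_on (UNIV \<times> I) (\<lambda>(x, t). F t x)"
    "\<And>t x. t \<in> I \<Longrightarrow> ((\<lambda>x. D (x, t)) has_real_derivative E (x, t)) (at x)"
    "continuous_on (UNIV \<times> I) E"
proof -
  obtain g' where g': "\<And>p. p \<in> UNIV \<times> I \<Longrightarrow> ((\<lambda>(x, t). F t x) has_derivative g' p) (at p)"
    "\<And>v. C1_on (UNIV \<times> I) (\<lambda>p. g' p v)" using C2 unfolding C2_on_def by blast
  define D where "D p = g' p (1, 0)" for p
  have C1: "C1_on (UNIV \<times> I) D" unfolding D_def[abs_def] by (rule g'(2))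
  then obtain g'' where g'': "\<And>p. p \<in> UNIV \<times> I \<Longrightarrow> (D has_derivative g'' p) (at p)"
    "\<And>v. continuous_on (UNIV \<times> I) (\<lambda>p. g'' p v)" unfolding C1_on_def by blast
  define E where "E p = g'' p (1, 0)" for p
  show ?thesis
  proof (rule that)
    show "(F t has_real_derivative D (x, t)) (at x)" if "t \<in> I" for t x
      using partial_derivative_fst[OF g'(1)[of "(x, t)"]] that by (simp add: D_def)
    show "continuous_on (UNIV \<times> I) D" by (rule C1_on_continuous[OF C1])
    show "continuous_on (UNIV \<times> I) (\<lambda>(x, t). F t x)"
      by (intro continuous_at_imp_continuous_on ballI) (blast intro: has_derivative_continuous g'(1))
    show "((\<lambda>x. D (x, t)) has_real_derivative E (x, t)) (at x)" if "t \<in> I" for t x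
      using partial_derivative_fst[OF g''(1)[of "(x, t)"]] that by (simp add: E_def)
    show "continuous_on (UNIV \<times> I) E" unfolding E_def[abs_def] by (rule g''(2))
  qed
qed

text \<open>x is confined to one period so that compactness applies; periodicity supplies the
  remaining x at the point of use.\<close>

lemma uniform_limit_in_parameter:
  fixes f :: "real \<times> real \<Rightarrow> real"
  assumes f: "continuous_on (UNIV \<times> {-a<..<a}) f" and a: "a > 0" and \<eta>: "\<eta> > 0"
  shows "\<exists>\<tau>>0. \<forall>t x. \<bar>t\<bar> < \<tau> \<longrightarrow> 0 \<le> x \<longrightarrow> x \<le> 1 \<longrightarrow> \<bar>f (x, t) - f (x, 0)\<bar> \<le> \<eta>"
proof -
  let ?K = "{0..1::real} \<times> {-a/2..a/2}"
  have uc: "uniformly_continuous_on ?K f"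
  proof (rule compact_uniformly_continuous)
    show "continuous_on ?K f" by (rule continuous_on_subset[OF f]) (use a in auto)
    show "compact ?K" by (intro compact_Times compact_Icc)
  qed
  have "\<exists>s>0. \<forall>p\<in>?K. \<forall>q\<in>?K. dist q p < s \<longrightarrow> dist (f q) (f p) < \<eta>"
    by (rule uc[unfolded uniformly_continuous_on_def, THEN spec, THEN mp, OF \<eta>])
  then obtain s where s: "s > 0" "\<forall>p\<in>?K. \<forall>q\<in>?K. dist q p < s \<longrightarrow> dist (f q) (f p) < \<eta>" by blast
  define \<tau> where "\<tau> = min s (a / 2)"
  have \<tau>: "\<tau> > 0" "\<tau> \<le> s" "\<tau> \<le> a / 2" using s(1) a by (auto simp: \<tau>_def)
  have "\<bar>f (x, t) - f (x, 0)\<bar> \<le> \<eta>" if t: "\<bar>t\<bar> < \<tau>" and x: "0 \<le> x" "x \<le> 1" for t x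
  proof -
    have "-a/2 \<le> t" "t \<le> a/2" using t \<tau>(3) by linarith+
    hence "(x, 0) \<in> ?K" "(x, t) \<in> ?K" using x a by auto
    moreover have "dist (x, t) (x, 0) < s" using t \<tau>(2) by (simp add: dist_Pair_Pair dist_real_def)
    ultimately have "dist (f (x, t)) (f (x, 0)) < \<eta>" using s(2) by blast
    thus ?thesis by (simp add: dist_real_def)
  qed
  with \<tau>(1) show ?thesis by blast
qed

lemma connected_nonzero_pos:
  fixes f :: "'a::topological_space \<Rightarrow> real"
  assumes "connected U" "continuous_on U f" "\<And>p. p \<in> U \<Longrightarrow> f p \<noteq> 0" "p0 \<in> U" "f p0 > 0" "p \<in> U"
  shows "f p > 0"
proof (rule ccontr)
  assume "\<not> f p > 0"
  hence le: "f p \<le> 0" by simp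
  have int: "is_interval (f ` U)"
    unfolding is_interval_connected_1 by (rule connected_continuous_image[OF assms(2,1)])
  have "0 \<in> f ` U"
    by (rule mem_is_interval_1_I[OF int imageI[OF assms(6)] imageI[OF assms(4)] le less_imp_le[OF assms(5)]])
  then obtain q where q: "q \<in> U" "f q = 0" by auto
  show False using assms(3)[OF q(1)] q(2) by contradiction
qed

lemma Limsup_ereal_le_0:
  fixes f :: "'a \<Rightarrow> ereal"
  assumes F: "\<And>e::real. e > 0 \<Longrightarrow> \<forall>\<^sub>F x in F. f x \<le> ereal e"
  shows "Limsup F f \<le> 0"
proof (rule ereal_le_epsilon2)
  fix e :: real assume "e > 0"
  thus "Limsup F f \<le> 0 + ereal e" using Limsup_bounded[OF F] by simp
qed

theorem theorem4p4:
  fixes F :: "real \<Rightarrow> real \<Rightarrow> real"   \<comment> \<open>F t is a lift of f_t to R\<close>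
    and t1 t0 :: real
    and \<mu> :: "real \<Rightarrow> real measure"
    and \<mu>0 :: "real measure"
  assumes t1_pos: "t1 > 0"
    \<comment> \<open>one-parameter family of C^2 local diffeomorphisms of M = R/Z\<close>
    and C2: "C2_on (UNIV \<times> {-t1<..<t1}) (\<lambda>(x, t). F t x)"
    and lift: "\<And>t. t \<in> {-t1<..<t1} \<Longrightarrow> \<exists>d::int. \<forall>x. F t (x + 1) = F t x + of_int d"
    and local_diffeo: "\<And>t x. t \<in> {-t1<..<t1} \<Longrightarrow> deriv (F t) x \<noteq> 0"
    \<comment> \<open>0 is a saddle-node fixed point of f_0, the unique one\<close>
    and fix0: "F 0 0 \<in> \<int>"
    and d1: "deriv (F 0) 0 = 1"
    and d2: "deriv (deriv (F 0)) 0 > 0"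
    and unique_sn: "\<And>y. F 0 y - y \<in> \<int> \<Longrightarrow> deriv (F 0) y = 1 \<Longrightarrow> y \<in> \<int>"
    \<comment> \<open>expansion outside W_0\<close>
    and expand: "\<And>x. x \<notin> W0_lift (F 0) \<Longrightarrow> \<bar>deriv (F 0) x\<bar> > 1"
    \<comment> \<open>generic unfolding\<close>
    and dt: "deriv (\<lambda>t. F t 0) 0 > 0"
    \<comment> \<open>t0\<close>
    and t0_pos: "t0 > 0" and t0_le: "t0 \<le> t1"
    and unif_exp: "\<And>t. t \<in> {0<..<t0} \<Longrightarrow> uniformly_expanding (F t)"
    and mu_acip: "\<And>t. t \<in> {0<..<t0} \<Longrightarrow> acip (\<mu> t) \<and> ergodic_meas (\<mu> t) (circle_map (F t))"
    and mu_unique: "\<And>t \<nu>. t \<in> {0<..<t0} \<Longrightarrow> acip \<nu> \<Longrightarrow> ergodic_meas \<nu> (circle_map (F t))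
                      \<Longrightarrow> \<nu> = \<mu> t"
    \<comment> \<open>\<mu>0 is a weak* accumulation point of \<mu>_t as t \<rightarrow> 0+\<close>
    and mu0_prob: "prob_on_M \<mu>0"
    and accum: "\<And>(\<Phi> :: (real \<Rightarrow> real) set) (\<epsilon>::real). finite \<Phi> \<Longrightarrow>
                  (\<forall>\<phi>\<in>\<Phi>. continuous_on UNIV \<phi> \<and> (\<forall>x. \<phi> (x + 1) = \<phi> x)) \<Longrightarrow> \<epsilon> > 0 \<Longrightarrow>
                  (\<exists>\<^sub>F t in at_right 0. \<forall>\<phi>\<in>\<Phi>.
                       \<bar>integral\<^sup>L (\<mu> t) \<phi> - integral\<^sup>L \<mu>0 \<phi>\<bar> < \<epsilon>)"
  shows "Limsup (at_right 0) (\<lambda>t. ks_entropy (\<mu> t) (circle_map (F t)))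
           \<le> ks_entropy \<mu>0 (circle_map (F 0))"
proof -
  define I where "I = {-t1<..<t1}"
  have I0: "0 \<in> I" using t1_pos by (simp add: I_def)
  obtain D E where
    D: "\<And>t x. t \<in> I \<Longrightarrow> (F t has_real_derivative D (x, t)) (at x)"
      "continuous_on (UNIV \<times> I) D" "continuous_on (UNIV \<times> I) (\<lambda>(x, t). F t x)"
    and E: "\<And>t x. t \<in> I \<Longrightarrow> ((\<lambda>x. D (x, t)) has_real_derivative E (x, t)) (at x)"
      "continuous_on (UNIV \<times> I) E"
    using C2_on_partials[of I F] C2 unfolding I_def by blast
  have derivF: "deriv (F t) x = D (x, t)" if "t \<in> I" for t x
    by (rule DERIV_imp_deriv[OF D(1)[OF that]])
  have slice: "continuous_on UNIV (\<lambda>x. h (x, t))" if "continuous_on (UNIV \<times> I) h" "t \<in> I" for h :: "real \<times> real \<Rightarrow> real" and t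
    by (rule continuous_on_compose2[OF that(1)]) (use that(2) in \<open>auto intro!: continuous_intros\<close>)
  have D00: "D (0, 0) = 1" using derivF[OF I0, of 0] d1 by simp
  have E00: "E (0, 0) > 0"
  proof -
    have "deriv (F 0) = (\<lambda>x. D (x, 0))" using derivF[OF I0] by (rule ext)
    thus ?thesis using d2 DERIV_imp_deriv[OF E(1)[OF I0, of 0]] by simp
  qed
  \<comment> \<open>The derivative has no zero on the connected strip and equals 1 at (0, 0), so
    every \<open>F t\<close> preserves orientation.\<close>
  have Dpos: "D p > 0" if p: "p \<in> UNIV \<times> I" for p
  proof (rule connected_nonzero_pos[OF _ D(2) _ _ _ p])
    have "convex ((UNIV :: real set) \<times> I)" unfolding I_def by (intro convex_Times convex_UNIV convex_real_interval)
    thus "connected ((UNIV :: real set) \<times> I)" by (rule convex_connected)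
    show "D q \<noteq> 0" if q: "q \<in> UNIV \<times> I" for q
    proof -
      have "snd q \<in> I" using q by (simp add: mem_Times_iff)
      thus ?thesis using local_diffeo[of "snd q" "fst q"] derivF[of "snd q" "fst q"] by (simp add: I_def)
    qed
    show "(0, 0) \<in> UNIV \<times> I" using I0 by simp
    show "D (0, 0) > 0" by (simp add: D00)
  qed
  define dd where "dd t = F t 1 - F t 0" for t
  have dd_int: "\<exists>n::int. dd t = of_int n" and dd_step: "F t (x + 1) = F t x + dd t" if t: "t \<in> I" for t x
  proof -
    obtain n :: int where n: "\<forall>x. F t (x + 1) = F t x + of_int n" using lift[of t] t unfolding I_def by blast
    have "dd t = of_int n" using spec[OF n, of 0] by (simp add: dd_def)
    thus "\<exists>n::int. dd t = of_int n" "F t (x + 1) = F t x + dd t" using n by auto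
  qed
  have dd_pos: "dd t > 0" if t: "t \<in> I" for t
  proof -
    have "F t 0 < F t 1"
      by (rule DERIV_pos_imp_increasing) (use D(1)[OF t] Dpos t in \<open>auto intro!: exI[of _ "D (x, t)" for x]\<close>)
    thus ?thesis by (simp add: dd_def)
  qed
  obtain n0 :: int where n0: "dd 0 = of_int n0" using dd_int[OF I0] by blast
  have "n0 > 0" using dd_pos[OF I0] n0 by simp
  define d where "d = nat n0"
  have d: "dd 0 = real d" using n0 \<open>n0 > 0\<close> by (simp add: d_def)
  have near: "\<exists>\<tau>>0. \<forall>t x. \<bar>t\<bar> < \<tau> \<longrightarrow> 0 \<le> x \<longrightarrow> x \<le> 1 \<longrightarrow> \<bar>f (x, t) - f (x, 0)\<bar> \<le> \<eta>"
    if "continuous_on (UNIV \<times> I) f" "\<eta> > 0" for f :: "real \<times> real \<Rightarrow> real" and \<eta>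
    using uniform_limit_in_parameter[of t1 f \<eta>] that t1_pos unfolding I_def by blast
  obtain \<tau>0 where \<tau>0: "\<tau>0 > 0" "\<And>t x. \<bar>t\<bar> < \<tau>0 \<Longrightarrow> 0 \<le> x \<Longrightarrow> x \<le> 1 \<Longrightarrow> \<bar>F t x - F 0 x\<bar> \<le> 1 / 4"
    using near[OF D(3), of "1 / 4"] by auto
  \<comment> \<open>The degree is an integer and moves by at most 1 / 2 within this range of t, so
    it is constant there.\<close>
  have dd_eq: "dd t = real d" if t: "t \<in> I" "\<bar>t\<bar> < \<tau>0" for t
  proof -
    obtain n :: int where n: "dd t = of_int n" using dd_int[OF t(1)] by blast
    have "\<bar>F t 0 - F 0 0\<bar> \<le> 1 / 4" "\<bar>F t 1 - F 0 1\<bar> \<le> 1 / 4" using \<tau>0(2)[OF t(2)] by auto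
    hence "\<bar>dd t - dd 0\<bar> < 1" unfolding dd_def by linarith
    hence "\<bar>real_of_int (n - n0)\<bar> < 1" by (simp add: n n0)
    hence "n = n0" by linarith
    thus ?thesis using n n0 d by simp
  qed
  have lft: "circle_lift (\<lambda>x. F t x - c) (\<lambda>x. D (x, t)) d" if t: "t \<in> I" "\<bar>t\<bar> < \<tau>0" for t c
  proof
    fix x
    show "((\<lambda>x. F t x - c) has_real_derivative D (x, t)) (at x)"
      using DERIV_diff[OF D(1)[OF t(1)] DERIV_const] by simp
    show "D (x, t) > 0" using Dpos t by simp
    show "F t (x + 1) - c = F t x - c + real d" using dd_step[OF t(1)] dd_eq[OF t] by simp
  qed (rule slice[OF D(2) t(1)])
  obtain k :: int where k: "F 0 0 = of_int k" using fix0 by (rule Ints_cases)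
  \<comment> \<open>\<open>fix0\<close> says that 0 is fixed on the circle; subtracting k makes it a
    fixed point of the lift and leaves the circle map unchanged.\<close>
  define G where "G x = F 0 x - of_int k" for x
  interpret G: circle_lift G "\<lambda>x. D (x, 0)" d
    unfolding G_def[abs_def] by (rule lft[OF I0]) (use \<tau>0 in simp)
  define t2 where "t2 = min \<tau>0 t0"
  have t2: "t2 > 0" "t2 \<le> \<tau>0" "t2 \<le> t0" using \<tau>0 t0_pos by (auto simp: t2_def)
  have tI: "t \<in> I" "\<bar>t\<bar> < \<tau>0" "t \<in> {0<..<t0}" if "0 < t" "t < t2" for t
    using that t2 t0_le t1_pos by (auto simp: I_def)
  \<comment> \<open>The degree of \<open>F 0\<close> is that of \<open>F t\<close> for small t > 0,
    where uniform expansion forces it to be at least 2.\<close>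
  have d2': "d \<ge> 2"
  proof -
    have t: "0 < t2 / 2" "t2 / 2 < t2" using t2 by auto
    interpret A: circle_lift "F (t2 / 2)" "\<lambda>x. D (x, t2 / 2)" d
      using lft[OF tI(1,2)[OF t], of 0] by simp
    show ?thesis by (rule A.expanding_imp_degree_ge_2[OF unif_exp[OF tI(3)[OF t]]])
  qed
  interpret G: neutral_lift G "\<lambda>x. D (x, 0)" d "\<lambda>x. E (x, 0)"
    by unfold_locales (use d2' D00 E00 E(1)[OF I0] slice[OF E(2) I0] in \<open>auto simp: G_def k\<close>)
  obtain p where p: "-1 < p" "p < 0" "G p = p" "\<And>x. p < x \<Longrightarrow> x < 0 \<Longrightarrow> G x > x"
    using G.left_fixed_point by blast
  \<comment> \<open>Points of (0, p + 1] lie outside W_0, so the expansion hypothesis applies to all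
    of them.\<close>
  interpret S: saddle_lift G "\<lambda>x. D (x, 0)" d "\<lambda>x. E (x, 0)" p
  proof
    fix x :: real assume x: "0 < x" "x \<le> p + 1"
    have "x \<notin> W0_lift (F 0)" by (rule G.not_in_W0_lift[OF _ p(1-3) x, of _ k]) (simp add: G_def)
    from expand[OF this] show "D (x, 0) > 1" using derivF[OF I0, of x] Dpos[of "(x, 0)"] I0 by simp
  qed (use G.G0 d2' p G.G'0 G.G''_deriv G.G''_cont G.G''0 in auto)
  obtain B0 where B0: "B0 > 0" "\<And>x. D (x, 0) \<le> B0" using G.G'_bounds by blast
  \<comment> \<open>B bounds the derivative of \<open>F t\<close> as soon as it is within 1 of that
    of \<open>F 0\<close>, so one N serves all small t.\<close>
  define B where "B = B0 + 1"
  define N where "N = max 2 (nat \<lceil>2 * B\<rceil>)"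
  have N: "real N \<ge> 2 * B" "N \<ge> 2"
  proof -
    have "2 * B \<le> real (nat \<lceil>2 * B\<rceil>)" by (rule real_nat_ceiling_ge)
    also have "\<dots> \<le> real N" by (simp add: N_def)
    finally show "real N \<ge> 2 * B" .
  qed (simp add: N_def)
  have N0: "N > 0" using N(2) by simp
  have close: "\<exists>\<tau>>0. \<tau> \<le> t2 \<and> (\<forall>t. 0 < t \<longrightarrow> t < \<tau> \<longrightarrow>
      (\<forall>x. \<bar>(F t x - of_int k) - G x\<bar> \<le> \<eta> \<and> \<bar>D (x, t) - D (x, 0)\<bar> \<le> \<eta>))" if \<eta>: "\<eta> > 0" for \<eta>
  proof -
    obtain \<tau>1 where \<tau>1: "\<tau>1 > 0" "\<And>t x. \<bar>t\<bar> < \<tau>1 \<Longrightarrow> 0 \<le> x \<Longrightarrow> x \<le> 1 \<Longrightarrow> \<bar>F t x - F 0 x\<bar> \<le> \<eta>"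
      using near[OF D(3) \<eta>] by auto
    obtain \<tau>2 where \<tau>2: "\<tau>2 > 0" "\<And>t x. \<bar>t\<bar> < \<tau>2 \<Longrightarrow> 0 \<le> x \<Longrightarrow> x \<le> 1 \<Longrightarrow> \<bar>D (x, t) - D (x, 0)\<bar> \<le> \<eta>"
      using near[OF D(2) \<eta>] by auto
    define \<tau> where "\<tau> = min t2 (min \<tau>1 \<tau>2)"
    have \<tau>: "\<tau> > 0" "\<tau> \<le> t2" "\<tau> \<le> \<tau>1" "\<tau> \<le> \<tau>2" using t2 \<tau>1 \<tau>2 by (auto simp: \<tau>_def)
    have "\<bar>(F t x - of_int k) - G x\<bar> \<le> \<eta> \<and> \<bar>D (x, t) - D (x, 0)\<bar> \<le> \<eta>" if t: "0 < t" "t < \<tau>" for t x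
    proof -
      have t': "t \<in> I" "\<bar>t\<bar> < \<tau>0" using tI(1,2)[of t] t \<tau> by auto
      interpret A: circle_lift "\<lambda>x. F t x - of_int k" "\<lambda>x. D (x, t)" d by (rule lft[OF t'])
      have fr: "0 \<le> frac x" "frac x \<le> 1" using frac_ge_0[of x] frac_lt_1[of x] by auto
      have "(F t (frac x) - of_int k) - G (frac x) = (F t x - of_int k) - G x"
        by (rule periodic_frac[where v="\<lambda>x. (F t x - of_int k) - G x"]) (use A.G_step G.G_step in simp)
      moreover have "\<bar>F t (frac x) - F 0 (frac x)\<bar> \<le> \<eta>" using \<tau>1(2)[of t "frac x"] t \<tau> fr by simp
      moreover have "D (frac x, t) - D (frac x, 0) = D (x, t) - D (x, 0)"
        by (rule periodic_frac[where v="\<lambda>x. D (x, t) - D (x, 0)"]) (simp only: A.G'_step G.G'_step)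
      moreover have "\<bar>D (frac x, t) - D (frac x, 0)\<bar> \<le> \<eta>" using \<tau>2(2)[of t "frac x"] t \<tau> fr by simp
      ultimately show ?thesis by (simp add: G_def)
    qed
    with \<tau>(1,2) show ?thesis by blast
  qed
  have cm: "circle_map (\<lambda>x. F t x - of_int k) = circle_map (F t)" for t
  proof
    fix x
    show "circle_map (\<lambda>x. F t x - of_int k) x = circle_map (F t) x"
      unfolding circle_map_def frac_def by simp
  qed
  \<comment> \<open>N being fixed, \<kappa> is chosen from N and e, then \<eta> from \<kappa> and
    the half arc length 1 / (2 N), and finally the range of t from \<eta>.\<close>
  have small: "\<forall>\<^sub>F t in at_right 0. ks_entropy (\<mu> t) (circle_map (F t)) \<le> ereal e" if e: "e > 0" for e :: real
  proof -
    have "((\<lambda>r. r + real N * (2 * sqrt r)) \<longlongrightarrow> 0 + real N * (2 * sqrt 0)) (at_right 0)"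
      by (intro tendsto_intros)
    hence "\<forall>\<^sub>F r in at_right 0. r + real N * (2 * sqrt r) < e"
      using e by (intro order_tendstoD(2)) auto
    then obtain r0 where r0: "r0 > 0" "\<forall>r>0. r < r0 \<longrightarrow> r + real N * (2 * sqrt r) < e"
      unfolding eventually_at_right_field by auto
    define \<kappa> where "\<kappa> = r0 / 2"
    have \<kappa>: "\<kappa> > 0" "\<kappa> + real N * (2 * sqrt \<kappa>) < e" using r0 by (auto simp: \<kappa>_def)
    have "1 / (2 * real N) > 0" using N0 by simp
    from S.concentration[OF this \<kappa>(1)] obtain \<eta> where \<eta>: "\<eta> > 0"
      "\<And>H H' M. circle_lift H H' d \<Longrightarrow> (\<forall>x. \<bar>H x - G x\<bar> \<le> \<eta> \<and> \<bar>H' x - D (x, 0)\<bar> \<le> \<eta>) \<Longrightarrow>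
        prob_on_M M \<Longrightarrow> absolutely_continuous circle_meas M \<Longrightarrow> invariant_meas M (circle_map H) \<Longrightarrow>
        measure M {x \<in> {0..<1}. \<forall>k::int. 1 / (2 * real N) \<le> \<bar>x - of_int k\<bar>} \<le> \<kappa>"
      by blast
    obtain \<tau>1 where \<tau>1: "\<tau>1 > 0" "\<tau>1 \<le> t2" "\<And>t. 0 < t \<Longrightarrow> t < \<tau>1 \<Longrightarrow>
      \<forall>x. \<bar>(F t x - of_int k) - G x\<bar> \<le> \<eta> \<and> \<bar>D (x, t) - D (x, 0)\<bar> \<le> \<eta>" using close[OF \<eta>(1)] by blast
    obtain \<tau>2 where \<tau>2: "\<tau>2 > 0" "\<And>t. 0 < t \<Longrightarrow> t < \<tau>2 \<Longrightarrow>
      \<forall>x. \<bar>(F t x - of_int k) - G x\<bar> \<le> 1 \<and> \<bar>D (x, t) - D (x, 0)\<bar> \<le> 1" using close[of 1] by auto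
    have "ks_entropy (\<mu> t) (circle_map (F t)) \<le> ereal e" if t: "0 < t" "t < min \<tau>1 \<tau>2" for t
    proof -
      have tt: "t < t2" "t < \<tau>1" "t < \<tau>2" using t \<tau>1 by auto
      note t' = tI[OF t(1) tt(1)]
      have M: "prob_on_M (\<mu> t)" and ac: "absolutely_continuous circle_meas (\<mu> t)"
        and inv: "invariant_meas (\<mu> t) (circle_map (F t))"
        using mu_acip[OF t'(3)] by (auto simp: acip_def ergodic_meas_def)
      interpret A: circle_lift "F t" "\<lambda>x. D (x, t)" d using lft[OF t'(1,2), of 0] by simp
      have DB: "D (x, t) \<le> B" for x
      proof -
        have "\<bar>D (x, t) - D (x, 0)\<bar> \<le> 1" using \<tau>2(2)[OF t(1) tt(3)] by blast
        thus ?thesis using B0(2)[of x] unfolding B_def by linarith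
      qed
      have conc: "measure (\<mu> t) {x \<in> {0..<1}. \<forall>k::int. 1 / (2 * real N) \<le> \<bar>x - of_int k\<bar>} \<le> \<kappa>"
        by (rule \<eta>(2)[OF lft[OF t'(1,2)] \<tau>1(3)[OF t(1) tt(2)] M ac]) (simp only: cm inv)
      have "ks_entropy (\<mu> t) (circle_map (F t)) \<le> ereal (ent (\<mu> t) (arc_code N))"
        by (rule A.ks_entropy_le_arc_code[OF N DB unif_exp[OF t'(3)] M inv])
      also have "\<dots> \<le> ereal (\<kappa> + real N * (2 * sqrt \<kappa>))" using ent_arc_code_le[OF M N0 conc] by simp
      also have "\<dots> \<le> ereal e" using \<kappa>(2) by simp
      finally show ?thesis .
    qed
    moreover have "min \<tau>1 \<tau>2 > 0" using \<tau>1(1) \<tau>2(1) by simp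
    ultimately show ?thesis unfolding eventually_at_right_field by blast
  qed
  have "Limsup (at_right 0) (\<lambda>t. ks_entropy (\<mu> t) (circle_map (F t))) \<le> 0"
    by (rule Limsup_ereal_le_0) (rule small)
  also have "0 \<le> ks_entropy \<mu>0 (circle_map (F 0))"
  proof (rule ks_entropy_nonneg)
    show "prob_space \<mu>0" using mu0_prob by (simp add: prob_on_M_def)
    show "circle_map (F 0) x \<in> space \<mu>0" for x
      unfolding prob_on_M_space(1)[OF mu0_prob] circle_map_def using frac_ge_0[of "F 0 x"] frac_lt_1[of "F 0 x"] by simp
  qed
  finally show ?thesis .
qed

end
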